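(* Let $n\ge 1$ be an integer, let $\alpha>-1$, and let $w_\alpha(x)=(1+|x|^2)^{(\alpha+n+1)/2}$ for $x\in\mathbb{R}^n$. Let $f\in w_\alpha\mathcal{D}'_{L^1}$ and set $u=\mathcal{K}_\alpha[f]$, with $u_y(x)=u(x,y)$ for $x\in\mathbb{R}^n$, $y>0$. Then $u_y\to f$ in $w_\alpha\mathcal{D}'_{L^1}$ as $y\to0$.
   Context: All function and distribution spaces are on $\mathbb{R}^n$. The kernel is $\mathcal{K}_\alpha(x,y)=\frac{\Gamma((\alpha+n+1)/2)}{\Gamma((\alpha+1)/2)\pi^{n/2}}\cdot\frac{y^{\alpha+1}}{(|x|^2+y^2)^{(\alpha+n+1)/2}}$ for $x\in\mathbb{R}^n$, $y>0$, and $\mathcal{K}_{\alpha,y}(x)=\mathcal{K}_\alpha(x,y)$. Translation is $\tau_\eta\varphi(x)=\varphi(x-\eta)$. $\mathcal{B}$ is the space of smooth $\varphi:\mathbb{R}^n\to\mathbb{C}$ such that $\varphi$ and all its derivatives are bounded; $\dot{\mathcal{B}}$ is the closed subspace of those $\varphi\in\mathcal{B}$ with $\partial^\beta\varphi(x)\to0$ as $|x|\to\infty$ for all multi-indices $\beta$ (topology: uniform convergence of all derivatives). $\mathcal{D}'_{L^1}$ is the dual of $\dot{\mathcal{B}}$, with the (strong) dual topology; it is a space of tempered distributions, consisting exactly of the finite sums $u=\sum_\beta\partial^\beta u_\beta$ with $u_\beta\in L^1$. $\mathcal{B}_c$ is $\mathcal{B}$ endowed with the finest locally convex topology that on bounded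 subsets of $\mathcal{B}$ induces the topology inherited from $C^\infty$; every $u\in\mathcal{D}'_{L^1}$ extends uniquely to a continuous linear form on $\mathcal{B}_c$, with pairing $\langle u,\varphi\rangle_{\mathcal{D}'_{L^1},\mathcal{B}_c}=\sum_\beta(-1)^{|\beta|}\int u_\beta\,\partial^\beta\varphi\,dx$ for $\varphi\in\mathcal{B}$. The weighted space is $w_\alpha\mathcal{D}'_{L^1}=\{u\in\mathcal{S}': w_\alpha^{-1}u\in\mathcal{D}'_{L^1}\}$ with the topology induced by the map $u\mapsto w_\alpha^{-1}u$ into $\mathcal{D}'_{L^1}$. $\mathcal{S}'$-convolution: two tempered distributions $u,v$ are $\mathcal{S}'$-convolvable if $u(\check v\ast\varphi)\in\mathcal{D}'_{L^1}$ for every $\varphi\in\mathcal{S}$, where $\check\varphi(x)=\varphi(-x)$ (extended to $\mathcal{S}'$ by duality) and $\check v\ast\varphi$ is the function $\eta\mapsto\langle v,\tau_{-\eta}\varphi\rangle_{\mathcal{S}',\mathcal{S}}$. Then $u\ast v\in\mathcal{S}'$ is defined by $\langle u\ast v,\varphi\rangle=\langle u(\check v\ast\varphi),1\rangle_{\mathcal{D}'_{L^1},\mathcal{B}_c}$. For $f\in w_\alpha\mathcal{D}'_{L^1}$ the $\mathcal{S}'$-convolution $\mathcal{K}_{\alpha,y}\ast f$ exists for every $y>0$ and is the function $x\mapsto\langle w_\alpha^{-1}f,w_\alpha\tau_x\mathcal{K}_{\alpha,y}\rangle_{\mathcal{D}'_{L^1},\mathcal{B}_c}$. The Poisson integral of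 $f$ is the function $\mathcal{K}_\alpha[f](x,y)=\mathcal{K}_{\alpha,y}\ast f(x)$, $x\in\mathbb{R}^n$, $y>0$. For each $y>0$ the function $\mathcal{K}_{\alpha,y}\ast f$ belongs to $w_\alpha\mathcal{D}'_{L^1}$, so the convergence makes sense. *)

theory Defs
  imports "HOL-Analysis.Analysis"
begin

section \<open>Locally convex spaces of complex-valued functions\<close>

text \<open>A locally convex space is given by a linear subspace \<open>V\<close> of the functions on some type
  together with a family \<open>P\<close> of seminorms on \<open>V\<close>. This covers both spaces of functions on
  Euclidean space and spaces of linear forms on such functions.\<close>

definition seminorm_on :: "('c \<Rightarrow> complex) set \<Rightarrow> (('c \<Rightarrow> complex) \<Rightarrow> real) \<Rightarrow> bool" where
  "seminorm_on V p \<longleftrightarrow>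
     (\<forall>f\<in>V. 0 \<le> p f) \<and>
     (\<forall>f\<in>V. \<forall>g\<in>V. p (\<lambda>x. f x + g x) \<le> p f + p g) \<and>
     (\<forall>c. \<forall>f\<in>V. p (\<lambda>x. c * f x) = cmod c * p f)"

definition seminorm_topology ::
    "('c \<Rightarrow> complex) set \<Rightarrow> (('c \<Rightarrow> complex) \<Rightarrow> real) set \<Rightarrow> ('c \<Rightarrow> complex) topology" where
  "seminorm_topology V P =
     topology_generated_by
       (insert V {{g \<in> V. p (\<lambda>x. g x - f x) < r} | p f r. p \<in> P \<and> f \<in> V \<and> r > 0})"

definition bounded_subset ::
    "('c \<Rightarrow> complex) set \<Rightarrow> (('c \<Rightarrow> complex) \<Rightarrow> real) set \<Rightarrow> ('c \<Rightarrow> complex) set \<Rightarrow> bool" where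
  "bounded_subset V P S \<longleftrightarrow> S \<subseteq> V \<and> (\<forall>p\<in>P. bdd_above (p ` S))"

definition linear_form_on :: "('c \<Rightarrow> complex) set \<Rightarrow> (('c \<Rightarrow> complex) \<Rightarrow> complex) \<Rightarrow> bool" where
  "linear_form_on V u \<longleftrightarrow>
     (\<forall>f\<in>V. \<forall>g\<in>V. u (\<lambda>x. f x + g x) = u f + u g) \<and>
     (\<forall>c. \<forall>f\<in>V. u (\<lambda>x. c * f x) = c * u f)"

text \<open>Linear forms on \<open>V\<close> are represented by total functions that vanish off \<open>V\<close>, so that equality
  of forms on \<open>V\<close> is equality in HOL.\<close>

definition dual_space ::
    "('c \<Rightarrow> complex) set \<Rightarrow> ('c \<Rightarrow> complex) topology \<Rightarrow> (('c \<Rightarrow> complex) \<Rightarrow> complex) set" where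
  "dual_space V T =
     {u. linear_form_on V u \<and> continuous_map T euclidean u \<and> (\<forall>f. f \<notin> V \<longrightarrow> u f = 0)}"

definition strong_seminorms ::
    "('c \<Rightarrow> complex) set \<Rightarrow> (('c \<Rightarrow> complex) \<Rightarrow> real) set \<Rightarrow> ((('c \<Rightarrow> complex) \<Rightarrow> complex) \<Rightarrow> real) set" where
  "strong_seminorms V P =
     {(\<lambda>u. SUP f\<in>S. cmod (u f)) | S. bounded_subset V P S \<and> S \<noteq> {}}"

section \<open>Smooth functions and their derivatives\<close>

definition partial :: "'n::finite \<Rightarrow> (real^'n \<Rightarrow> complex) \<Rightarrow> real^'n \<Rightarrow> complex" where
  "partial i f x = vector_derivative (\<lambda>t. f (x + t *\<^sub>R axis i 1)) (at 0)"

text \<open>Iterated partial derivatives are indexed by lists of coordinate directions. On smooth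
  functions partial derivatives commute, so the derivatives along lists are exactly the derivatives
  of multi-index type, the multi-index counting the occurrences of each direction.\<close>

primrec partials :: "'n::finite list \<Rightarrow> (real^'n \<Rightarrow> complex) \<Rightarrow> real^'n \<Rightarrow> complex" where
  "partials [] f = f"
| "partials (i # is) f = partial i (partials is f)"

definition smooth_functions :: "(real^'n::finite \<Rightarrow> complex) set" where
  "smooth_functions = {f. \<forall>is. partials is f differentiable_on UNIV}"

definition smooth_seminorms :: "((real^'n::finite \<Rightarrow> complex) \<Rightarrow> real) set" where
  "smooth_seminorms =
     {(\<lambda>f. SUP x\<in>K. cmod (partials is f x)) | is K. compact K \<and> K \<noteq> {}}"

definition smooth_topology :: "(real^'n::finite \<Rightarrow> complex) topology" where
  "smooth_topology = seminorm_topology smooth_functions smooth_seminorms"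

section \<open>Tempered distributions\<close>

definition schwartz :: "(real^'n::finite \<Rightarrow> complex) set" where
  "schwartz =
     {f \<in> smooth_functions. \<forall>N is. bdd_above (range (\<lambda>x. (1 + (norm x)\<^sup>2) ^ N * cmod (partials is f x)))}"

definition schwartz_seminorms :: "((real^'n::finite \<Rightarrow> complex) \<Rightarrow> real) set" where
  "schwartz_seminorms =
     {(\<lambda>f. SUP x. (1 + (norm x)\<^sup>2) ^ N * cmod (partials is f x)) | N is. True}"

type_synonym 'n distr = "(real^'n \<Rightarrow> complex) \<Rightarrow> complex"

definition tempered_distr :: "'n::finite distr set" where
  "tempered_distr = dual_space schwartz (seminorm_topology schwartz schwartz_seminorms)"

definition function_distr :: "(real^'n::finite \<Rightarrow> complex) \<Rightarrow> 'n distr" where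
  "function_distr g = (\<lambda>f. if f \<in> schwartz then (LINT x|lborel. g x * f x) else 0)"

definition mult_distr :: "(real^'n::finite \<Rightarrow> complex) \<Rightarrow> 'n distr \<Rightarrow> 'n distr" where
  "mult_distr m u = (\<lambda>f. if f \<in> schwartz then u (\<lambda>x. m x * f x) else 0)"

definition translate :: "real^'n::finite \<Rightarrow> (real^'n \<Rightarrow> complex) \<Rightarrow> real^'n \<Rightarrow> complex" where
  "translate h f = (\<lambda>x. f (x - h))"

section \<open>The spaces \<open>B\<close>, \<open>B_dot\<close>, \<open>B_c\<close> and integrable distributions\<close>

definition B_space :: "(real^'n::finite \<Rightarrow> complex) set" where
  "B_space = {f \<in> smooth_functions. \<forall>is. bounded (range (partials is f))}"

definition B_dot :: "(real^'n::finite \<Rightarrow> complex) set" where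
  "B_dot = {f \<in> B_space. \<forall>is. (partials is f \<longlongrightarrow> 0) at_infinity}"

definition B_seminorms :: "((real^'n::finite \<Rightarrow> complex) \<Rightarrow> real) set" where
  "B_seminorms = range (\<lambda>is f. SUP x. cmod (partials is f x))"

definition B_dot_dual :: "'n::finite distr set" where
  "B_dot_dual = dual_space B_dot (seminorm_topology B_dot B_seminorms)"

definition B_dot_dual_strong :: "'n::finite distr topology" where
  "B_dot_dual_strong = seminorm_topology B_dot_dual (strong_seminorms B_dot B_seminorms)"

text \<open>The families of seminorms on \<open>B\<close> that generate a locally convex topology inducing the topology
  of \<open>C\<^sup>\<infinity>\<close> on every bounded subset of \<open>B\<close>. The finest such topology is generated by the union of
  all of them; see \<open>B_c_topology_finest\<close> and
  \<open>B_c_topology_admissible\<close>.\<close>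

definition B_c_admissible :: "((real^'n::finite \<Rightarrow> complex) \<Rightarrow> real) set \<Rightarrow> bool" where
  "B_c_admissible P \<longleftrightarrow>
     (\<forall>p\<in>P. seminorm_on B_space p) \<and>
     (\<forall>S. bounded_subset B_space B_seminorms S \<longrightarrow>
        subtopology (seminorm_topology B_space P) S = subtopology smooth_topology S)"

definition B_c_topology :: "(real^'n::finite \<Rightarrow> complex) topology" where
  "B_c_topology = seminorm_topology B_space (\<Union>(Collect B_c_admissible))"

lemma partials_linear:
  fixes f g :: "real^'n::finite \<Rightarrow> complex"
  assumes f: "f \<in> smooth_functions" and g: "g \<in> smooth_functions"
  shows "partials is (\<lambda>x. f x + g x) = (\<lambda>x. partials is f x + partials is g x)"
    and "partials is (\<lambda>x. c * f x) = (\<lambda>x. c * partials is f x)"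
proof -
  have line: "(\<lambda>t. partials js h (x + t *\<^sub>R axis i 1)) differentiable at 0"
    if "h \<in> smooth_functions" for h :: "real^'n \<Rightarrow> complex" and js i x
  proof -
    have "partials js h differentiable at (x + 0 *\<^sub>R axis i 1)"
      using that by (auto simp: smooth_functions_def differentiable_on_def)
    then show ?thesis
      by (rule differentiable_compose) (auto intro!: derivative_intros)
  qed
  show "partials is (\<lambda>x. f x + g x) = (\<lambda>x. partials is f x + partials is g x)"
  proof (induction "is")
    case (Cons i js)
    then show ?case
      using line[OF f, of js _ i] line[OF g, of js _ i]
      by (simp add: partial_def fun_eq_iff vector_derivative_add_at)
  qed simp
  show "partials is (\<lambda>x. c * f x) = (\<lambda>x. c * partials is f x)"
  proof (induction "is")
    case (Cons i js)
    then show ?case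
      using line[OF f, of js _ i]
      by (auto simp: partial_def fun_eq_iff vector_derivative_works
          intro!: vector_derivative_at has_vector_derivative_mult_right)
  qed simp
qed

lemma smooth_functions_linear:
  assumes "f \<in> smooth_functions" "g \<in> smooth_functions"
  shows "(\<lambda>x. f x + g x) \<in> smooth_functions" and "(\<lambda>x. c * f x) \<in> smooth_functions"
  using assms by (auto simp: smooth_functions_def partials_linear[OF assms] intro!: derivative_intros)

lemma smooth_functions_diff:
  assumes "f \<in> smooth_functions" "g \<in> smooth_functions"
  shows "(\<lambda>x. f x - g x) \<in> smooth_functions"
  using smooth_functions_linear(1)[OF assms(1) smooth_functions_linear(2)[OF assms(2,2), of "-1"]]
  by simp

lemma smooth_seminorms_seminorm:
  fixes p :: "(real^'n::finite \<Rightarrow> complex) \<Rightarrow> real"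
  assumes "p \<in> smooth_seminorms"
  shows "seminorm_on smooth_functions p"
proof -
  obtain "is" K where K: "compact K" "K \<noteq> {}"
    and p: "p = (\<lambda>f. SUP x\<in>K. cmod (partials is f x))"
    using assms by (auto simp: smooth_seminorms_def)
  have bdd: "bdd_above ((\<lambda>x. cmod (partials is f x)) ` K)" if "f \<in> smooth_functions" for f
  proof -
    have "continuous_on K (partials is f)"
      using that unfolding smooth_functions_def
      by (auto intro: differentiable_imp_continuous_on differentiable_on_subset)
    then have "compact ((\<lambda>x. cmod (partials is f x)) ` K)"
      by (intro compact_continuous_image continuous_on_norm K(1))
    then show ?thesis
      by (intro bounded_imp_bdd_above compact_imp_bounded)
  qed
  show ?thesis
    unfolding seminorm_on_def
  proof (intro conjI ballI allI)
    fix f :: "real^'n \<Rightarrow> complex" assume f: "f \<in> smooth_functions"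
    obtain x where "x \<in> K" using K by auto
    then show "0 \<le> p f"
      unfolding p by (intro cSUP_upper2[OF bdd[OF f]]) auto
  next
    fix f g :: "real^'n \<Rightarrow> complex" assume fg: "f \<in> smooth_functions" "g \<in> smooth_functions"
    show "p (\<lambda>x. f x + g x) \<le> p f + p g"
      unfolding p partials_linear[OF fg]
    proof (rule cSUP_least[OF K(2)])
      fix x assume x: "x \<in> K"
      have "cmod (partials is f x + partials is g x) \<le> cmod (partials is f x) + cmod (partials is g x)"
        by (rule norm_triangle_ineq)
      also have "\<dots> \<le> (SUP x\<in>K. cmod (partials is f x)) + (SUP x\<in>K. cmod (partials is g x))"
        by (intro add_mono cSUP_upper x bdd fg)
      finally show "cmod (partials is f x + partials is g x) \<le> \<dots>" .
    qed
  next
    fix c and f :: "real^'n \<Rightarrow> complex" assume f: "f \<in> smooth_functions"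
    have *: "partials is (\<lambda>x. c * f x) = (\<lambda>x. c * partials is f x)"
      by (rule partials_linear(2)[OF f f])
    have "(SUP x\<in>K. cmod c * cmod (partials is f x)) = cmod c * (SUP x\<in>K. cmod (partials is f x))"
    proof -
      have "cmod c * (SUP x\<in>K. cmod (partials is f x)) =
          (SUP t\<in>(\<lambda>x. cmod (partials is f x)) ` K. cmod c * t)"
      proof (rule continuous_at_Sup_mono)
        show "continuous (at_left (SUP x\<in>K. cmod (partials is f x))) (\<lambda>t. cmod c * t)"
          by (intro continuous_mult continuous_const continuous_ident)
      qed (use K bdd[OF f] in \<open>auto simp: mono_def mult_left_mono\<close>)
      then show ?thesis by (simp add: image_image)
    qed
    then show "p (\<lambda>x. c * f x) = cmod c * p f"
      unfolding p * by (simp add: norm_mult)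
  qed
qed

lemma B_c_admissible_smooth_seminorms: "B_c_admissible smooth_seminorms"
  unfolding B_c_admissible_def
proof (intro conjI allI impI ballI)
  fix p :: "(real^'n \<Rightarrow> complex) \<Rightarrow> real" assume "p \<in> smooth_seminorms"
  then show "seminorm_on B_space p"
    using smooth_seminorms_seminorm[of p] by (auto simp: seminorm_on_def B_space_def)
next
  fix S :: "(real^'n \<Rightarrow> complex) set"
  assume S: "bounded_subset B_space B_seminorms S"
  let ?B = "seminorm_topology (B_space :: (real^'n \<Rightarrow> complex) set) smooth_seminorms"
  have SB: "S \<subseteq> B_space" and BC: "B_space \<subseteq> (smooth_functions :: (real^'n \<Rightarrow> complex) set)"
    using S by (auto simp: bounded_subset_def B_space_def)
  have 1: "openin (subtopology smooth_topology B_space) U" if "openin ?B U" for U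
    using that unfolding seminorm_topology_def openin_topology_generated_by_iff
  proof induction
    case (Basis s)
    then consider "s = B_space" | p f r where "p \<in> smooth_seminorms" "f \<in> B_space" "r > 0"
        "s = {g \<in> B_space. p (\<lambda>x. g x - f x) < r}"
      by auto
    then show ?case
    proof cases
      case 1
      have "openin smooth_topology smooth_functions"
        unfolding smooth_topology_def seminorm_topology_def
        by (rule topology_generated_by_Basis) simp
      then show ?thesis
        unfolding openin_subtopology using 1 BC by blast
    next
      case 2
      have "openin smooth_topology {g \<in> smooth_functions. p (\<lambda>x. g x - f x) < r}"
        unfolding smooth_topology_def seminorm_topology_def
        using 2 BC by (intro topology_generated_by_Basis) blast
      moreover have "s = {g \<in> smooth_functions. p (\<lambda>x. g x - f x) < r} \<inter> B_space"
        using 2(4) BC by blast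
      ultimately show ?thesis
        unfolding openin_subtopology by blast
    qed
  qed (auto)
  have 2: "openin ?B (U \<inter> B_space)" if "openin smooth_topology U" for U
    using that unfolding smooth_topology_def seminorm_topology_def[of smooth_functions]
      openin_topology_generated_by_iff
  proof induction
    case (Basis s)
    then consider "s = smooth_functions" | p f r where "p \<in> smooth_seminorms"
        "f \<in> smooth_functions" "r > 0" "s = {g \<in> smooth_functions. p (\<lambda>x. g x - f x) < r}"
      by auto
    then show ?case
    proof cases
      case 1
      then have "s \<inter> B_space = B_space" using BC by blast
      then show ?thesis
        unfolding seminorm_topology_def by (intro topology_generated_by_Basis) simp
    next
      case 2
      have p: "seminorm_on smooth_functions p"
        by (rule smooth_seminorms_seminorm[OF 2(1)])
      show ?thesis
      proof (subst openin_subopen, intro ballI)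
        fix g assume g: "g \<in> s \<inter> B_space"
        define e where "e = r - p (\<lambda>x. g x - f x)"
        let ?V = "{h \<in> B_space. p (\<lambda>x. h x - g x) < e}"
        have e: "e > 0" using g 2 by (auto simp: e_def)
        have "openin ?B ?V"
          unfolding seminorm_topology_def
          using 2(1) e g by (intro topology_generated_by_Basis) blast
        moreover have "p (\<lambda>x. g x - g x) = 0"
        proof -
          have "p (\<lambda>x. 0 * g x) = cmod 0 * p g"
            using p g BC unfolding seminorm_on_def by blast
          then show ?thesis by simp
        qed
        then have "g \<in> ?V" using e g by simp
        moreover have "?V \<subseteq> s \<inter> B_space"
        proof
          fix h assume h: "h \<in> ?V"
          have "p (\<lambda>x. (h x - g x) + (g x - f x)) \<le> p (\<lambda>x. h x - g x) + p (\<lambda>x. g x - f x)"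
          proof -
            have "(\<lambda>x. h x - g x) \<in> smooth_functions" "(\<lambda>x. g x - f x) \<in> smooth_functions"
              using h g 2(2) BC by (auto intro!: smooth_functions_diff)
            with p show ?thesis unfolding seminorm_on_def by metis
          qed
          also have "\<dots> < r" using h by (simp add: e_def)
          finally show "h \<in> s \<inter> B_space"
            using h BC 2(4) by auto
        qed
        ultimately show "\<exists>T. openin ?B T \<and> g \<in> T \<and> T \<subseteq> s \<inter> B_space"
          by blast
      qed
    qed
  next
    case (Int a b)
    have "a \<inter> b \<inter> B_space = (a \<inter> B_space) \<inter> (b \<inter> B_space)" by blast
    then show ?case using Int by (simp add: openin_Int)
  next
    case (UN K)
    have "\<Union>K \<inter> B_space = \<Union>((\<lambda>k. k \<inter> B_space) ` K)" by blast
    then show ?case using UN.IH by (metis (no_types, lifting) imageE openin_Union)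
  qed simp
  have "?B = subtopology smooth_topology B_space"
  proof (subst topology_eq, intro allI iffI)
    fix U :: "(real^'n \<Rightarrow> complex) set" assume "openin (subtopology smooth_topology B_space) U"
    then show "openin ?B U" using 2 by (auto simp: openin_subtopology)
  qed (rule 1)
  then show "subtopology ?B S = subtopology smooth_topology S"
    using SB by (simp add: subtopology_subtopology inf.absorb2)
qed

lemma B_c_topology_finest:
  assumes "B_c_admissible P" "openin (seminorm_topology B_space P) U"
  shows "openin B_c_topology U"
  using assms(2)
  unfolding B_c_topology_def seminorm_topology_def openin_topology_generated_by_iff
proof induction
  case (Basis s)
  with assms(1) show ?case by (intro generate_topology_on.Basis) blast
qed (auto intro: generate_topology_on.intros)

lemma B_c_topology_admissible: "B_c_admissible (\<Union>(Collect B_c_admissible))"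
  unfolding B_c_admissible_def[of "\<Union>(Collect B_c_admissible)"]
proof (intro conjI allI impI ballI)
  fix p :: "(real^'n \<Rightarrow> complex) \<Rightarrow> real" assume "p \<in> \<Union>(Collect B_c_admissible)"
  then show "seminorm_on B_space p" by (auto simp: B_c_admissible_def)
next
  fix S :: "(real^'n \<Rightarrow> complex) set"
  assume S: "bounded_subset B_space B_seminorms S"
  then have SB: "S \<subseteq> B_space" by (simp add: bounded_subset_def)
  have adm: "subtopology (seminorm_topology B_space P) S = subtopology smooth_topology S"
    if "B_c_admissible P" for P :: "((real^'n \<Rightarrow> complex) \<Rightarrow> real) set"
    using that S by (auto simp: B_c_admissible_def)
  have 1: "openin (subtopology smooth_topology S) (U \<inter> S)" if "openin B_c_topology U" for U
    using that unfolding B_c_topology_def seminorm_topology_def openin_topology_generated_by_iff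
  proof induction
    case (Basis s)
    then obtain P where "B_c_admissible P"
      and "s \<in> insert B_space {{g \<in> B_space. p (\<lambda>x. g x - f x) < r} | p f r.
             p \<in> P \<and> f \<in> B_space \<and> r > 0}"
      using B_c_admissible_smooth_seminorms by blast
    then have "openin (seminorm_topology B_space P) s"
      unfolding seminorm_topology_def by (intro topology_generated_by_Basis)
    then have "openin (subtopology (seminorm_topology B_space P) S) (s \<inter> S)"
      unfolding openin_subtopology by blast
    then show ?case using adm[OF \<open>B_c_admissible P\<close>] by simp
  next
    case (Int a b)
    have "a \<inter> b \<inter> S = (a \<inter> S) \<inter> (b \<inter> S)" by blast
    then show ?case using Int by (simp add: openin_Int)
  next
    case (UN K)
    have "\<Union>K \<inter> S = \<Union>((\<lambda>k. k \<inter> S) ` K)" by blast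
    then show ?case using UN.IH by (metis (no_types, lifting) imageE openin_Union)
  qed simp
  have 2: "openin (subtopology B_c_topology S) U" if "openin (subtopology smooth_topology S) U" for U
    using that B_c_topology_finest[OF B_c_admissible_smooth_seminorms]
    unfolding adm[OF B_c_admissible_smooth_seminorms, symmetric] openin_subtopology by blast
  show "subtopology (seminorm_topology B_space (\<Union>(Collect B_c_admissible))) S =
      subtopology smooth_topology S"
    unfolding B_c_topology_def[symmetric] topology_eq
    using 1 2 by (metis openin_subtopology)
qed

text \<open>A tempered distribution belongs to the dual of \<open>B_dot\<close> if it is the restriction to the Schwartz
  space (a dense subspace of \<open>B_dot\<close>) of an element of that dual; \<open>B_dot_extension\<close> is that element.\<close>

definition DL1 :: "'n::finite distr set" where
  "DL1 = {u \<in> tempered_distr. \<exists>v\<in>B_dot_dual. \<forall>f\<in>schwartz. v f = u f}"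

definition B_dot_extension :: "'n::finite distr \<Rightarrow> 'n distr" where
  "B_dot_extension u = (THE v. v \<in> B_dot_dual \<and> (\<forall>f\<in>schwartz. v f = u f))"

definition DL1_B_c_pairing :: "'n::finite distr \<Rightarrow> (real^'n \<Rightarrow> complex) \<Rightarrow> complex" where
  "DL1_B_c_pairing u =
     (THE v. v \<in> dual_space B_space B_c_topology \<and> (\<forall>f\<in>B_dot. v f = B_dot_extension u f))"

section \<open>Convolution of tempered distributions\<close>

definition check_conv :: "'n::finite distr \<Rightarrow> (real^'n \<Rightarrow> complex) \<Rightarrow> real^'n \<Rightarrow> complex" where
  "check_conv v f = (\<lambda>h. v (translate (- h) f))"

definition S'_convolvable :: "'n::finite distr \<Rightarrow> 'n distr \<Rightarrow> bool" where
  "S'_convolvable u v \<longleftrightarrow> (\<forall>f\<in>schwartz. mult_distr (check_conv v f) u \<in> DL1)"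

text \<open>Convolution of distributions that are not convolvable is 0 by convention.\<close>

definition S'_conv :: "'n::finite distr \<Rightarrow> 'n distr \<Rightarrow> 'n distr" where
  "S'_conv u v =
     (\<lambda>f. if S'_convolvable u v \<and> f \<in> schwartz
          then DL1_B_c_pairing (mult_distr (check_conv v f) u) (\<lambda>_. 1) else 0)"

section \<open>Weighted spaces and the Poisson integral\<close>

definition weight :: "real \<Rightarrow> real^'n::finite \<Rightarrow> real" where
  "weight \<alpha> x = (1 + (norm x)\<^sup>2) powr ((\<alpha> + real CARD('n) + 1) / 2)"

definition unweight :: "real \<Rightarrow> 'n::finite distr \<Rightarrow> 'n distr" where
  "unweight \<alpha> = mult_distr (\<lambda>x. complex_of_real (inverse (weight \<alpha> x)))"

definition weighted_DL1 :: "real \<Rightarrow> 'n::finite distr set" where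
  "weighted_DL1 \<alpha> = {u \<in> tempered_distr. unweight \<alpha> u \<in> DL1}"

definition weighted_DL1_topology :: "real \<Rightarrow> 'n::finite distr topology" where
  "weighted_DL1_topology \<alpha> =
     pullback_topology (weighted_DL1 \<alpha>) (\<lambda>u. B_dot_extension (unweight \<alpha> u)) B_dot_dual_strong"

definition poisson_kernel :: "real \<Rightarrow> real \<Rightarrow> real^'n::finite \<Rightarrow> real" where
  "poisson_kernel \<alpha> y x =
     Gamma ((\<alpha> + real CARD('n) + 1) / 2) / (Gamma ((\<alpha> + 1) / 2) * pi powr (real CARD('n) / 2)) *
     (y powr (\<alpha> + 1) / ((norm x)\<^sup>2 + y\<^sup>2) powr ((\<alpha> + real CARD('n) + 1) / 2))"

text \<open>The convolution of the kernel with \<open>f\<close> is a tempered distribution given by a continuous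
  function; the Poisson integral is that function.\<close>

definition poisson_integral :: "real \<Rightarrow> 'n::finite distr \<Rightarrow> real^'n \<Rightarrow> real \<Rightarrow> complex" where
  "poisson_integral \<alpha> f x y =
     (THE g. continuous_on UNIV g \<and>
        function_distr g = S'_conv (function_distr (\<lambda>z. complex_of_real (poisson_kernel \<alpha> y z))) f) x"

end

theory Submission
  imports Defs "HOL-Probability.Distributions"
begin

text \<open>Write \<open>w\<close> for the weight, \<open>K\<^sub>y\<close> for the kernel and \<open>v\<close> for the element of the dual of \<open>B_dot\<close>
  that extends \<open>w\<^sup>-\<^sup>1 f\<close>, so that \<open>f \<phi> = v (w \<phi>)\<close> for Schwartz functions \<open>\<phi>\<close>. The theorem says
  that the linear forms \<open>\<psi> \<mapsto> \<langle>v, w (K\<^sub>y * (\<psi> / w))\<rangle>\<close>, which are the extensions of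
  \<open>w\<^sup>-\<^sup>1 u\<^sub>y\<close>, converge to \<open>v\<close> uniformly on bounded subsets of \<open>B_dot\<close>. Since a continuous form is
  controlled by finitely many derivatives, it is enough that \<open>w (K\<^sub>y * (\<psi> / w)) - \<psi>\<close> tends to \<open>0\<close> with
  all its derivatives, uniformly on \<open>R\<^sup>n\<close> and for bounded \<open>\<psi>\<close>. This is the approximate
  identity argument \<open>approximate_identity_jet\<close>: the kernel has integral \<open>1\<close>
  (\<open>poisson_kernel_integral\<close>), near the origin the mean value inequality applies, and away from the
  origin \<open>K\<^sub>y\<close> is at most a constant times \<open>y\<^bsup>\<alpha>+1\<^esup> / w\<close>, which is harmless because \<open>1 / w\<close> is integrable and
  \<open>w (x + h) \<le> A (w x + w h)\<close>.

  The kernel decays no faster than \<open>1 / w\<close>, and this causes the main difficulty: the function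
  \<open>w (K\<^sub>y * (\<psi> / w))\<close> is bounded with all derivatives, but in general it has a nonzero limit at infinity.
  So \<open>v\<close> has to be extended from \<open>B_dot\<close> to \<open>B_space\<close>, and the extension has to be the one
  that enters the definition of the \<open>S'\<close>-convolution. The representation of \<open>v\<close> as a finite sum of
  derivatives of integrable functions is replaced by tightness (\<open>B_dot_dual_tight\<close>): on a
  bounded set, \<open>v\<close> is small at functions that are small on a large ball. The reason is that functions
  with large values of \<open>v\<close> and supports escaping to infinity could be added up to a
  bounded function with an arbitrarily large value of \<open>v\<close>. Tightness yields the extension
  \<open>\<psi> \<mapsto> lim\<^sub>k v (\<chi>\<^sub>k \<psi>)\<close> along cutoffs \<open>\<chi>\<^sub>k\<close>, its continuity and uniqueness on \<open>B_c\<close>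
  (\<open>DL1_B_c_pairing_eq\<close>), and its continuity along bounded sequences that converge locally.

  The convolution is then computed from its definition. A form that is bounded by finitely many
  derivatives can be applied under a convolution integral (\<open>bounded_form_conv\<close>). One
  application shows that \<open>K\<^sub>y * f\<close> is the form \<open>\<phi> \<mapsto> \<langle>v, w (K\<^sub>y * \<phi>)\<rangle>\<close>
  (\<open>S'_conv_decaying_kernel\<close>). A second one shows that this form is integration against the
  continuous function \<open>x \<mapsto> \<langle>v, w \<tau>\<^sub>x K\<^sub>y\<rangle>\<close>, and this function is unique because
  bump functions separate continuous functions.\<close>

section \<open>Topologies generated by seminorms\<close>

definition linear_space :: "('c \<Rightarrow> complex) set \<Rightarrow> bool" where
  "linear_space V \<longleftrightarrow>
     (\<forall>f\<in>V. \<forall>g\<in>V. (\<lambda>x. f x + g x) \<in> V) \<and> (\<forall>c. \<forall>f\<in>V. (\<lambda>x. c * f x) \<in> V)"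

lemma linear_space_add: "linear_space V \<Longrightarrow> f \<in> V \<Longrightarrow> g \<in> V \<Longrightarrow> (\<lambda>x. f x + g x) \<in> V"
  and linear_space_scale: "linear_space V \<Longrightarrow> f \<in> V \<Longrightarrow> (\<lambda>x. c * f x) \<in> V"
  by (auto simp: linear_space_def)

lemma linear_space_diff:
  assumes "linear_space V" "f \<in> V" "g \<in> V"
  shows "(\<lambda>x. f x - g x) \<in> V"
  using linear_space_add[OF assms(1,2) linear_space_scale[OF assms(1,3), of "-1"]] by simp

lemma linear_space_zero: "linear_space V \<Longrightarrow> f \<in> V \<Longrightarrow> (\<lambda>_. 0) \<in> V"
  using linear_space_scale[of V f 0] by simp

lemma linear_form_onD:
  assumes "linear_form_on V u" "f \<in> V"
  shows "g \<in> V \<Longrightarrow> u (\<lambda>x. f x + g x) = u f + u g" and "u (\<lambda>x. c * f x) = c * u f"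
  using assms by (auto simp: linear_form_on_def)

lemma linear_form_on_diff:
  assumes "linear_form_on V u" "linear_space V" "f \<in> V" "g \<in> V"
  shows "u (\<lambda>x. f x - g x) = u f - u g"
  using linear_form_onD(1)[OF assms(1,3) linear_space_scale[OF assms(2,4), of "-1"]]
    linear_form_onD(2)[OF assms(1,4), of "-1"] by simp

lemma linear_form_on_zero: "linear_form_on V u \<Longrightarrow> f \<in> V \<Longrightarrow> u (\<lambda>_. 0) = 0"
  using linear_form_onD(2)[of V u f 0] by simp

lemma seminorm_onD:
  assumes "seminorm_on V p" "f \<in> V"
  shows "0 \<le> p f" and "g \<in> V \<Longrightarrow> p (\<lambda>x. f x + g x) \<le> p f + p g"
    and "p (\<lambda>x. c * f x) = cmod c * p f"
  using assms by (auto simp: seminorm_on_def)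

lemma seminorm_on_zero: "seminorm_on V p \<Longrightarrow> f \<in> V \<Longrightarrow> p (\<lambda>_. 0) = 0"
  using seminorm_onD(3)[of V p f 0] by simp

lemma seminorm_on_diff_triangle:
  assumes "seminorm_on V p" "linear_space V" "f \<in> V" "g \<in> V" "h \<in> V"
  shows "p (\<lambda>x. h x - f x) \<le> p (\<lambda>x. h x - g x) + p (\<lambda>x. g x - f x)"
  using seminorm_onD(2)[OF assms(1) linear_space_diff[OF assms(2,5,4)]
      linear_space_diff[OF assms(2,4,3)]] by simp

lemma topspace_seminorm_topology [simp]: "topspace (seminorm_topology V P) = V"
  unfolding seminorm_topology_def topology_generated_by_topspace by auto

lemma openin_seminorm_ball:
  assumes "finite F" "F \<subseteq> P" "f \<in> V" "e > 0"
  shows "openin (seminorm_topology V P) {g \<in> V. \<forall>p\<in>F. p (\<lambda>x. g x - f x) < e}"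
  using assms(1,2)
proof (induction F)
  case empty
  show ?case unfolding seminorm_topology_def by (intro topology_generated_by_Basis) auto
next
  case (insert p F)
  have "openin (seminorm_topology V P) {g \<in> V. p (\<lambda>x. g x - f x) < e}"
    unfolding seminorm_topology_def using insert.prems assms(3,4)
    by (intro topology_generated_by_Basis) blast
  moreover have "{g \<in> V. \<forall>p\<in>insert p F. p (\<lambda>x. g x - f x) < e} =
      {g \<in> V. p (\<lambda>x. g x - f x) < e} \<inter> {g \<in> V. \<forall>p\<in>F. p (\<lambda>x. g x - f x) < e}"
    by auto
  ultimately show ?case
    using insert by (simp add: openin_Int)
qed

text \<open>The subbasic open sets are balls with arbitrary centres. By the triangle inequality, a point of
  such a ball is the centre of a smaller ball for the same seminorm, so finite intersections of balls
  centred at a point form a basis of its neighbourhoods.\<close>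

lemma seminorm_topology_nbhd:
  assumes V: "linear_space V" and P: "\<And>p. p \<in> P \<Longrightarrow> seminorm_on V p"
    and "openin (seminorm_topology V P) U" "f \<in> U"
  shows "\<exists>F e. finite F \<and> F \<subseteq> P \<and> e > 0 \<and> {g \<in> V. \<forall>p\<in>F. p (\<lambda>x. g x - f x) < e} \<subseteq> U"
  using assms(3,4) unfolding seminorm_topology_def openin_topology_generated_by_iff
proof (induction arbitrary: f)
  case (Basis s)
  then consider "s = V" | p f0 r where "p \<in> P" "f0 \<in> V" "r > 0" "s = {g \<in> V. p (\<lambda>x. g x - f0 x) < r}"
    by auto
  then show ?case
  proof cases
    case 1
    then show ?thesis by (intro exI[of _ "{}"] exI[of _ 1]) auto
  next
    case 2
    have "g \<in> s" if "g \<in> V" "p (\<lambda>x. g x - f x) < r - p (\<lambda>x. f x - f0 x)" for g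
      using seminorm_on_diff_triangle[OF P[OF 2(1)] V 2(2), of f g] that Basis(2) 2 by auto
    then show ?thesis
      using 2 Basis(2) by (intro exI[of _ "{p}"] exI[of _ "r - p (\<lambda>x. f x - f0 x)"]) auto
  qed
next
  case (Int a b)
  then obtain F e F' e' where *: "finite F" "F \<subseteq> P" "e > 0"
      "{g \<in> V. \<forall>p\<in>F. p (\<lambda>x. g x - f x) < e} \<subseteq> a" "finite F'" "F' \<subseteq> P" "e' > 0"
      "{g \<in> V. \<forall>p\<in>F'. p (\<lambda>x. g x - f x) < e'} \<subseteq> b"
    by (meson IntE)
  then show ?case by (intro exI[of _ "F \<union> F'"] exI[of _ "min e e'"]) auto
next
  case (UN K)
  then obtain k where "k \<in> K" "f \<in> k" by auto
  from UN.IH[OF this] this show ?case by (meson Sup_upper order_trans)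
qed simp

lemma limitin_seminorm_topologyI:
  assumes V: "linear_space V" and P: "\<And>p. p \<in> P \<Longrightarrow> seminorm_on V p"
    and "l \<in> V" "eventually (\<lambda>i. F i \<in> V) net"
    and lim: "\<And>p. p \<in> P \<Longrightarrow> ((\<lambda>i. p (\<lambda>x. F i x - l x)) \<longlongrightarrow> 0) net"
  shows "limitin (seminorm_topology V P) F l net"
  unfolding limitin_def
proof (intro conjI allI impI)
  fix U assume U: "openin (seminorm_topology V P) U \<and> l \<in> U"
  obtain G e where G: "finite G" "G \<subseteq> P" "e > 0" "{g \<in> V. \<forall>p\<in>G. p (\<lambda>x. g x - l x) < e} \<subseteq> U"
    using seminorm_topology_nbhd[OF V P conjunct1[OF U] conjunct2[OF U]] by auto
  have "eventually (\<lambda>i. \<forall>p\<in>G. p (\<lambda>x. F i x - l x) < e) net"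
    using G lim order_tendstoD(2)[OF lim] by (intro eventually_ball_finite) auto
  with assms(4) show "eventually (\<lambda>i. F i \<in> U) net"
    by eventually_elim (use G(4) in auto)
qed (use assms(3) in simp)

text \<open>Continuity of a linear form means that it is dominated by finitely many of the seminorms; the
  next two lemmas are the two halves of this.\<close>

lemma continuous_linear_form_bound:
  assumes V: "linear_space V" and P: "\<And>p. p \<in> P \<Longrightarrow> seminorm_on V p"
    and u: "linear_form_on V u" "continuous_map (seminorm_topology V P) euclidean u"
  shows "\<exists>F C. finite F \<and> F \<subseteq> P \<and> C \<ge> 0 \<and> (\<forall>g\<in>V. cmod (u g) \<le> C * (\<Sum>p\<in>F. p g))"
proof (cases "V = {}")
  case True
  then show ?thesis by (intro exI[of _ "{}"] exI[of _ 0]) auto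
next
  case False
  then obtain f0 where f0: "f0 \<in> V" by auto
  have 1: "openin (seminorm_topology V P) {g \<in> V. u g \<in> ball 0 1}"
    using openin_continuous_map_preimage[OF u(2), of "ball 0 1"] by simp
  have 2: "(\<lambda>_. 0) \<in> {g \<in> V. u g \<in> ball 0 1}"
    using linear_space_zero[OF V f0] linear_form_on_zero[OF u(1) f0] by simp
  obtain F e where F: "finite F" "F \<subseteq> P" "e > 0"
      "{g \<in> V. \<forall>p\<in>F. p (\<lambda>x. g x - 0) < e} \<subseteq> {g \<in> V. u g \<in> ball 0 1}"
    using seminorm_topology_nbhd[OF V P 1 2] by blast
  have "cmod (u g) \<le> (1 / e) * (\<Sum>p\<in>F. p g)" if g: "g \<in> V" for g
  proof -
    have q: "0 \<le> p g" "p g \<le> (\<Sum>p\<in>F. p g)" if "p \<in> F" for p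
      using that F(1,2) P[THEN seminorm_onD(1), OF _ g] by (auto intro!: member_le_sum)
    have "e * cmod (u g) \<le> (\<Sum>p\<in>F. p g)"
    proof (rule dense_ge)
      fix r assume r: "(\<Sum>p\<in>F. p g) < r"
      moreover have "0 \<le> (\<Sum>p\<in>F. p g)" using q by (intro sum_nonneg) auto
      ultimately have "r > 0" by linarith
      \<comment> \<open>rescale \<open>g\<close> into the neighbourhood of \<open>0\<close> on which \<open>u\<close> is smaller than \<open>1\<close>\<close>
      define c where "c = complex_of_real (e / r)"
      have c: "cmod c = e / r" using F(3) \<open>r > 0\<close> by (simp add: c_def norm_divide)
      have "p (\<lambda>x. c * g x) < e" if "p \<in> F" for p
      proof -
        have "p g < r" using q(2)[OF that] r by simp
        then have "e / r * p g < e / r * r" using F(3) \<open>r > 0\<close> by (intro mult_strict_left_mono) auto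
        moreover have "p (\<lambda>x. c * g x) = e / r * p g"
          using seminorm_onD(3)[OF P g, of p c] that F(2) by (auto simp: c)
        ultimately show ?thesis using \<open>r > 0\<close> by simp
      qed
      then have "(\<lambda>x. c * g x) \<in> {g \<in> V. u g \<in> ball 0 1}"
        using F(4) linear_space_scale[OF V g] by auto
      then show "e * cmod (u g) \<le> r"
        using linear_form_onD(2)[OF u(1) g, of c] \<open>r > 0\<close> by (simp add: norm_mult c field_simps)
    qed
    then show ?thesis using F(3) by (simp add: field_simps)
  qed
  then show ?thesis using F by (intro exI[of _ F] exI[of _ "1 / e"]) auto
qed

lemma continuous_map_linear_formI:
  assumes V: "linear_space V" and P: "\<And>p. p \<in> P \<Longrightarrow> seminorm_on V p" and u: "linear_form_on V u"
    and F: "finite F" "F \<subseteq> P" and C: "C \<ge> 0" "\<And>g. g \<in> V \<Longrightarrow> cmod (u g) \<le> C * (\<Sum>p\<in>F. p g)"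
  shows "continuous_map (seminorm_topology V P) euclidean u"
  unfolding continuous_map_def
proof (intro conjI allI impI)
  fix U :: "complex set" assume "openin euclidean U"
  then have U: "open U" by simp
  show "openin (seminorm_topology V P) {f \<in> topspace (seminorm_topology V P). u f \<in> U}"
  proof (subst openin_subopen, intro ballI)
    fix f assume f: "f \<in> {f \<in> topspace (seminorm_topology V P). u f \<in> U}"
    then obtain r where r: "r > 0" "ball (u f) r \<subseteq> U" using U by (auto simp: open_contains_ball)
    \<comment> \<open>the summand \<open>1\<close> covers the case that \<open>F\<close> is empty or \<open>C = 0\<close>\<close>
    define e where "e = r / (C * real (card F) + 1)"
    have e: "e > 0" using r C by (auto simp: e_def intro!: divide_pos_pos add_nonneg_pos)
    have small: "C * (real (card F) * e) < r"
      using r C by (simp add: e_def field_simps add_pos_nonneg)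
    let ?W = "{g \<in> V. \<forall>p\<in>F. p (\<lambda>x. g x - f x) < e}"
    have "openin (seminorm_topology V P) ?W"
      using F f e by (intro openin_seminorm_ball) auto
    moreover have "f \<in> ?W"
      using f e F by (auto simp: seminorm_on_zero[OF P, of _ f])
    moreover have "u g \<in> U" if g: "g \<in> ?W" for g
    proof -
      have "(\<Sum>p\<in>F. p (\<lambda>x. g x - f x)) \<le> real (card F) * e"
        using g by (intro sum_bounded_above) auto
      then have "C * (\<Sum>p\<in>F. p (\<lambda>x. g x - f x)) < r"
        using small C(1) by (meson mult_left_mono order_le_less_trans)
      moreover have "cmod (u g - u f) \<le> C * (\<Sum>p\<in>F. p (\<lambda>x. g x - f x))"
        using C(2)[OF linear_space_diff[OF V, of g f]] g f
        by (simp add: linear_form_on_diff[OF u V])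
      ultimately show ?thesis using r(2) by (auto simp: dist_norm norm_minus_commute)
    qed
    ultimately show "\<exists>T. openin (seminorm_topology V P) T \<and> f \<in> T \<and>
        T \<subseteq> {f \<in> topspace (seminorm_topology V P). u f \<in> U}"
      by (intro exI[of _ ?W]) auto
  qed
qed auto

section \<open>Calculus of iterated partial derivatives\<close>

text \<open>Differentiability means Frechet differentiability, so a directional derivative is a value of
  the derivative, and the derivative is recovered from the partial derivatives.\<close>

lemma partial_eq_derivative:
  assumes "(f has_derivative D) (at x)"
  shows "partial i f x = D (axis i 1)"
proof -
  have "((\<lambda>t. x + t *\<^sub>R axis i 1) has_derivative (\<lambda>t. t *\<^sub>R axis i 1)) (at (0::real))"
    by (auto intro!: derivative_eq_intros)
  then have "((\<lambda>t. f (x + t *\<^sub>R axis i 1)) has_derivative (\<lambda>t. D (t *\<^sub>R axis i 1))) (at 0)"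
    by (rule has_derivative_compose) (use assms in simp)
  moreover have "D (t *\<^sub>R axis i 1) = t *\<^sub>R D (axis i 1)" for t
    by (rule linear_scale[OF has_derivative_linear[OF assms]])
  ultimately show ?thesis
    unfolding partial_def by (intro vector_derivative_at) (simp add: has_vector_derivative_def)
qed

lemma has_derivative_partials:
  fixes f :: "real^'n::finite \<Rightarrow> complex"
  assumes "f differentiable at x"
  shows "(f has_derivative (\<lambda>v. \<Sum>i\<in>UNIV. (v $ i) *\<^sub>R partial i f x)) (at x)"
proof -
  obtain D where D: "(f has_derivative D) (at x)"
    using assms unfolding differentiable_def by blast
  interpret linear D by (rule has_derivative_linear[OF D])
  have "D v = (\<Sum>i\<in>UNIV. (v $ i) *\<^sub>R partial i f x)" for v
  proof -
    have "D v = D (\<Sum>i\<in>UNIV. (v $ i) *\<^sub>R axis i 1)"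
      using basis_expansion[of v] by (simp add: scalar_mult_eq_scaleR)
    also have "\<dots> = (\<Sum>i\<in>UNIV. (v $ i) *\<^sub>R partial i f x)"
      by (simp add: sum scale partial_eq_derivative[OF D])
    finally show ?thesis .
  qed
  then have "D = (\<lambda>v. \<Sum>i\<in>UNIV. (v $ i) *\<^sub>R partial i f x)" by blast
  then show ?thesis using D by simp
qed

lemma partial_const [simp]: "partial i (\<lambda>_. c) = (\<lambda>_. 0)"
  by (auto simp: partial_def fun_eq_iff)

lemma partial_add:
  assumes "f differentiable at x" "g differentiable at x"
  shows "partial i (\<lambda>x. f x + g x) x = partial i f x + partial i g x"
proof -
  obtain D E where "(f has_derivative D) (at x)" "(g has_derivative E) (at x)"
    using assms unfolding differentiable_def by blast
  then show ?thesis
    using partial_eq_derivative[OF has_derivative_add, of f D x g E i]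
    by (simp add: partial_eq_derivative add.commute)
qed

lemma partial_mult:
  assumes "f differentiable at x" "g differentiable at x"
  shows "partial i (\<lambda>x. f x * g x) x = partial i f x * g x + f x * partial i g x"
proof -
  obtain D E where "(f has_derivative D) (at x)" "(g has_derivative E) (at x)"
    using assms unfolding differentiable_def by blast
  then show ?thesis
    using partial_eq_derivative[OF has_derivative_mult, of f D x g E i]
    by (simp add: partial_eq_derivative add.commute)
qed

lemma partials_append: "partials (js @ is) f = partials js (partials is f)"
  by (induction js) auto

lemma smooth_differentiable: "f \<in> smooth_functions \<Longrightarrow> partials is f differentiable at x"
  by (auto simp: smooth_functions_def differentiable_on_def)

lemma smooth_differentiable0: "f \<in> smooth_functions \<Longrightarrow> f differentiable at x"
  using smooth_differentiable[of f "[]"] by simp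

lemma smooth_partials: "f \<in> smooth_functions \<Longrightarrow> partials is f \<in> smooth_functions"
  by (simp add: smooth_functions_def flip: partials_append)

lemma smooth_partial: "f \<in> smooth_functions \<Longrightarrow> partial i f \<in> smooth_functions"
  using smooth_partials[of f "[i]"] by simp

lemma smooth_continuous: "f \<in> smooth_functions \<Longrightarrow> continuous_on A (partials is f)"
  by (auto intro!: continuous_at_imp_continuous_on differentiable_imp_continuous_within
      smooth_differentiable)

lemma smooth_continuous0: "f \<in> smooth_functions \<Longrightarrow> continuous_on A f"
  using smooth_continuous[of f A "[]"] by simp

lemma smooth_measurable [measurable_dest]: "f \<in> smooth_functions \<Longrightarrow> f \<in> borel_measurable borel"
  by (intro borel_measurable_continuous_onI smooth_continuous0)

text \<open>Smoothness of a concrete function is proved by exhibiting a family of differentiable functions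
  that contains it and whose partial derivatives are polynomials in members of the family: the
  generated algebra is then stable under differentiation. If moreover all members are bounded, so
  are all derivatives.\<close>

inductive_set alg :: "(real^'n::finite \<Rightarrow> complex) set \<Rightarrow> (real^'n \<Rightarrow> complex) set" for X where
  alg_gen: "f \<in> X \<Longrightarrow> f \<in> alg X"
| alg_const: "(\<lambda>_. c) \<in> alg X"
| alg_add: "f \<in> alg X \<Longrightarrow> g \<in> alg X \<Longrightarrow> (\<lambda>x. f x + g x) \<in> alg X"
| alg_mult: "f \<in> alg X \<Longrightarrow> g \<in> alg X \<Longrightarrow> (\<lambda>x. f x * g x) \<in> alg X"

lemma alg_partials:
  assumes X: "\<And>f x. f \<in> X \<Longrightarrow> f differentiable at x" "\<And>f i. f \<in> X \<Longrightarrow> partial i f \<in> alg X"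
    and f: "f \<in> alg X"
  shows "partials is f \<in> alg X" "partials is f differentiable at x"
proof -
  have "(\<forall>x. f differentiable at x) \<and> (\<forall>i. partial i f \<in> alg X)" if "f \<in> alg X" for f
    using that
  proof induction
    case (alg_add f g)
    then have "partial i (\<lambda>x. f x + g x) = (\<lambda>x. partial i f x + partial i g x)" for i
      by (auto simp: partial_add)
    with alg_add show ?case by (auto intro!: alg.alg_add derivative_intros)
  next
    case (alg_mult f g)
    then have "partial i (\<lambda>x. f x * g x) = (\<lambda>x. partial i f x * g x + f x * partial i g x)" for i
      by (auto simp: partial_mult)
    with alg_mult show ?case by (auto intro!: alg.alg_add alg.alg_mult derivative_intros)
  qed (use X in \<open>auto intro: alg.alg_const\<close>)
  note 1 = this
  show "partials is f \<in> alg X" by (induction "is") (use 1 f in auto)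
  then show "partials is f differentiable at x" using 1 by blast
qed

lemma alg_smooth:
  assumes "\<And>f x. f \<in> X \<Longrightarrow> f differentiable at x" "\<And>f i. f \<in> X \<Longrightarrow> partial i f \<in> alg X"
  shows "alg X \<subseteq> smooth_functions"
  using alg_partials(2)[OF assms] by (auto simp: smooth_functions_def differentiable_on_def)

lemma alg_B_space:
  assumes "\<And>f x. f \<in> X \<Longrightarrow> f differentiable at x" "\<And>f i. f \<in> X \<Longrightarrow> partial i f \<in> alg X"
    and bd: "\<And>f. f \<in> X \<Longrightarrow> bounded (range f)"
  shows "alg X \<subseteq> B_space"
proof -
  have "bounded (range f)" if "f \<in> alg X" for f
    using that
  proof induction
    case (alg_add f g)
    then obtain a b where "\<And>x. cmod (f x) \<le> a" "\<And>x. cmod (g x) \<le> b"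
      by (auto simp: bounded_iff)
    then show ?case
      unfolding bounded_iff by (intro exI[of _ "a + b"]) (auto intro: norm_triangle_mono)
  next
    case (alg_mult f g)
    then obtain a b where ab: "\<And>x. cmod (f x) \<le> a" "\<And>x. cmod (g x) \<le> b"
      by (auto simp: bounded_iff)
    have "0 \<le> a" using ab(1)[of undefined] norm_ge_zero order_trans by blast
    with ab show ?case
      unfolding bounded_iff by (intro exI[of _ "a * b"]) (auto simp: norm_mult intro!: mult_mono)
  qed (use bd in auto)
  then show ?thesis
    using alg_smooth[OF assms(1,2)] alg_partials(1)[OF assms(1,2)] by (auto simp: B_space_def)
qed

lemma smooth_const: "(\<lambda>_. c) \<in> smooth_functions"
  using alg_smooth[of "{}"] alg.alg_const by blast

lemma smooth_add: "f \<in> smooth_functions \<Longrightarrow> g \<in> smooth_functions \<Longrightarrow> (\<lambda>x. f x + g x) \<in> smooth_functions"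
  by (rule smooth_functions_linear(1))

lemma smooth_mult:
  assumes "f \<in> smooth_functions" "g \<in> smooth_functions"
  shows "(\<lambda>x. f x * g x) \<in> smooth_functions"
proof -
  have "alg (smooth_functions :: (real^'a \<Rightarrow> complex) set) \<subseteq> smooth_functions"
    by (rule alg_smooth) (auto intro: smooth_differentiable0 alg.alg_gen smooth_partial)
  then show ?thesis using assms by (auto intro: alg.intros)
qed

lemma linear_space_smooth: "linear_space smooth_functions"
  by (auto simp: linear_space_def smooth_functions_linear)

lemma partials_const: "partials is (\<lambda>_. c) = (\<lambda>_. if is = [] then c else 0)"
  by (induction "is") auto

lemma partials_diff:
  assumes "f \<in> smooth_functions" "g \<in> smooth_functions"
  shows "partials is (\<lambda>x. f x - g x) = (\<lambda>x. partials is f x - partials is g x)"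
  using partials_linear(1)[OF assms(1) smooth_functions_linear(2)[OF assms(2,2), of "-1"]]
    partials_linear(2)[OF assms(2,2), of "is" "-1"] by (auto simp: fun_eq_iff)

lemma partial_translate: "partial i (translate h f) = translate h (partial i f)"
  by (simp add: partial_def translate_def fun_eq_iff algebra_simps)

lemma partials_translate: "partials is (translate h f) = translate h (partials is f)"
  by (induction "is") (auto simp: partial_translate)

lemma smooth_translate:
  assumes "f \<in> smooth_functions"
  shows "translate h f \<in> smooth_functions"
proof -
  have "(\<lambda>x. partials is f (x - h)) differentiable at x" for "is" x
    by (rule differentiable_compose[where f="partials is f"])
      (auto intro!: derivative_intros smooth_differentiable assms)
  moreover have "partials is (translate h f) = (\<lambda>x. partials is f (x - h))" for "is"
    unfolding partials_translate by (simp add: translate_def)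
  ultimately show ?thesis
    by (simp add: smooth_functions_def differentiable_on_def)
qed

lemma partials_scale:
  assumes "f \<in> smooth_functions"
  shows "partials is (\<lambda>x. f (c *\<^sub>R x)) = (\<lambda>x. of_real (c ^ length is) * partials is f (c *\<^sub>R x))"
proof (induction "is")
  case (Cons i js)
  have "((\<lambda>x. of_real (c ^ length js) * partials js f (c *\<^sub>R x)) has_derivative
       (\<lambda>v. of_real (c ^ length js) *
          (\<Sum>i\<in>UNIV. ((c *\<^sub>R v) $ i) *\<^sub>R partial i (partials js f) (c *\<^sub>R x)))) (at x)" for x
    by (rule has_derivative_mult_right)
      (rule has_derivative_compose[OF _ has_derivative_partials], auto intro!: derivative_eq_intros smooth_differentiable assms)
  note D = this
  have "((c *\<^sub>R axis i 1) $ k) *\<^sub>R partial k (partials js f) (c *\<^sub>R x) =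
      (if k = i then c *\<^sub>R partial i (partials js f) (c *\<^sub>R x) else 0)" for k x
    by (simp add: axis_def)
  then have "(\<Sum>k\<in>UNIV. ((c *\<^sub>R axis i 1) $ k) *\<^sub>R partial k (partials js f) (c *\<^sub>R x)) =
      c *\<^sub>R partial i (partials js f) (c *\<^sub>R x)" for x
    by simp
  then have "partial i (\<lambda>x. of_real (c ^ length js) * partials js f (c *\<^sub>R x)) x =
      of_real (c ^ length js) * c *\<^sub>R partial i (partials js f) (c *\<^sub>R x)" for x
    using partial_eq_derivative[OF D, of i x] by simp
  then show ?case
    unfolding partials.simps Cons by (simp add: fun_eq_iff) (simp add: scaleR_conv_of_real)
qed auto

lemma smooth_scale:
  assumes "f \<in> smooth_functions"
  shows "(\<lambda>x. f (c *\<^sub>R x)) \<in> smooth_functions"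
proof -
  have "(\<lambda>x. of_real (c ^ length is) * partials is f (c *\<^sub>R x)) differentiable at x" for "is" x
  proof (rule differentiable_mult[OF differentiable_const])
    show "(\<lambda>x. partials is f (c *\<^sub>R x)) differentiable at x"
      by (rule differentiable_compose[where f="partials is f" and g="\<lambda>x. c *\<^sub>R x"])
        (auto intro!: smooth_differentiable assms differentiable_scaleR)
  qed
  then show ?thesis
    by (auto simp: smooth_functions_def differentiable_on_def partials_scale[OF assms])
qed

text \<open>Symmetry of second derivatives: the second difference quotient of \<open>f\<close> in the directions \<open>i\<close>
  and \<open>j\<close> is symmetric in them and converges to the mixed derivative in either order.\<close>

lemma second_difference:
  assumes f: "f \<in> smooth_functions" and e: "e > 0"
  shows "\<exists>d>0. \<forall>s. 0 < s \<longrightarrow> s < d \<longrightarrow>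
     cmod (f (x + s *\<^sub>R axis i 1 + s *\<^sub>R axis j 1) - f (x + s *\<^sub>R axis i 1) - f (x + s *\<^sub>R axis j 1) + f x
       - (s * s) *\<^sub>R partial j (partial i f) x) \<le> e * (s * s)"
proof -
  have line: "cmod (g (a + s *\<^sub>R axis k 1) - g a - s *\<^sub>R c) \<le> e * s"
    if g: "\<And>z. g differentiable at z" and s: "0 < s"
      and b: "\<And>t. 0 \<le> t \<Longrightarrow> t \<le> s \<Longrightarrow> cmod (partial k g (a + t *\<^sub>R axis k 1) - c) \<le> e"
    for g :: "real^'a \<Rightarrow> complex" and k a s c e
  proof -
    have D: "((\<lambda>t. g (a + t *\<^sub>R axis k 1) - t *\<^sub>R c) has_derivative
        (\<lambda>h. h *\<^sub>R (partial k g (a + t *\<^sub>R axis k 1) - c))) (at t within {0..s})" for t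
    proof -
      have "((\<lambda>t. g (a + t *\<^sub>R axis k 1)) has_derivative
        (\<lambda>h. \<Sum>i\<in>UNIV. ((h *\<^sub>R axis k 1) $ i) *\<^sub>R partial i g (a + t *\<^sub>R axis k 1))) (at t within {0..s})"
        by (rule has_derivative_compose[OF _ has_derivative_partials[OF g]])
          (auto intro!: derivative_eq_intros)
      moreover have "(\<Sum>i\<in>UNIV. ((h *\<^sub>R axis k 1) $ i) *\<^sub>R partial i g (a + t *\<^sub>R axis k 1)) =
          h *\<^sub>R partial k g (a + t *\<^sub>R axis k 1)" for h
      proof -
        have "((h *\<^sub>R axis k 1) $ i) *\<^sub>R partial i g (a + t *\<^sub>R axis k 1) =
           (if i = k then h *\<^sub>R partial k g (a + t *\<^sub>R axis k 1) else 0)" for i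
          by (simp add: axis_def)
        then show ?thesis by simp
      qed
      ultimately show ?thesis
        by (auto intro!: derivative_eq_intros simp: scaleR_diff_right)
    qed
    have "norm ((g (a + s *\<^sub>R axis k 1) - s *\<^sub>R c) - (g (a + 0 *\<^sub>R axis k 1) - 0 *\<^sub>R c)) \<le> e * norm (s - 0)"
    proof (rule differentiable_bound[where S="{0..s}"
          and f="\<lambda>t. g (a + t *\<^sub>R axis k 1) - t *\<^sub>R c"
          and f'="\<lambda>t h. h *\<^sub>R (partial k g (a + t *\<^sub>R axis k 1) - c)"])
      show "((\<lambda>t. g (a + t *\<^sub>R axis k 1) - t *\<^sub>R c) has_derivative
        (\<lambda>h. h *\<^sub>R (partial k g (a + t *\<^sub>R axis k 1) - c))) (at t within {0..s})" for t by (rule D)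
      show "onorm (\<lambda>h. h *\<^sub>R (partial k g (a + t *\<^sub>R axis k 1) - c)) \<le> e" if "t \<in> {0..s}" for t
        using b[of t] that by (intro onorm_le) (auto simp: mult.commute[of e] intro!: mult_left_mono)
    qed (use s in auto)
    then show ?thesis using s by (simp add: algebra_simps)
  qed
  have "isCont (partial j (partial i f)) x"
    using smooth_continuous[OF f, of UNIV "[j, i]"] by (simp add: continuous_on_eq_continuous_at)
  then obtain d where d: "d > 0" "\<And>z. dist z x < d \<Longrightarrow> dist (partial j (partial i f) z) (partial j (partial i f) x) < e"
    using e unfolding continuous_at_eps_delta by metis
  \<comment> \<open>first difference \<open>f\<close> in direction \<open>j\<close>, then apply the one-dimensional bound in direction \<open>i\<close>\<close>
  have "cmod (f (x + s *\<^sub>R axis i 1 + s *\<^sub>R axis j 1) - f (x + s *\<^sub>R axis i 1) - f (x + s *\<^sub>R axis j 1) + f x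
       - (s * s) *\<^sub>R partial j (partial i f) x) \<le> e * (s * s)" if s: "0 < s" "s < d / 2" for s
  proof -
    let ?c = "partial j (partial i f) x"
    let ?g = "\<lambda>z. f (z + s *\<^sub>R axis j 1) - f z"
    have pg: "partial i ?g z = partial i f (z + s *\<^sub>R axis j 1) - partial i f z" for z
      using partials_diff[OF smooth_translate[OF f, of "- s *\<^sub>R axis j 1"] f, of "[i]"]
      by (simp add: partial_translate) (simp add: translate_def fun_eq_iff)
    have "cmod (partial i ?g (x + t *\<^sub>R axis i 1) - s *\<^sub>R ?c) \<le> e * s" if t: "0 \<le> t" "t \<le> s" for t
      unfolding pg
    proof (rule line[OF _ s(1)])
      fix r assume r: "0 \<le> r" "r \<le> s"
      have "norm (t *\<^sub>R axis i (1::real) + r *\<^sub>R axis j 1) \<le> t + r"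
        by (rule norm_triangle_le) (use t r in simp)
      then have "dist (x + t *\<^sub>R axis i 1 + r *\<^sub>R axis j 1) x < d"
        using t r s by (simp add: dist_norm add.assoc)
      from d(2)[OF this] show "cmod (partial j (partial i f) (x + t *\<^sub>R axis i 1 + r *\<^sub>R axis j 1) - ?c) \<le> e"
        by (simp add: dist_norm)
    qed (use smooth_differentiable[OF f, of "[i]"] in simp)
    from line[OF _ s(1) this] have
      "cmod (?g (x + s *\<^sub>R axis i 1) - ?g x - s *\<^sub>R (s *\<^sub>R ?c)) \<le> e * s * s"
      using smooth_differentiable0[OF smooth_functions_diff[OF smooth_translate[OF f, of "- s *\<^sub>R axis j 1"] f]]
      by (simp add: translate_def)
    then show ?thesis by (simp add: algebra_simps)
  qed
  then show ?thesis using d(1) by (intro exI[of _ "d / 2"]) auto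
qed

lemma partial_commute:
  assumes f: "f \<in> smooth_functions"
  shows "partial i (partial j f) = partial j (partial i f)"
proof
  fix x
  have "cmod (partial i (partial j f) x - partial j (partial i f) x) \<le> 2 * e" if e: "e > 0" for e
  proof -
    obtain d where d: "d > 0" "\<And>s. 0 < s \<Longrightarrow> s < d \<Longrightarrow>
       cmod (f (x + s *\<^sub>R axis i 1 + s *\<^sub>R axis j 1) - f (x + s *\<^sub>R axis i 1) - f (x + s *\<^sub>R axis j 1) + f x
       - (s * s) *\<^sub>R partial j (partial i f) x) \<le> e * (s * s)"
      using second_difference[OF f e, of x i j] by blast
    obtain d' where d': "d' > 0" "\<And>s. 0 < s \<Longrightarrow> s < d' \<Longrightarrow>
       cmod (f (x + s *\<^sub>R axis j 1 + s *\<^sub>R axis i 1) - f (x + s *\<^sub>R axis j 1) - f (x + s *\<^sub>R axis i 1) + f x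
       - (s * s) *\<^sub>R partial i (partial j f) x) \<le> e * (s * s)"
      using second_difference[OF f e, of x j i] by blast
    define s where "s = min d d' / 2"
    have s: "0 < s" "s < d" "s < d'" using d d' by (auto simp: s_def)
    let ?D = "f (x + s *\<^sub>R axis i 1 + s *\<^sub>R axis j 1) - f (x + s *\<^sub>R axis i 1) - f (x + s *\<^sub>R axis j 1) + f x"
    have "f (x + s *\<^sub>R axis j 1 + s *\<^sub>R axis i 1) - f (x + s *\<^sub>R axis j 1) - f (x + s *\<^sub>R axis i 1) + f x = ?D"
      by (simp add: algebra_simps)
    with d(2)[OF s(1,2)] d'(2)[OF s(1,3)]
    have "cmod (?D - (s * s) *\<^sub>R partial j (partial i f) x) \<le> e * (s * s)"
      "cmod (?D - (s * s) *\<^sub>R partial i (partial j f) x) \<le> e * (s * s)"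
      by simp_all
    then have "cmod ((s * s) *\<^sub>R (partial i (partial j f) x - partial j (partial i f) x)) \<le> 2 * e * (s * s)"
      using norm_triangle_ineq4[of "?D - (s * s) *\<^sub>R partial j (partial i f) x"
          "?D - (s * s) *\<^sub>R partial i (partial j f) x"]
      by (simp add: scaleR_diff_right)
    then show ?thesis using s(1) by (simp add: mult.commute[of _ "s * s"] abs_mult mult_ac)
  qed
  then have "cmod (partial i (partial j f) x - partial j (partial i f) x) \<le> e" if "e > 0" for e
    using that by (metis half_gt_zero_iff mult_2 field_sum_of_halves)
  then show "partial i (partial j f) x = partial j (partial i f) x"
    by (metis dense_ge eq_iff_diff_eq_0 norm_le_zero_iff)
qed

lemma partials_partial:
  assumes f: "f \<in> smooth_functions"
  shows "partials is (partial i f) = partial i (partials is f)"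
proof (induction "is")
  case (Cons j js)
  show ?case unfolding partials.simps Cons by (rule partial_commute[OF smooth_partials[OF f]])
qed simp

section \<open>Jets\<close>

text \<open>All estimates below are pointwise estimates of the following sum over the derivatives of order
  at most \<open>N\<close>; it behaves like an absolute value that is submultiplicative up to a constant.\<close>

definition jet :: "nat \<Rightarrow> (real^'n::finite \<Rightarrow> complex) \<Rightarrow> real^'n \<Rightarrow> real" where
  "jet N f x = (\<Sum>is | length is \<le> N. cmod (partials is f x))"

lemma finite_indices: "finite {is :: 'n::finite list. length is \<le> N}"
  using finite_lists_length_le[of "UNIV :: 'n set" N] by simp

lemma jet_nonneg: "0 \<le> jet N f x"
  by (simp add: jet_def sum_nonneg)

lemma partials_le_jet: "length is \<le> N \<Longrightarrow> cmod (partials is f x) \<le> jet N f x"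
  unfolding jet_def
  by (rule member_le_sum[where f="\<lambda>is. cmod (partials is f x)"]) (auto simp: finite_indices)

lemma cmod_le_jet: "cmod (f x) \<le> jet N f x"
  using partials_le_jet[of "[]" N f x] by simp

lemma jet_mono: "N \<le> M \<Longrightarrow> jet N f x \<le> jet M f x"
  unfolding jet_def by (rule sum_mono2) (auto simp: finite_indices)

lemma jet_le_card:
  fixes f :: "real^'n::finite \<Rightarrow> complex"
  assumes "\<And>is. length is \<le> N \<Longrightarrow> cmod (partials is f x) \<le> M"
  shows "jet N f x \<le> real (card {is :: 'n list. length is \<le> N}) * M"
  unfolding jet_def using assms by (intro sum_bounded_above) auto

lemma jet_add:
  assumes "f \<in> smooth_functions" "g \<in> smooth_functions"
  shows "jet N (\<lambda>x. f x + g x) x \<le> jet N f x + jet N g x"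
  unfolding jet_def partials_linear(1)[OF assms] sum.distrib[symmetric]
  by (intro sum_mono norm_triangle_ineq)

lemma jet_diff:
  assumes "f \<in> smooth_functions" "g \<in> smooth_functions"
  shows "jet N (\<lambda>x. f x - g x) x \<le> jet N f x + jet N g x"
  unfolding jet_def partials_diff[OF assms] sum.distrib[symmetric]
  by (intro sum_mono norm_triangle_ineq4)

lemma jet_scale:
  assumes "f \<in> smooth_functions"
  shows "jet N (\<lambda>x. c * f x) x = cmod c * jet N f x"
  unfolding jet_def partials_linear(2)[OF assms assms] by (simp add: norm_mult sum_distrib_left)

lemma jet_translate: "jet N (translate h f) x = jet N f (x - h)"
  by (simp add: jet_def partials_translate) (simp add: translate_def)

lemma jet_const: "jet N (\<lambda>_. c) x = cmod c"
proof -
  have "cmod (partials is (\<lambda>_. c) x) = (if is = [] then cmod c else 0)" for "is" :: "'a list"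
    by (simp add: partials_const)
  then show ?thesis unfolding jet_def by (simp add: finite_indices)
qed

lemma jet_partials:
  fixes f :: "real^'n::finite \<Rightarrow> complex"
  shows "jet N (partials js f) x \<le> real (card {is :: 'n list. length is \<le> N}) * jet (N + length js) f x"
  by (rule jet_le_card) (simp flip: partials_append add: partials_le_jet)

lemma jet_continuous: "f \<in> smooth_functions \<Longrightarrow> continuous_on A (jet N f)"
  unfolding jet_def by (intro continuous_on_sum continuous_on_norm smooth_continuous)

lemma jet_measurable: "f \<in> smooth_functions \<Longrightarrow> jet N f \<in> borel_measurable borel"
  by (intro borel_measurable_continuous_onI jet_continuous)

text \<open>A weak form of the Leibniz rule. Differentiating a product once gives two products, so a
  derivative of order \<open>m\<close> is a sum of \<open>2\<^sup>m\<close> products, and only their size matters. The induction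
  removes the direction that is differentiated first, which is the last one of the list.\<close>

lemma partials_mult_bound:
  assumes "f \<in> smooth_functions" "g \<in> smooth_functions"
    and "\<And>js. length js \<le> length is \<Longrightarrow> cmod (partials js f x) \<le> F"
    and "\<And>js. length js \<le> length is \<Longrightarrow> cmod (partials js g x) \<le> G"
  shows "cmod (partials is (\<lambda>x. f x * g x) x) \<le> 2 ^ length is * (F * G)"
  using assms
proof (induction "is" arbitrary: f g rule: rev_induct)
  case Nil
  have "0 \<le> F" using Nil(3)[of "[]"] by (auto intro: order_trans[OF norm_ge_zero])
  then show ?case using Nil(3,4)[of "[]"] by (auto simp: norm_mult intro!: mult_mono)
next
  case (snoc i js)
  have "partial i (\<lambda>x. f x * g x) = (\<lambda>x. partial i f x * g x + f x * partial i g x)"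
    using snoc.prems by (auto simp: partial_mult smooth_differentiable0)
  then have "partials (js @ [i]) (\<lambda>x. f x * g x) x =
      partials js (\<lambda>x. partial i f x * g x) x + partials js (\<lambda>x. f x * partial i g x) x"
    using snoc.prems by (simp add: partials_append partials_linear smooth_mult smooth_partial)
  moreover have "cmod (partials js (\<lambda>x. partial i f x * g x) x) \<le> 2 ^ length js * (F * G)"
  proof (rule snoc.IH)
    show "cmod (partials ks (partial i f) x) \<le> F" if "length ks \<le> length js" for ks
      using snoc.prems(3)[of "ks @ [i]"] that by (simp add: partials_append)
  qed (use snoc.prems in \<open>auto intro: smooth_partial\<close>)
  moreover have "cmod (partials js (\<lambda>x. f x * partial i g x) x) \<le> 2 ^ length js * (F * G)"
  proof (rule snoc.IH)
    show "cmod (partials ks (partial i g) x) \<le> G" if "length ks \<le> length js" for ks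
      using snoc.prems(4)[of "ks @ [i]"] that by (simp add: partials_append)
  qed (use snoc.prems in \<open>auto intro: smooth_partial\<close>)
  ultimately show ?case
    using norm_triangle_ineq[of "partials js (\<lambda>x. partial i f x * g x) x" "partials js (\<lambda>x. f x * partial i g x) x"]
    by simp
qed

lemma jet_mult:
  "\<exists>C\<ge>0. \<forall>f\<in>smooth_functions. \<forall>g\<in>smooth_functions. \<forall>x :: real^'n::finite.
     jet N (\<lambda>x. f x * g x) x \<le> C * (jet N f x * jet N g x)"
proof (intro exI conjI ballI allI)
  let ?K = "real (card {is :: 'n list. length is \<le> N})"
  fix f g :: "real^'n \<Rightarrow> complex" and x
  assume fg: "f \<in> smooth_functions" "g \<in> smooth_functions"
  have "cmod (partials is (\<lambda>x. f x * g x) x) \<le> 2 ^ N * (jet N f x * jet N g x)" if "length is \<le> N" for "is"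
  proof -
    have "cmod (partials is (\<lambda>x. f x * g x) x) \<le> 2 ^ length is * (jet N f x * jet N g x)"
      using that by (intro partials_mult_bound fg partials_le_jet) auto
    also have "\<dots> \<le> 2 ^ N * (jet N f x * jet N g x)"
      using that by (intro mult_right_mono power_increasing mult_nonneg_nonneg jet_nonneg) auto
    finally show ?thesis .
  qed
  from jet_le_card[OF this] show "jet N (\<lambda>x. f x * g x) x \<le> (?K * 2 ^ N) * (jet N f x * jet N g x)"
    by (simp add: mult_ac)
qed simp

lemma onorm_partials_le:
  fixes d :: "'n::finite \<Rightarrow> complex"
  shows "onorm (\<lambda>v :: real^'n. \<Sum>i\<in>UNIV. (v $ i) *\<^sub>R d i) \<le> (\<Sum>i\<in>UNIV. cmod (d i))"
proof (rule onorm_le)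
  fix v :: "real^'n"
  have "cmod (\<Sum>i\<in>UNIV. (v $ i) *\<^sub>R d i) \<le> (\<Sum>i\<in>UNIV. cmod (d i) * norm v)"
  proof (rule sum_norm_le)
    show "cmod ((v $ i) *\<^sub>R d i) \<le> cmod (d i) * norm v" for i
      using mult_left_mono[OF component_le_norm_cart[of v i], of "cmod (d i)"]
      by (simp add: mult.commute)
  qed
  then show "cmod (\<Sum>i\<in>UNIV. (v $ i) *\<^sub>R d i) \<le> (\<Sum>i\<in>UNIV. cmod (d i)) * norm v"
    by (simp add: sum_distrib_right)
qed

lemma smooth_mean_value:
  fixes f :: "real^'n::finite \<Rightarrow> complex"
  assumes f: "f \<in> smooth_functions"
    and M: "\<And>t i. 0 \<le> t \<Longrightarrow> t \<le> 1 \<Longrightarrow> cmod (partial i f (x + t *\<^sub>R v)) \<le> M"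
  shows "cmod (f (x + v) - f x) \<le> real CARD('n) * M * norm v"
proof -
  have "norm (f (x + v) - f x) \<le> norm v * (real CARD('n) * M)"
  proof (rule differentiable_bound_segment[where G=UNIV])
    show "(f has_derivative (\<lambda>v. \<Sum>i\<in>UNIV. (v $ i) *\<^sub>R partial i f z)) (at z within UNIV)" for z
      by (simp add: has_derivative_partials smooth_differentiable0 f)
    show "onorm (\<lambda>v'. \<Sum>i\<in>UNIV. (v' $ i) *\<^sub>R partial i f (x + t *\<^sub>R v)) \<le> real CARD('n) * M"
      if "t \<in> {0..1}" for t
      by (rule order_trans[OF onorm_partials_le]) (use M that in \<open>auto intro!: sum_bounded_above\<close>)
  qed auto
  then show ?thesis by (simp add: mult.commute)
qed

text \<open>The linearisation error of \<open>f\<close> is controlled by the variation of its derivative along the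
  segment, and that variation by the second derivatives.\<close>

lemma smooth_taylor:
  fixes f :: "real^'n::finite \<Rightarrow> complex"
  assumes f: "f \<in> smooth_functions"
    and M: "\<And>t i j. 0 \<le> t \<Longrightarrow> t \<le> 1 \<Longrightarrow> cmod (partial i (partial j f) (x + t *\<^sub>R v)) \<le> M"
  shows "cmod (f (x + v) - f x - (\<Sum>i\<in>UNIV. (v $ i) *\<^sub>R partial i f x)) \<le> real CARD('n) ^ 2 * M * norm v ^ 2"
proof -
  define d where "d z = (\<lambda>v. \<Sum>i\<in>UNIV. (v $ i) *\<^sub>R partial i f z)" for z
  let ?S = "closed_segment x (x + v)"
  have "norm (f (x + v) - f x - d x (x + v - x)) \<le>
      norm (x + v - x) * (real CARD('n) * (real CARD('n) * M * norm v))"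
  proof (rule differentiable_bound_linearization[where S="?S" and f'=d and f=f and a=x and b="x + v" and ?x0.0=x])
    show "(f has_derivative d z) (at z within ?S)" for z
      unfolding d_def
      by (rule has_derivative_at_withinI[OF has_derivative_partials[OF smooth_differentiable0[OF f]]])
    show "onorm (d z - d x) \<le> real CARD('n) * (real CARD('n) * M * norm v)" if z: "z \<in> ?S" for z
    proof -
      obtain t where t: "0 \<le> t" "t \<le> 1" "z = x + t *\<^sub>R v"
        using z by (auto simp: in_segment scaleR_left_diff_distrib scaleR_right_distrib)
      have "cmod (partial i f z - partial i f x) \<le> real CARD('n) * M * norm v" for i
      proof -
        have M0: "0 \<le> M" using M[of 0 i i] by (auto intro: order_trans[OF norm_ge_zero])
        have "cmod (partial i f (x + t *\<^sub>R v) - partial i f x) \<le> real CARD('n) * M * norm (t *\<^sub>R v)"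
        proof (rule smooth_mean_value[OF smooth_partial[OF f]])
          fix s j assume s: "0 \<le> s" "s \<le> (1::real)"
          then show "cmod (partial j (partial i f) (x + s *\<^sub>R t *\<^sub>R v)) \<le> M"
            using M[of "s * t" j i] t by (simp add: mult_le_one)
        qed
        also have "\<dots> \<le> real CARD('n) * M * norm v"
          using t M0 by (intro mult_left_mono) (auto intro!: mult_left_le_one_le)
        finally show ?thesis using t by simp
      qed
      then have "(\<Sum>i\<in>UNIV. cmod (partial i f z - partial i f x)) \<le> real CARD('n) * (real CARD('n) * M * norm v)"
        by (intro sum_bounded_above) auto
      moreover have "d z - d x = (\<lambda>v. \<Sum>i\<in>UNIV. (v $ i) *\<^sub>R (partial i f z - partial i f x))"
        by (simp add: d_def fun_eq_iff sum_subtractf scaleR_diff_right)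
      ultimately show ?thesis
        using order_trans[OF onorm_partials_le[of "\<lambda>i. partial i f z - partial i f x"]] by simp
    qed
    show "x + t *\<^sub>R (x + v - x) \<in> ?S" if "t \<in> {0..1}" for t
      using that by (auto simp: in_segment scaleR_left_diff_distrib scaleR_right_distrib intro!: exI[of _ t])
  qed simp
  then show ?thesis by (simp add: d_def power2_eq_square mult_ac)
qed

text \<open>The bound on the derivatives is only required on the segment from \<open>x\<close> to \<open>x + v\<close>: with a bound
  that depends on \<open>x\<close>, decay of the derivatives is inherited by the differences.\<close>

lemma jet_mean_value:
  "\<exists>C\<ge>0. \<forall>f\<in>smooth_functions. \<forall>(x :: real^'n::finite) v M.
     (\<forall>t. 0 \<le> t \<and> t \<le> 1 \<longrightarrow> jet (Suc N) f (x + t *\<^sub>R v) \<le> M) \<longrightarrow>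
     jet N (\<lambda>z. f (z + v) - f z) x \<le> C * (M * norm v)"
proof (intro exI conjI ballI allI impI)
  let ?K = "real (card {is :: 'n list. length is \<le> N})"
  fix f :: "real^'n \<Rightarrow> complex" and x v M
  assume f: "f \<in> smooth_functions" and M: "\<forall>t. 0 \<le> t \<and> t \<le> 1 \<longrightarrow> jet (Suc N) f (x + t *\<^sub>R v) \<le> M"
  have "cmod (partials is (\<lambda>z. f (z + v) - f z) x) \<le> real CARD('n) * M * norm v" if "length is \<le> N" for "is"
  proof -
    have "cmod (partials is f (x + v) - partials is f x) \<le> real CARD('n) * M * norm v"
    proof (rule smooth_mean_value[OF smooth_partials[OF f]])
      fix t i assume "0 \<le> t" "t \<le> (1::real)"
      then show "cmod (partial i (partials is f) (x + t *\<^sub>R v)) \<le> M"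
        using partials_le_jet[of "i # is" "Suc N" f "x + t *\<^sub>R v"] M that by fastforce
    qed
    then show ?thesis
      using partials_diff[OF smooth_translate[OF f, of "- v"] f, of "is"]
      by (simp add: partials_translate) (simp add: translate_def)
  qed
  from jet_le_card[OF this] show "jet N (\<lambda>z. f (z + v) - f z) x \<le> (?K * real CARD('n)) * (M * norm v)"
    by (simp add: mult_ac)
qed simp

lemma smooth_sum:
  assumes "finite A" "\<And>i. i \<in> A \<Longrightarrow> f i \<in> smooth_functions"
  shows "(\<lambda>x. \<Sum>i\<in>A. c i * f i x) \<in> smooth_functions"
    and "partials is (\<lambda>x. \<Sum>i\<in>A. c i * f i x) = (\<lambda>x. \<Sum>i\<in>A. c i * partials is (f i) x)"
proof -
  have "(\<lambda>x. \<Sum>i\<in>A. c i * f i x) \<in> smooth_functions \<and>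
     partials is (\<lambda>x. \<Sum>i\<in>A. c i * f i x) = (\<lambda>x. \<Sum>i\<in>A. c i * partials is (f i) x)"
    using assms
  proof (induction A)
    case (insert i A)
    have 1: "(\<lambda>x. c i * f i x) \<in> smooth_functions" "(\<lambda>x. \<Sum>i\<in>A. c i * f i x) \<in> smooth_functions"
      using insert by (auto intro: smooth_functions_linear)
    show ?case
      using insert smooth_add[OF 1] partials_linear(1)[OF 1, of "is"]
        partials_linear(2)[of "f i" "f i" "is" "c i"] by simp
  qed (auto simp: partials_const smooth_const)
  then show "(\<lambda>x. \<Sum>i\<in>A. c i * f i x) \<in> smooth_functions"
    "partials is (\<lambda>x. \<Sum>i\<in>A. c i * f i x) = (\<lambda>x. \<Sum>i\<in>A. c i * partials is (f i) x)" by auto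
qed

text \<open>The derivative of \<open>\<partial>\<^sup>\<beta> f\<close> is expressed by \<open>\<partial>\<^sub>i \<partial>\<^sup>\<beta> f\<close>, whereas \<open>\<partial>\<^sup>\<beta>\<close> of the
  linear part below gives \<open>\<partial>\<^sup>\<beta> \<partial>\<^sub>i f\<close>; this is where the symmetry of second derivatives enters.\<close>

lemma jet_taylor:
  "\<exists>C\<ge>0. \<forall>f\<in>smooth_functions. \<forall>(x :: real^'n::finite) v M.
     (\<forall>t. 0 \<le> t \<and> t \<le> 1 \<longrightarrow> jet (N + 2) f (x + t *\<^sub>R v) \<le> M) \<longrightarrow>
     jet N (\<lambda>z. f (z + v) - f z - (\<Sum>i\<in>UNIV. of_real (v $ i) * partial i f z)) x \<le> C * (M * norm v ^ 2)"
proof (intro exI conjI ballI allI impI)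
  let ?K = "real (card {is :: 'n list. length is \<le> N})"
  fix f :: "real^'n \<Rightarrow> complex" and x v M
  assume f: "f \<in> smooth_functions" and M: "\<forall>t. 0 \<le> t \<and> t \<le> 1 \<longrightarrow> jet (N + 2) f (x + t *\<^sub>R v) \<le> M"
  have "cmod (partials is (\<lambda>z. f (z + v) - f z - (\<Sum>i\<in>UNIV. of_real (v $ i) * partial i f z)) x)
      \<le> real CARD('n) ^ 2 * M * norm v ^ 2" if "length is \<le> N" for "is"
  proof -
    have "cmod (partials is f (x + v) - partials is f x - (\<Sum>i\<in>UNIV. (v $ i) *\<^sub>R partial i (partials is f) x))
        \<le> real CARD('n) ^ 2 * M * norm v ^ 2"
    proof (rule smooth_taylor[OF smooth_partials[OF f]])
      fix t i j assume "0 \<le> t" "t \<le> (1::real)"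
      then show "cmod (partial i (partial j (partials is f)) (x + t *\<^sub>R v)) \<le> M"
        using partials_le_jet[of "i # j # is" "N + 2" f "x + t *\<^sub>R v"] M that by fastforce
    qed
    moreover have "partials is (\<lambda>z. f (z + v) - f z - (\<Sum>i\<in>UNIV. of_real (v $ i) * partial i f z)) =
        (\<lambda>x. partials is f (x + v) - partials is f x - (\<Sum>i\<in>UNIV. of_real (v $ i) * partial i (partials is f) x))"
    proof -
      have tr: "(\<lambda>z. f (z + v)) \<in> smooth_functions" "partials is (\<lambda>z. f (z + v)) = (\<lambda>z. partials is f (z + v))"
        using smooth_translate[OF f, of "- v"] partials_translate[of "is" "- v" f] by (auto simp: translate_def)
      have sm: "(\<lambda>z. \<Sum>i\<in>UNIV. of_real (v $ i) * partial i f z) \<in> smooth_functions"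
        by (intro smooth_sum) (auto intro: smooth_partial f)
      have "partials is (\<lambda>z. \<Sum>i\<in>UNIV. of_real (v $ i) * partial i f z) =
          (\<lambda>x. \<Sum>i\<in>UNIV. of_real (v $ i) * partials is (partial i f) x)"
        by (intro smooth_sum) (auto intro: smooth_partial f)
      then show ?thesis
        by (simp add: partials_diff[OF smooth_functions_diff[OF tr(1) f] sm] partials_diff[OF tr(1) f]
            partials_partial[OF f] tr(2))
    qed
    ultimately show ?thesis by (simp add: scaleR_conv_of_real)
  qed
  from jet_le_card[OF this]
  show "jet N (\<lambda>z. f (z + v) - f z - (\<Sum>i\<in>UNIV. of_real (v $ i) * partial i f z)) x
      \<le> (?K * real CARD('n) ^ 2) * (M * norm v ^ 2)"
    by (simp add: mult_ac)
qed simp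

section \<open>The test function spaces in terms of jets\<close>

lemma B_space_iff: "f \<in> B_space \<longleftrightarrow> f \<in> smooth_functions \<and> (\<forall>N. \<exists>C. \<forall>x. jet N f x \<le> C)"
proof safe
  fix N assume f: "f \<in> B_space"
  have "\<forall>is. \<exists>C. \<forall>x. cmod (partials is f x) \<le> C"
    using f by (auto simp: B_space_def bounded_iff)
  then obtain C where C: "\<And>is x. cmod (partials is f x) \<le> C is" by metis
  have "jet N f x \<le> (\<Sum>is | length is \<le> N. C is)" for x
    unfolding jet_def by (intro sum_mono C)
  then show "\<exists>C. \<forall>x. jet N f x \<le> C" by blast
next
  assume f: "f \<in> smooth_functions" "\<forall>N. \<exists>C. \<forall>x. jet N f x \<le> C"
  have "bounded (range (partials is f))" for "is"
  proof -
    obtain C where "\<And>x. jet (length is) f x \<le> C" using f by blast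
    then have "cmod (partials is f x) \<le> C" for x
      using partials_le_jet[of "is" "length is" f x] by (meson order_refl order_trans)
    then show ?thesis by (auto simp: bounded_iff)
  qed
  then show "f \<in> B_space" using f by (simp add: B_space_def)
qed (simp add: B_space_def)

lemma B_space_smooth: "f \<in> B_space \<Longrightarrow> f \<in> smooth_functions"
  by (simp add: B_space_def)

lemma B_space_jet:
  assumes "f \<in> B_space"
  obtains C where "C \<ge> 0" "\<And>x. jet N f x \<le> C"
proof -
  obtain C where "\<And>x. jet N f x \<le> C" using assms B_space_iff by blast
  then show thesis using that[of C] jet_nonneg[of N f undefined] order_trans by blast
qed

lemma B_dot_iff: "f \<in> B_dot \<longleftrightarrow> f \<in> B_space \<and> (\<forall>N. (jet N f \<longlongrightarrow> 0) at_infinity)"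
proof safe
  fix N assume f: "f \<in> B_dot"
  have "((\<lambda>x. cmod (partials is f x)) \<longlongrightarrow> 0) at_infinity" for "is"
    using f by (auto simp: B_dot_def intro: tendsto_norm_zero)
  then show "(jet N f \<longlongrightarrow> 0) at_infinity"
    unfolding jet_def[abs_def] by (rule tendsto_null_sum)
next
  assume f: "f \<in> B_space" "\<forall>N. (jet N f \<longlongrightarrow> 0) at_infinity"
  have "(partials is f \<longlongrightarrow> 0) at_infinity" for "is"
    by (rule Lim_null_comparison[where g="jet (length is) f"]) (use f in \<open>auto simp: partials_le_jet\<close>)
  then show "f \<in> B_dot" using f by (simp add: B_dot_def)
qed (simp add: B_dot_def)

lemma schwartz_iff:
  "f \<in> schwartz \<longleftrightarrow> f \<in> smooth_functions \<and> (\<forall>N P. \<exists>C. \<forall>x. (1 + (norm x)\<^sup>2) ^ P * jet N f x \<le> C)"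
proof safe
  fix N P assume f: "f \<in> schwartz"
  have "\<forall>is. \<exists>C. \<forall>x. (1 + (norm x)\<^sup>2) ^ P * cmod (partials is f x) \<le> C"
    using f by (auto simp: schwartz_def bdd_above_def)
  then obtain C where C: "\<And>is x. (1 + (norm x)\<^sup>2) ^ P * cmod (partials is f x) \<le> C is" by metis
  have "(1 + (norm x)\<^sup>2) ^ P * jet N f x \<le> (\<Sum>is | length is \<le> N. C is)" for x
    unfolding jet_def sum_distrib_left by (intro sum_mono C)
  then show "\<exists>C. \<forall>x. (1 + (norm x)\<^sup>2) ^ P * jet N f x \<le> C" by blast
next
  assume f: "f \<in> smooth_functions" "\<forall>N P. \<exists>C. \<forall>x. (1 + (norm x)\<^sup>2) ^ P * jet N f x \<le> C"
  have "bdd_above (range (\<lambda>x. (1 + (norm x)\<^sup>2) ^ P * cmod (partials is f x)))" for P "is"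
  proof -
    obtain C where C: "\<And>x. (1 + (norm x)\<^sup>2) ^ P * jet (length is) f x \<le> C" using f by blast
    have "(1 + (norm x)\<^sup>2) ^ P * cmod (partials is f x) \<le> C" for x
      by (rule order_trans[OF mult_left_mono C]) (auto simp: partials_le_jet)
    then show ?thesis by (auto simp: bdd_above_def)
  qed
  then show "f \<in> schwartz" using f by (simp add: schwartz_def)
qed (simp add: schwartz_def)

lemma schwartz_smooth: "f \<in> schwartz \<Longrightarrow> f \<in> smooth_functions"
  by (simp add: schwartz_def)

lemma schwartz_jet:
  assumes "f \<in> schwartz"
  obtains C where "C \<ge> 0" "\<And>x. (1 + (norm x)\<^sup>2) ^ P * jet N f x \<le> C"
proof -
  obtain C where C: "\<And>x. (1 + (norm x)\<^sup>2) ^ P * jet N f x \<le> C" using assms schwartz_iff by blast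
  moreover have "0 \<le> (1 + (norm undefined)\<^sup>2) ^ P * jet N f undefined"
    by (intro mult_nonneg_nonneg jet_nonneg) auto
  ultimately show thesis using that[of C] order_trans by blast
qed

lemma B_dot_subset_B_space: "B_dot \<subseteq> B_space"
  by (auto simp: B_dot_def)

lemma schwartz_subset_B_dot: "schwartz \<subseteq> (B_dot :: (real^'n::finite \<Rightarrow> complex) set)"
proof
  fix f :: "real^'n \<Rightarrow> complex" assume f: "f \<in> schwartz"
  have "\<exists>C. \<forall>x. jet N f x \<le> C" for N
    using schwartz_jet[OF f, of 0 N] by (metis mult_1 power_0)
  then have "f \<in> B_space" using schwartz_smooth[OF f] by (simp add: B_space_iff)
  moreover have "(jet N f \<longlongrightarrow> 0) at_infinity" for N
  proof -
    obtain C where C: "C \<ge> 0" "\<And>x. (1 + (norm x)\<^sup>2) ^ 1 * jet N f x \<le> C"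
      using schwartz_jet[OF f] by metis
    have "((\<lambda>x::real^'n. C / (1 + (norm x)\<^sup>2)) \<longlongrightarrow> 0) at_infinity"
    proof -
      have "filterlim (\<lambda>x::real^'n. (norm x)\<^sup>2) at_top at_infinity"
        by (intro filterlim_pow_at_top filterlim_norm_at_top) simp
      then have "filterlim (\<lambda>x::real^'n. 1 + (norm x)\<^sup>2) at_top at_infinity"
        by (rule filterlim_tendsto_add_at_top[OF tendsto_const])
      then show ?thesis
        by (intro real_tendsto_divide_at_top[OF tendsto_const])
    qed
    moreover have "norm (jet N f x) \<le> C / (1 + (norm x)\<^sup>2)" for x
      using C(2)[of x] jet_nonneg[of N f x]
      by (simp add: pos_le_divide_eq add_pos_nonneg mult.commute)
    ultimately show ?thesis by - (rule Lim_null_comparison[where g="\<lambda>x. C / (1 + (norm x)\<^sup>2)"], auto)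
  qed
  ultimately show "f \<in> B_dot" by (simp add: B_dot_iff)
qed

text \<open>\<open>B_space\<close>, \<open>B_dot\<close> and the Schwartz space are all defined by a linear condition that every
  derivative has to satisfy.\<close>

lemma linear_space_smooth_subspace:
  assumes add: "\<And>f g. Q f \<Longrightarrow> Q g \<Longrightarrow> Q (\<lambda>x. f x + g x)"
    and scale: "\<And>f c. Q f \<Longrightarrow> Q (\<lambda>x. c * f x)"
  shows "linear_space {f \<in> smooth_functions. \<forall>is. Q (partials is f)}"
  unfolding linear_space_def
proof (intro conjI ballI allI)
  fix c f assume "f \<in> {f \<in> smooth_functions. \<forall>is. Q (partials is f)}"
  then show "(\<lambda>x. c * f x) \<in> {f \<in> smooth_functions. \<forall>is. Q (partials is f)}"
    using partials_linear(2)[of f f _ c] smooth_functions_linear(2)[of f f c] by (auto intro: scale)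
qed (auto simp: partials_linear(1) smooth_functions_linear(1) intro: add)

lemma bounded_range_linear:
  fixes f g :: "'a \<Rightarrow> complex"
  shows "bounded (range f) \<Longrightarrow> bounded (range g) \<Longrightarrow> bounded (range (\<lambda>x. f x + g x))"
    and "bounded (range f) \<Longrightarrow> bounded (range (\<lambda>x. c * f x))"
proof -
  assume "bounded (range f)" "bounded (range g)"
  then obtain a b where "\<And>x. cmod (f x) \<le> a" "\<And>x. cmod (g x) \<le> b"
    by (auto simp: bounded_iff)
  then show "bounded (range (\<lambda>x. f x + g x))"
    unfolding bounded_iff by (intro exI[of _ "a + b"]) (auto intro: norm_triangle_mono)
next
  assume "bounded (range f)"
  then obtain a where "\<And>x. cmod (f x) \<le> a" by (auto simp: bounded_iff)
  then show "bounded (range (\<lambda>x. c * f x))"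
    unfolding bounded_iff by (intro exI[of _ "cmod c * a"]) (auto simp: norm_mult mult_left_mono)
qed

lemma linear_space_B_space: "linear_space B_space"
  unfolding B_space_def by (intro linear_space_smooth_subspace bounded_range_linear)

lemma linear_space_B_dot: "linear_space (B_dot :: (real^'n::finite \<Rightarrow> complex) set)"
proof -
  have "(B_dot :: (real^'n \<Rightarrow> complex) set) = {f \<in> smooth_functions. \<forall>is. bounded (range (partials is f)) \<and> (partials is f \<longlongrightarrow> 0) at_infinity}"
    by (auto simp: B_dot_def B_space_def)
  moreover have "linear_space \<dots>"
  proof (rule linear_space_smooth_subspace)
    fix f g :: "real^'n \<Rightarrow> complex"
    assume "bounded (range f) \<and> (f \<longlongrightarrow> 0) at_infinity" "bounded (range g) \<and> (g \<longlongrightarrow> 0) at_infinity"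
    then show "bounded (range (\<lambda>x. f x + g x)) \<and> ((\<lambda>x. f x + g x) \<longlongrightarrow> 0) at_infinity"
      using tendsto_add[of f 0 at_infinity g 0] by (simp add: bounded_range_linear)
  qed (auto intro: bounded_range_linear tendsto_mult_right_zero)
  ultimately show ?thesis by simp
qed

lemma linear_space_schwartz: "linear_space (schwartz :: (real^'n::finite \<Rightarrow> complex) set)"
proof -
  let ?q = "\<lambda>N x :: real^'n. (1 + (norm x)\<^sup>2) ^ N"
  have "(schwartz :: (real^'n \<Rightarrow> complex) set) = {f \<in> smooth_functions. \<forall>is. \<forall>N. bdd_above (range (\<lambda>x. ?q N x * cmod (partials is f x)))}"
    by (auto simp: schwartz_def)
  moreover have "linear_space \<dots>"
  proof (rule linear_space_smooth_subspace)
    fix f g :: "real^'n \<Rightarrow> complex"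
    assume fg: "\<forall>N. bdd_above (range (\<lambda>x. ?q N x * cmod (f x)))" "\<forall>N. bdd_above (range (\<lambda>x. ?q N x * cmod (g x)))"
    show "\<forall>N. bdd_above (range (\<lambda>x. ?q N x * cmod (f x + g x)))"
    proof
      fix N
      obtain a b where ab: "\<And>x. ?q N x * cmod (f x) \<le> a" "\<And>x. ?q N x * cmod (g x) \<le> b"
        using fg by (auto simp: bdd_above_def dest!: spec[of _ N])
      have "?q N x * cmod (f x + g x) \<le> a + b" for x
      proof -
        have "?q N x * cmod (f x + g x) \<le> ?q N x * (cmod (f x) + cmod (g x))"
          by (intro mult_left_mono norm_triangle_ineq) auto
        then show ?thesis using ab[of x] by (simp add: distrib_left)
      qed
      then show "bdd_above (range (\<lambda>x. ?q N x * cmod (f x + g x)))" by (auto simp: bdd_above_def)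
    qed
  next
    fix f :: "real^'n \<Rightarrow> complex" and c
    assume f: "\<forall>N. bdd_above (range (\<lambda>x. ?q N x * cmod (f x)))"
    show "\<forall>N. bdd_above (range (\<lambda>x. ?q N x * cmod (c * f x)))"
    proof
      fix N
      obtain a where a: "\<And>x. ?q N x * cmod (f x) \<le> a"
        using f by (auto simp: bdd_above_def dest!: spec[of _ N])
      have "?q N x * cmod (c * f x) \<le> cmod c * a" for x
        using mult_left_mono[OF a[of x], of "cmod c"] by (simp add: norm_mult mult_ac)
      then show "bdd_above (range (\<lambda>x. ?q N x * cmod (c * f x)))" by (auto simp: bdd_above_def)
    qed
  qed
  ultimately show ?thesis by simp
qed

lemma B_space_const: "(\<lambda>_. c) \<in> B_space"
  by (auto simp: B_space_iff smooth_const jet_const)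

text \<open>Multipliers of the Schwartz space: all derivatives have polynomial growth.\<close>

lemma schwartz_mult:
  assumes f: "f \<in> smooth_functions" "\<And>N. \<exists>C P. \<forall>x. jet N f x \<le> C * (1 + (norm x)\<^sup>2) ^ P"
    and g: "g \<in> schwartz"
  shows "(\<lambda>x. f x * g x) \<in> schwartz"
proof -
  have "\<exists>C. \<forall>x. (1 + (norm x)\<^sup>2) ^ P * jet N (\<lambda>x. f x * g x) x \<le> C" for N P
  proof -
    obtain C where C: "C \<ge> 0" "\<And>x. jet N (\<lambda>x. f x * g x) x \<le> C * (jet N f x * jet N g x)"
      using jet_mult[of N] f(1) schwartz_smooth[OF g] by metis
    obtain A Q where A: "\<And>x. jet N f x \<le> A * (1 + (norm x)\<^sup>2) ^ Q" using f(2) by blast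
    have A0: "A \<ge> 0"
      using order_trans[OF jet_nonneg A, of 0] by simp
    obtain D where D: "\<And>x. (1 + (norm x)\<^sup>2) ^ (P + Q) * jet N g x \<le> D"
      using schwartz_jet[OF g] by metis
    have "(1 + (norm x)\<^sup>2) ^ P * jet N (\<lambda>x. f x * g x) x \<le> C * A * D" for x
    proof -
      let ?b = "1 + (norm x)\<^sup>2"
      have "?b ^ P * jet N (\<lambda>x. f x * g x) x \<le> ?b ^ P * (C * ((A * ?b ^ Q) * jet N g x))"
        by (intro mult_left_mono order_trans[OF C(2)] mult_right_mono A C(1) jet_nonneg) auto
      also have "\<dots> = (C * A) * (?b ^ (P + Q) * jet N g x)" by (simp add: power_add mult_ac)
      also have "\<dots> \<le> (C * A) * D" by (intro mult_left_mono D mult_nonneg_nonneg C(1) A0)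
      finally show ?thesis .
    qed
    then show ?thesis by blast
  qed
  then show ?thesis using f(1) schwartz_smooth[OF g] by (simp add: schwartz_iff smooth_mult)
qed

lemma schwartz_mult_B_space:
  assumes "f \<in> B_space" "g \<in> schwartz"
  shows "(\<lambda>x. f x * g x) \<in> schwartz"
proof (rule schwartz_mult)
  show "\<exists>C P. \<forall>x. jet N f x \<le> C * (1 + (norm x)\<^sup>2) ^ P" for N
    using B_space_jet[OF assms(1), of N] by (metis mult.right_neutral power_0)
qed (use assms B_space_smooth in auto)

lemma schwartz_translate:
  assumes f: "f \<in> schwartz"
  shows "translate h f \<in> schwartz"
proof -
  have "\<exists>C. \<forall>x. (1 + (norm x)\<^sup>2) ^ P * jet N (translate h f) x \<le> C" for N P
  proof -
    obtain C where C: "C \<ge> 0" "\<And>x. (1 + (norm x)\<^sup>2) ^ P * jet N f x \<le> C"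
      using schwartz_jet[OF f] by metis
    have "(1 + (norm x)\<^sup>2) ^ P * jet N (translate h f) x \<le> (2 * (1 + (norm h)\<^sup>2)) ^ P * C" for x
    proof -
      have "norm x \<le> norm (x - h) + norm h" by (metis diff_add_cancel norm_triangle_ineq)
      then have "(norm x)\<^sup>2 \<le> (norm (x - h) + norm h)\<^sup>2" by (intro power_mono) auto
      also have "\<dots> \<le> 2 * (norm (x - h))\<^sup>2 + 2 * (norm h)\<^sup>2"
        using sum_squares_bound[of "norm (x - h)" "norm h"] by (simp add: power2_sum)
      finally have "1 + (norm x)\<^sup>2 \<le> 2 + 2 * (norm (x - h))\<^sup>2 + 2 * (norm h)\<^sup>2 + 2 * ((norm h)\<^sup>2 * (norm (x - h))\<^sup>2)"
        using mult_nonneg_nonneg[OF zero_le_power2 zero_le_power2, of "norm h" "norm (x - h)"] by linarith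
      also have "\<dots> = 2 * (1 + (norm h)\<^sup>2) * (1 + (norm (x - h))\<^sup>2)"
        by (simp add: algebra_simps)
      finally have "1 + (norm x)\<^sup>2 \<le> 2 * (1 + (norm h)\<^sup>2) * (1 + (norm (x - h))\<^sup>2)" .
      then have "(1 + (norm x)\<^sup>2) ^ P \<le> (2 * (1 + (norm h)\<^sup>2) * (1 + (norm (x - h))\<^sup>2)) ^ P"
        by (intro power_mono) auto
      then have "(1 + (norm x)\<^sup>2) ^ P * jet N f (x - h) \<le>
          (2 * (1 + (norm h)\<^sup>2)) ^ P * ((1 + (norm (x - h))\<^sup>2) ^ P * jet N f (x - h))"
        by (simp add: power_mult_distrib mult_right_mono jet_nonneg flip: mult.assoc)
      also have "\<dots> \<le> (2 * (1 + (norm h)\<^sup>2)) ^ P * C"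
        by (intro mult_left_mono C) auto
      finally show ?thesis by (simp add: jet_translate)
    qed
    then show ?thesis by blast
  qed
  then show ?thesis using schwartz_smooth[OF f] by (simp add: schwartz_iff smooth_translate)
qed

section \<open>Duals\<close>

text \<open>This covers the seminorms on functions, where \<open>T\<close> evaluates a derivative at a point, as well as
  the seminorms of the strong dual, where \<open>T\<close> evaluates a form at a test function.\<close>

lemma seminorm_on_SUP:
  fixes T :: "'i \<Rightarrow> ('c \<Rightarrow> complex) \<Rightarrow> complex"
  assumes T: "\<And>i. linear_form_on V (T i)" and I: "I \<noteq> {}" and q: "\<And>i. 0 \<le> q i"
    and bdd: "\<And>f. f \<in> V \<Longrightarrow> bdd_above ((\<lambda>i. q i * cmod (T i f)) ` I)"
  shows "seminorm_on V (\<lambda>f. SUP i\<in>I. q i * cmod (T i f))"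
  unfolding seminorm_on_def
proof (intro conjI ballI allI)
  fix f assume f: "f \<in> V"
  obtain i where "i \<in> I" using I by auto
  then show "0 \<le> (SUP i\<in>I. q i * cmod (T i f))"
    by (intro cSUP_upper2[OF bdd[OF f]]) (auto simp: q)
next
  fix f g assume fg: "f \<in> V" "g \<in> V"
  show "(SUP i\<in>I. q i * cmod (T i (\<lambda>x. f x + g x))) \<le> (SUP i\<in>I. q i * cmod (T i f)) + (SUP i\<in>I. q i * cmod (T i g))"
  proof (rule cSUP_least[OF I])
    fix i assume i: "i \<in> I"
    have "q i * cmod (T i f + T i g) \<le> q i * cmod (T i f) + q i * cmod (T i g)"
      using mult_left_mono[OF norm_triangle_ineq q] by (simp add: distrib_left)
    also have "\<dots> \<le> (SUP i\<in>I. q i * cmod (T i f)) + (SUP i\<in>I. q i * cmod (T i g))"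
      by (intro add_mono cSUP_upper bdd fg i)
    finally show "q i * cmod (T i (\<lambda>x. f x + g x)) \<le> \<dots>" by (simp add: linear_form_onD(1)[OF T fg])
  qed
next
  fix c f assume f: "f \<in> V"
  have "cmod c * (SUP i\<in>I. q i * cmod (T i f)) = (SUP t\<in>(\<lambda>i. q i * cmod (T i f)) ` I. cmod c * t)"
  proof (rule continuous_at_Sup_mono)
    show "continuous (at_left (SUP i\<in>I. q i * cmod (T i f))) (\<lambda>t. cmod c * t)"
      by (intro continuous_mult continuous_const continuous_ident)
  qed (use I bdd[OF f] in \<open>auto simp: mono_def mult_left_mono\<close>)
  then show "(SUP i\<in>I. q i * cmod (T i (\<lambda>x. c * f x))) = cmod c * (SUP i\<in>I. q i * cmod (T i f))"
    by (simp add: linear_form_onD(2)[OF T f] norm_mult image_image mult_ac)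
qed

lemma linear_form_partials:
  "V \<subseteq> smooth_functions \<Longrightarrow> linear_form_on V (\<lambda>f. partials is f x)"
  unfolding linear_form_on_def by (auto simp: partials_linear subset_iff)

lemma B_seminorms_seminorm:
  assumes "p \<in> B_seminorms"
  shows "seminorm_on B_space p" "seminorm_on B_dot p"
proof -
  obtain "is" where p: "p = (\<lambda>f. SUP x. cmod (partials is f x))"
    using assms by (auto simp: B_seminorms_def)
  have "bdd_above (range (\<lambda>x. 1 * cmod (partials is f x)))" if "f \<in> B_space" for f :: "real^'a \<Rightarrow> complex"
    using that by (auto simp: B_space_def bounded_iff bdd_above_def)
  then have "seminorm_on B_space (\<lambda>f. SUP x. 1 * cmod (partials is f x))"
    by (intro seminorm_on_SUP linear_form_partials) (auto simp: B_space_smooth)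
  then show "seminorm_on B_space p" by (simp add: p)
  then show "seminorm_on B_dot p"
    using B_dot_subset_B_space by (auto simp: seminorm_on_def subset_iff)
qed

lemma schwartz_seminorms_seminorm:
  assumes "p \<in> schwartz_seminorms"
  shows "seminorm_on schwartz p"
proof -
  obtain N "is" where p: "p = (\<lambda>f. SUP x. (1 + (norm x)\<^sup>2) ^ N * cmod (partials is f x))"
    using assms by (auto simp: schwartz_seminorms_def)
  show ?thesis
    unfolding p by (intro seminorm_on_SUP linear_form_partials) (auto simp: schwartz_def)
qed

text \<open>Bounds by the supremum of a weighted jet are what the estimates below deliver. Such a supremum is
  at most a constant times the sum of the seminorms of order at most \<open>N\<close>.\<close>

lemma continuous_map_SUP_seminormsI:
  fixes V :: "(real^'n::finite \<Rightarrow> complex) set"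
  assumes V: "linear_space V" and P: "\<And>p. p \<in> P \<Longrightarrow> seminorm_on V p" and u: "linear_form_on V u"
    and sub: "\<And>is. (\<lambda>f. SUP x. q x * cmod (partials is f x)) \<in> P"
    and bdd: "\<And>f is. f \<in> V \<Longrightarrow> bdd_above (range (\<lambda>x. q x * cmod (partials is f x)))"
    and C: "C \<ge> 0" "\<And>f M. f \<in> V \<Longrightarrow> (\<And>x. q x * jet N f x \<le> M) \<Longrightarrow> cmod (u f) \<le> C * M"
  shows "continuous_map (seminorm_topology V P) euclidean u"
proof -
  define p where "p is = (\<lambda>f. SUP x. q x * cmod (partials is f x))" for "is" :: "'n list"
  let ?I = "{is :: 'n list. length is \<le> N}"
  have le: "q x * cmod (partials is f x) \<le> p is f" if "f \<in> V" for f "is" x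
    unfolding p_def by (rule cSUP_upper[OF _ bdd[OF that]]) simp
  have "cmod (u g) \<le> (C * real (card ?I)) * (\<Sum>r\<in>p ` ?I. r g)" if g: "g \<in> V" for g
  proof -
    have pos: "0 \<le> r g" if "r \<in> p ` ?I" for r
      using that seminorm_onD(1)[OF P g] sub by (auto simp: p_def)
    have "q x * jet N g x \<le> real (card ?I) * (\<Sum>r\<in>p ` ?I. r g)" for x
    proof -
      have "q x * cmod (partials is g x) \<le> (\<Sum>r\<in>p ` ?I. r g)" if "is \<in> ?I" for "is"
      proof (rule order_trans[OF le[OF g]])
        show "p is g \<le> (\<Sum>r\<in>p ` ?I. r g)"
          by (rule member_le_sum[where f="\<lambda>r. r g"]) (use that pos in \<open>auto simp: finite_indices\<close>)
      qed
      then show ?thesis unfolding jet_def sum_distrib_left[of "q x"] by (rule sum_bounded_above)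
    qed
    from C(2)[OF g this] show ?thesis by (simp add: mult.assoc)
  qed
  then show ?thesis
    using C(1) sub finite_indices
    by (intro continuous_map_linear_formI[OF V P u, where F="p ` ?I" and C="C * real (card ?I)"])
      (auto simp: p_def)
qed

lemma B_dot_dualI:
  assumes "linear_form_on B_dot u" "\<And>f. f \<notin> B_dot \<Longrightarrow> u f = 0" "C \<ge> 0"
    and "\<And>f M. f \<in> B_dot \<Longrightarrow> (\<And>x. jet N f x \<le> M) \<Longrightarrow> cmod (u f) \<le> C * M"
  shows "u \<in> B_dot_dual"
proof -
  have "continuous_map (seminorm_topology B_dot B_seminorms) euclidean u"
  proof (rule continuous_map_SUP_seminormsI[where q="\<lambda>_. 1" and N=N and C=C])
    show "bdd_above (range (\<lambda>x. 1 * cmod (partials is f x)))" if "f \<in> B_dot" for f :: "real^'a \<Rightarrow> complex" and "is"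
      using that by (auto simp: B_dot_def B_space_def bounded_iff bdd_above_def)
    show "(\<lambda>f. SUP x. 1 * cmod (partials is f x)) \<in> B_seminorms" for "is" :: "'a list"
      by (auto simp: B_seminorms_def)
  qed (simp_all add: assms B_seminorms_seminorm linear_space_B_dot)
  then show ?thesis using assms(1,2) by (auto simp: B_dot_dual_def dual_space_def)
qed

lemma tempered_distrI:
  assumes "linear_form_on schwartz u" "\<And>f. f \<notin> schwartz \<Longrightarrow> u f = 0" "C \<ge> 0"
    and "\<And>f M. f \<in> schwartz \<Longrightarrow> (\<And>x. (1 + (norm x)\<^sup>2) ^ P * jet N f x \<le> M) \<Longrightarrow> cmod (u f) \<le> C * M"
  shows "u \<in> tempered_distr"
proof -
  have "continuous_map (seminorm_topology schwartz schwartz_seminorms) euclidean u"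
  proof (rule continuous_map_SUP_seminormsI[where q="\<lambda>x. (1 + (norm x)\<^sup>2) ^ P" and N=N and C=C])
    show "bdd_above (range (\<lambda>x. (1 + (norm x)\<^sup>2) ^ P * cmod (partials is f x)))"
      if "f \<in> schwartz" for f :: "real^'a \<Rightarrow> complex" and "is"
      using that by (auto simp: schwartz_def)
    show "(\<lambda>f. SUP x. (1 + (norm x)\<^sup>2) ^ P * cmod (partials is f x)) \<in> schwartz_seminorms" for "is" :: "'a list"
      by (auto simp: schwartz_seminorms_def)
    show "cmod (u f) \<le> C * M"
      if "f \<in> schwartz" "\<And>x. (1 + (norm x)\<^sup>2) ^ P * jet N f x \<le> M" for f M
      using that by (rule assms(4))
    show "seminorm_on schwartz p" if "p \<in> schwartz_seminorms" for p :: "(real^'a \<Rightarrow> complex) \<Rightarrow> real"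
      using that by (rule schwartz_seminorms_seminorm)
  qed (rule linear_space_schwartz assms(1) assms(3))+
  then show ?thesis using assms(1,2) by (auto simp: tempered_distr_def dual_space_def)
qed

lemma B_dot_dual_linear: "v \<in> B_dot_dual \<Longrightarrow> linear_form_on B_dot v"
  by (simp add: B_dot_dual_def dual_space_def)

lemma B_dot_dual_bound:
  assumes v: "v \<in> B_dot_dual"
  shows "\<exists>N C. C \<ge> 0 \<and> (\<forall>f\<in>B_dot. \<forall>M. (\<forall>x. jet N f x \<le> M) \<longrightarrow> cmod (v f) \<le> C * M)"
proof -
  obtain F C where F: "finite F" "F \<subseteq> B_seminorms" and C: "C \<ge> 0" "\<And>g. g \<in> B_dot \<Longrightarrow> cmod (v g) \<le> C * (\<Sum>p\<in>F. p g)"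
    using continuous_linear_form_bound[OF linear_space_B_dot B_seminorms_seminorm(2), of B_seminorms v] v
    unfolding B_dot_dual_def dual_space_def by auto
  obtain I where I: "finite I" "F = (\<lambda>is f. SUP x. cmod (partials is f x)) ` I"
    using finite_subset_image[OF F(1) F(2)[unfolded B_seminorms_def]] by blast
  define N where "N = Max (insert 0 (length ` I))"
  have len: "length is \<le> N" if "is \<in> I" for "is"
    unfolding N_def using I(1) that by (intro Max_ge) auto
  have "cmod (v f) \<le> (C * real (card F)) * M" if f: "f \<in> B_dot" and M: "\<forall>x. jet N f x \<le> M" for f M
  proof -
    have "p f \<le> M" if "p \<in> F" for p
    proof -
      obtain "is" where "is": "is \<in> I" "p = (\<lambda>f. SUP x. cmod (partials is f x))" using \<open>p \<in> F\<close> I by auto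
      show ?thesis
        unfolding "is"(2)
      proof (rule cSUP_least)
        show "cmod (partials is f x) \<le> M" for x
          using partials_le_jet[OF len[OF "is"(1)], of f x] M by (meson order_trans)
      qed simp
    qed
    then have "(\<Sum>p\<in>F. p f) \<le> real (card F) * M" by (rule sum_bounded_above)
    from order_trans[OF C(2)[OF f] mult_left_mono[OF this C(1)]] show ?thesis by (simp add: mult.assoc)
  qed
  then show ?thesis using C(1) by (intro exI[of _ N] exI[of _ "C * real (card F)"]) auto
qed

section \<open>A bump function\<close>

text \<open>The functions \<open>t\<^sup>-\<^sup>m exp (- 1 / t)\<close>, extended by \<open>0\<close> to \<open>t \<le> 0\<close>: the span of this family is
  stable under differentiation.\<close>

definition flat :: "nat \<Rightarrow> real \<Rightarrow> real" where
  "flat m t = (if t > 0 then inverse t ^ m * exp (- inverse t) else 0)"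

lemma flat_tendsto_0: "(flat m \<longlongrightarrow> 0) (at_right 0)"
proof -
  have "((\<lambda>z::real. z ^ m / exp z) \<longlongrightarrow> 0) at_top" by (rule tendsto_power_div_exp_0)
  then have "((\<lambda>t::real. inverse t ^ m / exp (inverse t)) \<longlongrightarrow> 0) (at_right 0)"
    by (rule filterlim_compose[OF _ filterlim_inverse_at_top_right])
  moreover have "eventually (\<lambda>t. inverse t ^ m / exp (inverse t) = flat m t) (at_right 0)"
    using eventually_at_right_less[of "0::real"] by eventually_elim (simp add: flat_def exp_minus field_simps)
  ultimately show ?thesis by (rule Lim_transform_eventually)
qed

lemma flat_derivative: "(flat m has_real_derivative (flat (m + 2) t - real m * flat (m + 1) t)) (at t)"
proof (cases t "0 :: real" rule: linorder_cases)
  case greater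
  have *: "((\<lambda>t. inverse t ^ m * exp (- inverse t)) has_real_derivative
      (inverse t ^ (m + 2) * exp (- inverse t) - real m * (inverse t ^ (m + 1) * exp (- inverse t)))) (at t)"
  proof -
    have "((\<lambda>t. inverse t ^ m) has_real_derivative - (real m * inverse t ^ (m + 1))) (at t)"
      using DERIV_power[OF DERIV_inverse[of t UNIV], of m] greater
      by (cases m) (simp_all add: mult_ac)
    moreover have "((\<lambda>t. exp (- inverse t)) has_real_derivative exp (- inverse t) * inverse t ^ 2) (at t)"
      using greater by (auto intro!: derivative_eq_intros simp: power2_eq_square)
    ultimately show ?thesis
      by (rule DERIV_cong[OF DERIV_mult]) (simp add: algebra_simps power2_eq_square)
  qed
  have "eventually (\<lambda>t. flat m t = inverse t ^ m * exp (- inverse t)) (nhds t)"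
    using eventually_nhds_in_open[of "{0<..}" t] greater
    by (auto elim!: eventually_mono simp: flat_def)
  note eq = DERIV_cong_ev[OF refl this refl]
  have "flat (m + 2) t - real m * flat (m + 1) t =
      inverse t ^ (m + 2) * exp (- inverse t) - real m * (inverse t ^ (m + 1) * exp (- inverse t))"
    using greater by (simp add: flat_def)
  then show ?thesis using iffD2[OF eq *] by (simp only:)
next
  case less
  have "eventually (\<lambda>t. flat m t = 0) (nhds t)"
    using eventually_nhds_in_open[of "{..<0}" t] less
    by (auto elim!: eventually_mono simp: flat_def)
  note eq = DERIV_cong_ev[OF refl this refl]
  have "flat (m + 2) t - real m * flat (m + 1) t = 0" using less by (simp add: flat_def)
  then show ?thesis using iffD2[OF eq DERIV_const] by (simp only:)
next
  case equal
  have "((\<lambda>h. (flat m (0 + h) - flat m 0) / h) \<longlongrightarrow> 0) (at 0)"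
    unfolding filterlim_at_split
  proof
    have "eventually (\<lambda>h. 0 = (flat m (0 + h) - flat m 0) / h) (at_left 0)"
      by (auto simp: eventually_at_left_field flat_def intro: exI[of _ "-1"])
    then show "((\<lambda>h. (flat m (0 + h) - flat m 0) / h) \<longlongrightarrow> 0) (at_left 0)"
      by (rule Lim_transform_eventually[OF tendsto_const])
    have "eventually (\<lambda>h. flat (Suc m) h = (flat m (0 + h) - flat m 0) / h) (at_right 0)"
      using eventually_at_right_less[of "0::real"]
      by eventually_elim (simp add: flat_def divide_inverse mult_ac)
    then show "((\<lambda>h. (flat m (0 + h) - flat m 0) / h) \<longlongrightarrow> 0) (at_right 0)"
      by (rule Lim_transform_eventually[OF flat_tendsto_0])
  qed
  then show ?thesis unfolding DERIV_def equal by (simp add: flat_def)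
qed

definition radial_flat :: "nat \<Rightarrow> real^'n::finite \<Rightarrow> complex" where
  "radial_flat m x = of_real (flat m (1 - x \<bullet> x))"

lemma radial_flat_derivative:
  "(radial_flat m has_derivative
     (\<lambda>v. of_real ((flat (m + 2) (1 - x \<bullet> x) - real m * flat (m + 1) (1 - x \<bullet> x)) * (- 2 * (x \<bullet> v))))) (at x)"
proof -
  have "((\<lambda>x. 1 - x \<bullet> x) has_derivative (\<lambda>v. - 2 * (x \<bullet> v))) (at x)"
    by (auto intro!: derivative_eq_intros simp: inner_commute)
  from has_derivative_compose[OF this flat_derivative[unfolded has_field_derivative_def]]
  show ?thesis
    unfolding radial_flat_def[abs_def] by (rule has_derivative_of_real)
qed

lemma coordinate_derivative:
  "((\<lambda>x :: real^'n::finite. complex_of_real (x $ i)) has_derivative (\<lambda>v. of_real (v $ i))) (at x)"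
  by (intro has_derivative_of_real bounded_linear_imp_has_derivative bounded_linear_vec_nth)

lemma radial_flat_smooth: "(radial_flat m :: real^'n::finite \<Rightarrow> complex) \<in> smooth_functions"
proof -
  define X where "X = range radial_flat \<union> range (\<lambda>i (x :: real^'n). complex_of_real (x $ i))"
  have G: "radial_flat m \<in> alg X" "(\<lambda>x. complex_of_real (x $ i)) \<in> alg X" for m i
    by (auto intro!: alg.alg_gen simp: X_def)
  have "alg X \<subseteq> smooth_functions"
  proof (rule alg_smooth)
    show "f differentiable at x" if "f \<in> X" for f x
      using that differentiableI[OF radial_flat_derivative] differentiableI[OF coordinate_derivative]
      by (auto simp: X_def)
    show "partial i f \<in> alg X" if f: "f \<in> X" for f i
    proof -
      consider m where "f = radial_flat m" | j where "f = (\<lambda>x. complex_of_real (x $ j))"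
        using f by (auto simp: X_def)
      then show ?thesis
      proof cases
        case (1 m)
        have "partial i f = (\<lambda>x. (radial_flat (m + 2) x + (- of_nat m) * radial_flat (m + 1) x) *
            ((-2) * complex_of_real (x $ i)))"
          unfolding 1 partial_eq_derivative[OF radial_flat_derivative, abs_def]
          by (simp add: radial_flat_def fun_eq_iff inner_axis algebra_simps)
        then show ?thesis by (simp only:) (intro alg.alg_mult alg.alg_add G alg.alg_const)
      next
        case (2 j)
        have "partial i f = (\<lambda>x. of_real (axis i 1 $ j))"
          unfolding 2 partial_eq_derivative[OF coordinate_derivative, abs_def] ..
        then show ?thesis by (simp only:) (rule alg.alg_const)
      qed
    qed
  qed
  then show ?thesis using G by blast
qed

definition bump :: "real^'n::finite \<Rightarrow> complex" where
  "bump x = of_real (exp 1) * radial_flat 0 x"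

lemma bump_smooth: "bump \<in> smooth_functions"
  unfolding bump_def[abs_def] by (rule smooth_functions_linear(2)[OF radial_flat_smooth radial_flat_smooth])

lemma bump_0: "bump 0 = 1"
  by (simp add: bump_def radial_flat_def flat_def exp_minus flip: of_real_mult)

lemma bump_eq_0: "norm x \<ge> 1 \<Longrightarrow> bump x = 0"
proof -
  assume "norm x \<ge> 1"
  then have "x \<bullet> x \<ge> 1" by (simp flip: power2_norm_eq_inner)
  then show ?thesis by (simp add: bump_def radial_flat_def flat_def)
qed

lemma bump_nonneg: "\<exists>r\<ge>0. bump x = of_real r"
  by (rule exI[of _ "exp 1 * flat 0 (1 - x \<bullet> x)"]) (simp add: bump_def radial_flat_def flat_def)

text \<open>A derivative at a point only depends on the function near the point.\<close>

lemma partials_eq_0_local: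
  assumes f: "f \<in> smooth_functions" and U: "open U" "\<And>x. x \<in> U \<Longrightarrow> f x = 0"
  shows "x \<in> U \<Longrightarrow> partials is f x = 0"
proof (induction "is" arbitrary: x)
  case (Cons i js)
  have "((\<lambda>_. 0 :: complex) has_derivative (\<lambda>_. 0)) (at x)" by simp
  then have "(partials js f has_derivative (\<lambda>_. 0)) (at x)"
    by (rule has_derivative_transform_within_open[OF _ U(1) Cons.prems]) (simp add: Cons.IH)
  then show ?case by (simp add: partial_eq_derivative)
qed (use U in auto)

lemma compact_support_schwartz:
  assumes f: "f \<in> smooth_functions" and R: "\<And>x. norm x > R \<Longrightarrow> f x = 0"
  shows "f \<in> schwartz"
proof -
  have "\<exists>C. \<forall>x. (1 + (norm x)\<^sup>2) ^ P * jet N f x \<le> C" for N P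
  proof -
    have "bounded ((\<lambda>x. (1 + (norm x)\<^sup>2) ^ P * jet N f x) ` cball 0 R)"
      by (intro compact_imp_bounded compact_continuous_image continuous_intros jet_continuous f compact_cball)
    then obtain C where "\<forall>x\<in>cball 0 R. \<bar>(1 + (norm x)\<^sup>2) ^ P * jet N f x\<bar> \<le> C"
      by (auto simp: bounded_iff)
    then have C: "\<And>x. norm x \<le> R \<Longrightarrow> \<bar>(1 + (norm x)\<^sup>2) ^ P * jet N f x\<bar> \<le> C"
      by simp
    have "(1 + (norm x)\<^sup>2) ^ P * jet N f x \<le> max C 0" for x
    proof (cases "norm x \<le> R")
      case True
      from C[OF this] show ?thesis by linarith
    next
      case False
      have "open {x. norm x > R}" by (intro open_Collect_less continuous_intros)
      from partials_eq_0_local[OF f this] R False have "jet N f x = 0" by (simp add: jet_def)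
      then show ?thesis by simp
    qed
    then show ?thesis by blast
  qed
  then show ?thesis using f by (simp add: schwartz_iff)
qed

lemma bump_schwartz: "bump \<in> schwartz"
  by (rule compact_support_schwartz[OF bump_smooth, of 1]) (simp add: bump_eq_0)

text \<open>These are the functions \<open>\<chi>\<^sub>k\<close>. Dilating a fixed bump keeps all derivatives bounded and makes
  those of positive order tend to \<open>0\<close>.\<close>

definition cutoff :: "nat \<Rightarrow> real^'n::finite \<Rightarrow> complex" where
  "cutoff k x = bump (inverse (real (Suc k)) *\<^sub>R x)"

lemma cutoff_smooth: "cutoff k \<in> smooth_functions"
  unfolding cutoff_def[abs_def] by (rule smooth_scale[OF bump_smooth])

lemma cutoff_schwartz: "cutoff k \<in> schwartz"
proof (rule compact_support_schwartz[OF cutoff_smooth, of "real (Suc k)"])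
  fix x :: "real^'a" assume "norm x > real (Suc k)"
  then show "cutoff k x = 0"
    unfolding cutoff_def by (intro bump_eq_0) (simp add: field_simps)
qed

lemma cmod_partials_cutoff:
  "cmod (partials is (cutoff k) x) =
     inverse (real (Suc k)) ^ length is * cmod (partials is bump (inverse (real (Suc k)) *\<^sub>R x))"
  unfolding cutoff_def[abs_def] partials_scale[OF bump_smooth] norm_mult norm_of_real
  by (subst abs_of_nonneg) auto

lemma cutoff_bounded: "\<exists>C\<ge>0. \<forall>k (x :: real^'n::finite). jet N (cutoff k) x \<le> C"
proof -
  obtain C where C: "C \<ge> 0" "\<And>x :: real^'n. jet N bump x \<le> C"
    using B_space_jet[of bump N] bump_schwartz schwartz_subset_B_dot B_dot_subset_B_space by blast
  have "jet N (cutoff k) x \<le> real (card {is :: 'n list. length is \<le> N}) * C" for k and x :: "real^'n"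
  proof (rule jet_le_card)
    fix "is" :: "'n list" assume len: "length is \<le> N"
    have "cmod (partials is (cutoff k) x) = inverse (real (Suc k)) ^ length is * cmod (partials is bump (inverse (real (Suc k)) *\<^sub>R x))"
      by (rule cmod_partials_cutoff)
    also have "\<dots> \<le> 1 * C"
      by (intro mult_mono power_le_one order_trans[OF partials_le_jet[OF len] C(2)]) (auto simp: inverse_le_1_iff)
    finally show "cmod (partials is (cutoff k) x) \<le> C" by simp
  qed
  then show ?thesis using C(1) by (intro exI[of _ "real (card {is :: 'n list. length is \<le> N}) * C"]) auto
qed

lemma cutoff_tendsto_1:
  assumes "d > 0"
  shows "eventually (\<lambda>k. \<forall>x :: real^'n::finite. norm x \<le> R \<longrightarrow> jet N (\<lambda>x. cutoff k x - 1) x \<le> d) sequentially"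
proof -
  let ?K = "real (card {is :: 'n list. length is \<le> N})"
  define M where "M = max N 1"
  obtain C where C: "C \<ge> 0" "\<And>x :: real^'n. jet M bump x \<le> C"
    using B_space_jet[of bump M] bump_schwartz schwartz_subset_B_dot B_dot_subset_B_space by blast
  define D where "D = C * (1 + real CARD('n) * \<bar>R\<bar>)"
  have D: "C \<le> D" "real CARD('n) * C * \<bar>R\<bar> \<le> D" "D \<ge> 0" using C(1) by (auto simp: D_def algebra_simps)
  have *: "jet N (\<lambda>x. cutoff k x - 1) x \<le> ?K * (inverse (real (Suc k)) * D)" if x: "norm x \<le> R" for k and x :: "real^'n"
  proof (rule jet_le_card)
    fix "is" :: "'n list" assume len: "length is \<le> N"
    let ?s = "inverse (real (Suc k))"
    show "cmod (partials is (\<lambda>x. cutoff k x - 1) x) \<le> ?s * D"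
    proof (cases "is")
      case Nil
      have "cmod (bump (0 + ?s *\<^sub>R x) - bump (0 :: real^'n)) \<le> real CARD('n) * C * norm (?s *\<^sub>R x)"
      proof -
        have "cmod (partial i bump (0 + t *\<^sub>R ?s *\<^sub>R x)) \<le> C" for t :: real and i :: 'n
        proof -
          have "cmod (partials [i] bump (0 + t *\<^sub>R ?s *\<^sub>R x)) \<le> C"
            by (intro order_trans[OF partials_le_jet C(2)]) (simp add: M_def)
          then show ?thesis by simp
        qed
        then show ?thesis
          using smooth_mean_value[OF bump_smooth, of 0 "?s *\<^sub>R x" C] by blast
      qed
      also have "\<dots> = ?s * (real CARD('n) * C * norm x)" by simp
      also have "\<dots> \<le> ?s * (real CARD('n) * C * \<bar>R\<bar>)"
        using x C(1) by (intro mult_left_mono) auto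
      also have "\<dots> \<le> ?s * D" using D by (intro mult_left_mono) auto
      finally show ?thesis using Nil by (simp add: cutoff_def bump_0)
    next
      case (Cons i js)
      have "partials is (\<lambda>x. cutoff k x - 1) x = partials is (cutoff k) x"
        using Cons by (simp add: partials_diff[OF cutoff_smooth smooth_const] partials_const del: partials.simps)
      then have "cmod (partials is (\<lambda>x. cutoff k x - 1) x) = ?s ^ length is * cmod (partials is bump (?s *\<^sub>R x))"
        by (simp only: cmod_partials_cutoff)
      also have "\<dots> \<le> ?s * C"
      proof (rule mult_mono)
        show "?s ^ length is \<le> ?s"
          using Cons power_decreasing[of 1 "length is" ?s] by (simp add: inverse_le_1_iff)
        show "cmod (partials is bump (?s *\<^sub>R x)) \<le> C"
          using len by (intro order_trans[OF partials_le_jet C(2)]) (simp add: M_def)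
      qed auto
      also have "\<dots> \<le> ?s * D" using D by (intro mult_left_mono) auto
      finally show ?thesis .
    qed
  qed
  have "(\<lambda>k. ?K * (inverse (real (Suc k)) * D)) \<longlonglongrightarrow> ?K * (0 * D)"
    by (intro tendsto_intros LIMSEQ_inverse_real_of_nat)
  then have "eventually (\<lambda>k. ?K * (inverse (real (Suc k)) * D) < d) sequentially"
    using assms by (intro order_tendstoD(2)) auto
  then show ?thesis
  proof eventually_elim
    case (elim k)
    show ?case
    proof (intro allI impI)
      fix x :: "real^'n" assume "norm x \<le> R"
      from *[OF this, of k] elim show "jet N (\<lambda>x. cutoff k x - 1) x \<le> d" by linarith
    qed
  qed
qed

lemma cutoff_mult_schwartz: "f \<in> B_space \<Longrightarrow> (\<lambda>x. cutoff k x * f x) \<in> schwartz"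
  using schwartz_mult_B_space[OF _ cutoff_schwartz, of f k] by (simp add: mult.commute)

text \<open>Both bounds are uniform in \<open>k\<close> and pointwise, so that multiplication with \<open>\<chi>\<^sub>k\<close> preserves
  bounded sets and, as \<open>\<chi>\<^sub>k - 1\<close> is locally small, changes a function only a little on balls.\<close>

lemma cutoff_mult_jets:
  "\<exists>C\<ge>0. \<forall>f\<in>smooth_functions. \<forall>k (x :: real^'n::finite).
     jet N (\<lambda>x. cutoff k x * f x) x \<le> C * jet N f x \<and>
     jet N (\<lambda>x. cutoff k x * f x - f x) x \<le> C * (jet N (\<lambda>x. cutoff k x - 1) x * jet N f x)"
proof -
  obtain C where C: "C \<ge> 0" "\<And>f g (x :: real^'n). f \<in> smooth_functions \<Longrightarrow> g \<in> smooth_functions \<Longrightarrow>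
      jet N (\<lambda>x. f x * g x) x \<le> C * (jet N f x * jet N g x)"
    using jet_mult[of N] by metis
  obtain D where D: "D \<ge> 0" "\<And>k (x :: real^'n). jet N (cutoff k) x \<le> D"
    using cutoff_bounded by metis
  have "jet N (\<lambda>x. cutoff k x * f x) x \<le> max C (C * D) * jet N f x \<and>
     jet N (\<lambda>x. cutoff k x * f x - f x) x \<le> max C (C * D) * (jet N (\<lambda>x. cutoff k x - 1) x * jet N f x)"
    if f: "f \<in> smooth_functions" for f k and x :: "real^'n"
  proof
    have "jet N (\<lambda>x. cutoff k x * f x) x \<le> C * (jet N (cutoff k) x * jet N f x)"
      by (rule C(2)[OF cutoff_smooth f])
    also have "\<dots> \<le> C * (D * jet N f x)" by (intro mult_left_mono mult_right_mono D C jet_nonneg)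
    also have "\<dots> \<le> max C (C * D) * jet N f x"
      unfolding mult.assoc[symmetric] by (intro mult_right_mono jet_nonneg) simp
    finally show "jet N (\<lambda>x. cutoff k x * f x) x \<le> max C (C * D) * jet N f x" .
    have "jet N (\<lambda>x. (cutoff k x - 1) * f x) x \<le> C * (jet N (\<lambda>x. cutoff k x - 1) x * jet N f x)"
      by (rule C(2)[OF smooth_functions_diff[OF cutoff_smooth smooth_const] f])
    also have "\<dots> \<le> max C (C * D) * (jet N (\<lambda>x. cutoff k x - 1) x * jet N f x)"
      by (intro mult_right_mono mult_nonneg_nonneg jet_nonneg) simp
    finally show "jet N (\<lambda>x. cutoff k x * f x - f x) x \<le> max C (C * D) * (jet N (\<lambda>x. cutoff k x - 1) x * jet N f x)"
      by (simp add: left_diff_distrib)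
  qed
  then show ?thesis using C(1) by (intro exI[of _ "max C (C * D)"]) auto
qed

lemma cutoff_mult_tendsto:
  fixes f :: "real^'n::finite \<Rightarrow> complex"
  assumes f: "f \<in> B_space" and d: "d > 0"
  shows "eventually (\<lambda>k. \<forall>x. norm x \<le> R \<longrightarrow> jet N (\<lambda>x. cutoff k x * f x - f x) x \<le> d) sequentially"
proof -
  obtain C where C: "C \<ge> 0" "\<And>k (x :: real^'n). jet N (\<lambda>x. cutoff k x * f x - f x) x \<le> C * (jet N (\<lambda>x. cutoff k x - 1) x * jet N f x)"
    using cutoff_mult_jets[of N] B_space_smooth[OF f] by metis
  obtain A where A: "A \<ge> 0" "\<And>x. jet N f x \<le> A" using B_space_jet[OF f] by metis
  have e: "d / (C * A + 1) > 0" using d C A by (auto intro!: divide_pos_pos add_nonneg_pos)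
  from cutoff_tendsto_1[OF e, where 'n='n, of R N] show ?thesis
  proof eventually_elim
    case (elim k)
    show ?case
    proof (intro allI impI)
      fix x :: "real^'n" assume x: "norm x \<le> R"
      have "C * (jet N (\<lambda>x. cutoff k x - 1) x * jet N f x) \<le> C * (d / (C * A + 1) * A)"
        using elim x e by (intro mult_left_mono mult_mono C A jet_nonneg) auto
      also have "\<dots> \<le> d"
        using d mult_nonneg_nonneg[OF C(1) A(1)] by (simp add: field_simps add_nonneg_pos)
      finally show "jet N (\<lambda>x. cutoff k x * f x - f x) x \<le> d" using C(2)[of k x] by simp
    qed
  qed
qed

section \<open>Tightness of integrable distributions\<close>

text \<open>A set on which one jet is bounded plays the role of a bounded set, and smallness of the
  same jet on a ball that of a neighbourhood of \<open>0\<close> in \<open>C\<^sup>\<infinity>\<close>. Thus this is continuity at \<open>0\<close> on bounded sets for the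
  topology of \<open>C\<^sup>\<infinity>\<close>, with a single order \<open>N\<close> of derivatives.\<close>

definition tight_on :: "(real^'n::finite \<Rightarrow> complex) set \<Rightarrow> nat \<Rightarrow> 'n distr \<Rightarrow> bool" where
  "tight_on V N u \<longleftrightarrow> linear_form_on V u \<and>
     (\<forall>M e. e > 0 \<longrightarrow> (\<exists>R d. d > 0 \<and> (\<forall>f\<in>V.
        (\<forall>x. jet N f x \<le> M) \<and> (\<forall>x. norm x \<le> R \<longrightarrow> jet N f x \<le> d) \<longrightarrow> cmod (u f) \<le> e)))"

lemma tight_onD:
  assumes "tight_on V N u" "e > 0"
  obtains R d where "d > 0" "\<And>f. f \<in> V \<Longrightarrow> (\<And>x. jet N f x \<le> M) \<Longrightarrow>
    (\<And>x. norm x \<le> R \<Longrightarrow> jet N f x \<le> d) \<Longrightarrow> cmod (u f) \<le> e"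
  using assms unfolding tight_on_def by metis

text \<open>A gliding hump argument. If the claim fails for some \<open>M\<close> and \<open>e\<close>, there are functions with jets at
  most \<open>M\<close> that are as small as desired on any ball while \<open>v\<close> exceeds \<open>e\<close> at them. Given a sum \<open>f\<close>
  of \<open>k\<close> of them, \<open>f\<close> is small outside some ball because it belongs to \<open>B_dot\<close>, and the next function
  can be taken to be small inside that ball. Hence the sums stay bounded by nearly \<open>M\<close>, while their values under \<open>v\<close> grow
  like \<open>k e\<close>, which contradicts the continuity of \<open>v\<close>.\<close>

lemma B_dot_dual_tight:
  fixes v :: "'n::finite distr"
  assumes v: "v \<in> B_dot_dual"
  shows "\<exists>N. tight_on B_dot N v"
proof -
  note lin = B_dot_dual_linear[OF v]
  obtain N C where C: "C \<ge> 0" "\<And>f M. f \<in> B_dot \<Longrightarrow> (\<And>x. jet N f x \<le> M) \<Longrightarrow> cmod (v f) \<le> C * M"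
    using B_dot_dual_bound[OF v] by metis
  have "\<exists>R d. d > 0 \<and> (\<forall>f\<in>B_dot. (\<forall>x. jet N f x \<le> M) \<and> (\<forall>x. norm x \<le> R \<longrightarrow> jet N f x \<le> d) \<longrightarrow>
      cmod (v f) \<le> e)" if e: "e > 0" for M e
  proof (rule ccontr)
    assume neg: "\<not> (\<exists>R d. d > 0 \<and> (\<forall>f\<in>B_dot. (\<forall>x. jet N f x \<le> M) \<and>
        (\<forall>x. norm x \<le> R \<longrightarrow> jet N f x \<le> d) \<longrightarrow> cmod (v f) \<le> e))"
    have ex: "\<exists>f\<in>B_dot. (\<forall>x. jet N f x \<le> M) \<and> (\<forall>x. norm x \<le> R \<longrightarrow> jet N f x \<le> d) \<and> cmod (v f) > e"
      if "d > 0" for R d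
      using neg that by (meson not_le)
    have M: "M \<ge> 0" using ex[of 1 0] jet_nonneg order_trans by (metis zero_less_one)
    have zero: "(\<lambda>_. 0) \<in> (B_dot :: (real^'n \<Rightarrow> complex) set)" "v (\<lambda>_. 0) = 0"
      using ex[of 1 0] linear_space_zero[OF linear_space_B_dot] linear_form_on_zero[OF lin] by auto
    \<comment> \<open>any bound \<open>B > M\<close> is allowed, so half of the excess can be spent on each new summand\<close>
    have claim: "\<exists>f\<in>B_dot. (\<forall>x. jet N f x \<le> B) \<and> real k * e \<le> Re (v f)" if "B > M" for B k
      using that
    proof (induction k arbitrary: B)
      case 0
      then show ?case using M zero by (intro bexI[of _ "\<lambda>_. 0"]) (auto simp: jet_const)
    next
      case (Suc k)
      obtain f where f: "f \<in> B_dot" "\<And>x. jet N f x \<le> (B + M) / 2" "real k * e \<le> Re (v f)"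
        using Suc.IH[of "(B + M) / 2"] Suc.prems by auto
      have "eventually (\<lambda>x. jet N f x < B - M) at_infinity"
        using f(1) Suc.prems by (intro order_tendstoD(2)[of _ 0]) (auto simp: B_dot_iff)
      then obtain R where R: "\<And>x. R \<le> norm x \<Longrightarrow> jet N f x < B - M"
        by (auto simp: eventually_at_infinity)
      obtain g where g: "g \<in> B_dot" "\<And>x. jet N g x \<le> M"
          "\<And>x. norm x \<le> R \<Longrightarrow> jet N g x \<le> B - (B + M) / 2" "cmod (v g) > e"
        using ex[of "B - (B + M) / 2" R] Suc.prems by (auto simp: field_simps)
      \<comment> \<open>rotate \<open>g\<close> so that \<open>v g\<close> is positive\<close>
      define c where "c = cnj (sgn (v g))"
      have "v g \<noteq> 0" using g(4) e by auto
      then have c: "cmod c = 1" by (simp add: c_def norm_sgn)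
      have vg: "c * v g = of_real (cmod (v g))"
      proof -
        have "c * v g = v g * cnj (v g) / of_real (cmod (v g))" by (simp add: c_def sgn_eq)
        also have "\<dots> = of_real (cmod (v g))"
          using \<open>v g \<noteq> 0\<close> by (simp add: complex_norm_square[symmetric] power2_eq_square)
        finally show ?thesis .
      qed
      have cg: "(\<lambda>x. c * g x) \<in> B_dot" by (rule linear_space_scale[OF linear_space_B_dot g(1)])
      have sm: "f \<in> smooth_functions" "(\<lambda>x. c * g x) \<in> smooth_functions" "g \<in> smooth_functions"
        using f(1) g(1) cg B_dot_subset_B_space B_space_smooth by blast+
      have "jet N (\<lambda>x. f x + c * g x) x \<le> B" for x
      proof -
        have "jet N (\<lambda>x. f x + c * g x) x \<le> jet N f x + jet N g x"
          using jet_add[OF sm(1,2), of N x] c jet_scale[OF sm(3), of N c x] by simp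
        also have "\<dots> \<le> B"
        proof (cases "norm x \<le> R")
          case True
          then show ?thesis using f(2)[of x] g(3)[of x] by linarith
        next
          case False
          then show ?thesis using R[of x] g(2)[of x] by simp
        qed
        finally show ?thesis .
      qed
      moreover have "v (\<lambda>x. f x + c * g x) = v f + of_real (cmod (v g))"
        using linear_form_onD(1)[OF lin f(1) cg] linear_form_onD(2)[OF lin g(1), of c] vg by simp
      then have "real (Suc k) * e \<le> Re (v (\<lambda>x. f x + c * g x))"
        using f(3) g(4) by (simp add: algebra_simps)
      ultimately show ?case
        using linear_space_add[OF linear_space_B_dot f(1) cg] by blast
    qed
    obtain k where k: "C * (M + 1) < real k * e"
      using reals_Archimedean3[OF e] by blast
    obtain f where f: "f \<in> B_dot" "\<And>x. jet N f x \<le> M + 1" "real k * e \<le> Re (v f)"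
      using claim[of "M + 1" k] by auto
    show False
      using C(2)[OF f(1,2)] f(3) k complex_Re_le_cmod[of "v f"] by linarith
  qed
  then show ?thesis using lin unfolding tight_on_def by blast
qed

text \<open>A function whose jet is at most \<open>min 1 d\<close> everywhere satisfies both conditions of tightness;
  the general bound follows by scaling.\<close>

lemma tight_on_bounded:
  assumes u: "tight_on V N u" and V: "linear_space V" "V \<subseteq> smooth_functions"
  shows "\<exists>C\<ge>0. \<forall>f\<in>V. \<forall>M. (\<forall>x. jet N f x \<le> M) \<longrightarrow> cmod (u f) \<le> C * M"
proof -
  have lin: "linear_form_on V u" using u by (simp add: tight_on_def)
  obtain R d where d: "d > 0" "\<And>f. f \<in> V \<Longrightarrow> (\<And>x. jet N f x \<le> 1) \<Longrightarrow>
      (\<And>x. norm x \<le> R \<Longrightarrow> jet N f x \<le> d) \<Longrightarrow> cmod (u f) \<le> 1"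
    using tight_onD[OF u, of 1 1] by (metis zero_less_one)
  define c where "c = min 1 d"
  have c: "0 < c" "c \<le> 1" "c \<le> d" using d(1) by (auto simp: c_def)
  have "cmod (u f) \<le> (1 / c) * M" if f: "f \<in> V" and M: "\<forall>x. jet N f x \<le> M" for f M
  proof -
    \<comment> \<open>a bound \<open>r > M\<close> is positive, so division by it is possible even if \<open>M = 0\<close>\<close>
    have "c * cmod (u f) \<le> r" if r: "M < r" for r
    proof -
      have "r > 0" using r M jet_nonneg[of N f 0] by (smt (verit))
      define s where "s = complex_of_real (c / r)"
      have s: "cmod s = c / r" using c \<open>r > 0\<close> by (simp add: s_def norm_divide)
      have "jet N (\<lambda>x. s * f x) x \<le> c" for x
      proof -
        have "jet N f x \<le> r" using M r by (meson less_imp_le order_trans)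
        then have "c / r * jet N f x \<le> c / r * r" using c \<open>r > 0\<close> by (intro mult_left_mono) auto
        then show ?thesis using f V(2) \<open>r > 0\<close> s by (simp add: jet_scale subset_iff)
      qed
      then have "cmod (u (\<lambda>x. s * f x)) \<le> 1"
        using c by (intro d(2) linear_space_scale[OF V(1) f]) (auto intro: order_trans)
      then have "c / r * cmod (u f) \<le> 1"
        by (simp add: linear_form_onD(2)[OF lin f] norm_mult s)
      then show ?thesis using \<open>r > 0\<close> by (simp add: field_simps)
    qed
    then have "c * cmod (u f) \<le> M" by (rule dense_ge)
    then show ?thesis using c by (simp add: field_simps)
  qed
  then show ?thesis using c by (intro exI[of _ "1 / c"]) auto
qed

text \<open>Tightness, applied to the differences \<open>f i - g\<close>; this is the form in which limits along
  cutoffs are taken.\<close>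

lemma tight_on_tendsto:
  assumes u: "tight_on V N u" and V: "linear_space V" and g: "g \<in> V"
    and f: "eventually (\<lambda>i. f i \<in> V \<and> (\<forall>x. jet N (\<lambda>x. f i x - g x) x \<le> M)) F"
    and loc: "\<And>R d. d > 0 \<Longrightarrow> eventually (\<lambda>i. \<forall>x. norm x \<le> R \<longrightarrow> jet N (\<lambda>x. f i x - g x) x \<le> d) F"
  shows "((\<lambda>i. u (f i)) \<longlongrightarrow> u g) F"
proof (rule tendstoI)
  fix e :: real assume e: "e > 0"
  have lin: "linear_form_on V u" using u by (simp add: tight_on_def)
  obtain R d where d: "d > 0" "\<And>f. f \<in> V \<Longrightarrow> (\<And>x. jet N f x \<le> M) \<Longrightarrow>
      (\<And>x. norm x \<le> R \<Longrightarrow> jet N f x \<le> d) \<Longrightarrow> cmod (u f) \<le> e / 2"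
    using tight_onD[OF u, of "e / 2" M] e by (metis half_gt_zero)
  show "eventually (\<lambda>i. dist (u (f i)) (u g) < e) F"
    using f loc[OF d(1), of R]
  proof eventually_elim
    case (elim i)
    then have "cmod (u (\<lambda>x. f i x - g x)) \<le> e / 2"
      by (intro d(2) linear_space_diff[OF V _ g]) auto
    then show ?case using elim e by (simp add: dist_norm linear_form_on_diff[OF lin V _ g])
  qed
qed

lemma cutoff_mult_tight_tendsto:
  fixes f :: "real^'n::finite \<Rightarrow> complex"
  assumes u: "tight_on V N u" and V: "linear_space V" "schwartz \<subseteq> V" and f: "f \<in> V" "f \<in> B_space"
  shows "(\<lambda>k. u (\<lambda>x. cutoff k x * f x)) \<longlonglongrightarrow> u f"
proof -
  obtain C where C: "C \<ge> 0" "\<And>k x. jet N (\<lambda>x. cutoff k x * f x) x \<le> C * jet N f x"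
    using cutoff_mult_jets[of N] B_space_smooth[OF f(2)] by metis
  obtain A where A: "A \<ge> 0" "\<And>x. jet N f x \<le> A" using B_space_jet[OF f(2)] by metis
  have "jet N (\<lambda>x. cutoff k x * f x - f x) x \<le> C * A + A" for k x
  proof -
    have sm: "(\<lambda>x. cutoff k x * f x) \<in> smooth_functions" "f \<in> smooth_functions"
      using f(2) by (auto intro: smooth_mult cutoff_smooth B_space_smooth)
    have "C * jet N f x \<le> C * A" by (intro mult_left_mono A C)
    then show ?thesis using jet_diff[OF sm, of N x] C(2)[of k x] A(2)[of x] by linarith
  qed
  moreover have "(\<lambda>x. cutoff k x * f x) \<in> V" for k
    using cutoff_mult_schwartz[OF f(2)] V(2) by auto
  ultimately show ?thesis
    by (intro tight_on_tendsto[OF u V(1) f(1), where M="C * A + A"] cutoff_mult_tendsto f(2)) auto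
qed

definition B_extension :: "'n::finite distr \<Rightarrow> 'n distr" where
  "B_extension v f = (if f \<in> B_space then lim (\<lambda>k. v (\<lambda>x. cutoff k x * f x)) else 0)"

text \<open>For large \<open>m\<close> and \<open>n\<close> the difference \<open>\<chi>\<^sub>m f - \<chi>\<^sub>n f\<close> is small on a given ball, and all
  these differences are bounded; so tightness gives a Cauchy sequence.\<close>

lemma B_extension_tendsto:
  fixes f :: "real^'n::finite \<Rightarrow> complex"
  assumes v: "tight_on B_dot N v" and f: "f \<in> B_space"
  shows "(\<lambda>k. v (\<lambda>x. cutoff k x * f x)) \<longlonglongrightarrow> B_extension v f"
proof -
  have lin: "linear_form_on B_dot v" using v by (simp add: tight_on_def)
  obtain C where C: "C \<ge> 0" "\<And>k x. jet N (\<lambda>x. cutoff k x * f x) x \<le> C * jet N f x"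
    using cutoff_mult_jets[of N] B_space_smooth[OF f] by metis
  obtain A where A: "A \<ge> 0" "\<And>x. jet N f x \<le> A" using B_space_jet[OF f] by metis
  have "Cauchy (\<lambda>k. v (\<lambda>x. cutoff k x * f x))"
  proof (rule metric_CauchyI)
    fix e :: real assume e: "e > 0"
    obtain R d where d: "d > 0" "\<And>f. f \<in> B_dot \<Longrightarrow> (\<And>x. jet N f x \<le> 2 * (C * A)) \<Longrightarrow>
      (\<And>x. norm x \<le> R \<Longrightarrow> jet N f x \<le> d) \<Longrightarrow> cmod (v f) \<le> e / 2"
      using tight_onD[OF v, of "e / 2" "2 * (C * A)"] e by (metis half_gt_zero)
    obtain K where K: "\<And>k x. k \<ge> K \<Longrightarrow> norm x \<le> R \<Longrightarrow> jet N (\<lambda>x. cutoff k x * f x - f x) x \<le> d / 2"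
      using cutoff_mult_tendsto[OF f half_gt_zero[OF d(1)], of R N] by (auto simp: eventually_sequentially)
    have "dist (v (\<lambda>x. cutoff m x * f x)) (v (\<lambda>x. cutoff n x * f x)) < e" if mn: "m \<ge> K" "n \<ge> K" for m n
    proof -
      have D: "(\<lambda>x. cutoff k x * f x) \<in> B_dot" for k
        using cutoff_mult_schwartz[OF f] schwartz_subset_B_dot by auto
      have sm: "(\<lambda>x. cutoff k x * f x) \<in> smooth_functions" "(\<lambda>x. cutoff k x * f x - f x) \<in> smooth_functions" for k
        using B_space_smooth[OF f] by (auto intro!: smooth_functions_diff smooth_mult cutoff_smooth)
      have bd: "jet N (\<lambda>x. cutoff k x * f x) x \<le> C * A" for k x
        by (rule order_trans[OF C(2)]) (intro mult_left_mono A C)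
      have "cmod (v (\<lambda>x. cutoff m x * f x - cutoff n x * f x)) \<le> e / 2"
      proof (rule d(2))
        show "(\<lambda>x. cutoff m x * f x - cutoff n x * f x) \<in> B_dot"
          by (intro linear_space_diff[OF linear_space_B_dot] D)
        show "jet N (\<lambda>x. cutoff m x * f x - cutoff n x * f x) x \<le> 2 * (C * A)" for x
          using jet_diff[OF sm(1)[of m] sm(1)[of n], of N x] bd[of m x] bd[of n x] by linarith
        fix x :: "real^'n" assume x: "norm x \<le> R"
        show "jet N (\<lambda>x. cutoff m x * f x - cutoff n x * f x) x \<le> d"
          using jet_diff[OF sm(2)[of m] sm(2)[of n], of N x] K[OF mn(1) x] K[OF mn(2) x] by simp
      qed
      then show ?thesis
        using e by (simp add: dist_norm linear_form_on_diff[OF lin linear_space_B_dot D D])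
    qed
    then show "\<exists>M. \<forall>m\<ge>M. \<forall>n\<ge>M. dist (v (\<lambda>x. cutoff m x * f x)) (v (\<lambda>x. cutoff n x * f x)) < e" by blast
  qed
  then show ?thesis
    using f by (simp add: B_extension_def Cauchy_convergent_iff convergent_LIMSEQ_iff)
qed

lemma B_extension_eq:
  assumes v: "tight_on B_dot N v" and f: "f \<in> B_dot"
  shows "B_extension v f = v f"
proof -
  have fB: "f \<in> B_space" using f B_dot_subset_B_space by auto
  show ?thesis
    by (rule LIMSEQ_unique[OF B_extension_tendsto[OF v fB]
          cutoff_mult_tight_tendsto[OF v linear_space_B_dot schwartz_subset_B_dot f fB]])
qed

lemma B_extension_tight:
  fixes v :: "'n::finite distr"
  assumes v: "tight_on B_dot N v"
  shows "tight_on B_space N (B_extension v)"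
  unfolding tight_on_def
proof (intro conjI allI impI)
  have lin: "linear_form_on B_dot v" using v by (simp add: tight_on_def)
  have D: "(\<lambda>x. cutoff k x * f x) \<in> B_dot" if "f \<in> B_space" for f :: "real^'n \<Rightarrow> complex" and k
    using cutoff_mult_schwartz[OF that] schwartz_subset_B_dot by auto
  show "linear_form_on B_space (B_extension v)"
    unfolding linear_form_on_def
  proof (intro conjI ballI allI)
    fix f g :: "real^'n \<Rightarrow> complex" assume fg: "f \<in> B_space" "g \<in> B_space"
    have "(\<lambda>k. v (\<lambda>x. cutoff k x * (f x + g x))) \<longlonglongrightarrow> B_extension v (\<lambda>x. f x + g x)"
      by (rule B_extension_tendsto[OF v linear_space_add[OF linear_space_B_space fg]])
    moreover have "v (\<lambda>x. cutoff k x * (f x + g x)) = v (\<lambda>x. cutoff k x * f x) + v (\<lambda>x. cutoff k x * g x)" for k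
      using linear_form_onD(1)[OF lin D D, of f g k k] fg by (simp add: distrib_left)
    ultimately show "B_extension v (\<lambda>x. f x + g x) = B_extension v f + B_extension v g"
      using tendsto_add[OF B_extension_tendsto[OF v fg(1)] B_extension_tendsto[OF v fg(2)]]
      by (simp add: LIMSEQ_unique)
  next
    fix c and f :: "real^'n \<Rightarrow> complex" assume f: "f \<in> B_space"
    have "(\<lambda>k. v (\<lambda>x. cutoff k x * (c * f x))) \<longlonglongrightarrow> B_extension v (\<lambda>x. c * f x)"
      by (rule B_extension_tendsto[OF v linear_space_scale[OF linear_space_B_space f]])
    moreover have "v (\<lambda>x. cutoff k x * (c * f x)) = c * v (\<lambda>x. cutoff k x * f x)" for k
      using linear_form_onD(2)[OF lin D[OF f], of c k] by (simp add: mult_ac)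
    ultimately show "B_extension v (\<lambda>x. c * f x) = c * B_extension v f"
      using tendsto_mult_left[OF B_extension_tendsto[OF v f], of c]
      by (simp add: LIMSEQ_unique)
  qed
  fix M e :: real assume e: "e > 0"
  obtain C where C: "C \<ge> 0" "\<And>f k (x :: real^'n). f \<in> smooth_functions \<Longrightarrow> jet N (\<lambda>x. cutoff k x * f x) x \<le> C * jet N f x"
    using cutoff_mult_jets[of N] by metis
  obtain R d where d: "d > 0" "\<And>f. f \<in> B_dot \<Longrightarrow> (\<And>x. jet N f x \<le> C * M) \<Longrightarrow>
      (\<And>x. norm x \<le> R \<Longrightarrow> jet N f x \<le> d) \<Longrightarrow> cmod (v f) \<le> e"
    using tight_onD[OF v e, of "C * M"] by metis
  have "cmod (B_extension v f) \<le> e"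
    if f: "f \<in> B_space" "\<forall>x. jet N f x \<le> M" "\<forall>x. norm x \<le> R \<longrightarrow> jet N f x \<le> d / (C + 1)" for f
  proof (rule LIMSEQ_le_const2[OF tendsto_norm[OF B_extension_tendsto[OF v f(1)]]], intro exI allI impI)
    fix k
    note sm = B_space_smooth[OF f(1)]
    show "cmod (v (\<lambda>x. cutoff k x * f x)) \<le> e"
    proof (rule d(2)[OF D[OF f(1)]])
      show "jet N (\<lambda>x. cutoff k x * f x) x \<le> C * M" for x
        using f(2) by (intro order_trans[OF C(2)[OF sm]] mult_left_mono C) auto
      fix x :: "real^'n" assume "norm x \<le> R"
      then have "C * jet N f x \<le> C * (d / (C + 1))" using f(3) C(1) by (intro mult_left_mono) auto
      also have "\<dots> \<le> d" using C(1) d(1) by (simp add: field_simps)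
      finally show "jet N (\<lambda>x. cutoff k x * f x) x \<le> d" using C(2)[OF sm, of k x] by linarith
    qed
  qed
  then show "\<exists>R d. 0 < d \<and> (\<forall>f\<in>B_space. (\<forall>x. jet N f x \<le> M) \<and> (\<forall>x. norm x \<le> R \<longrightarrow> jet N f x \<le> d) \<longrightarrow>
      cmod (B_extension v f) \<le> e)"
    using d(1) C(1) by (intro exI[of _ R] exI[of _ "d / (C + 1)"]) auto
qed

section \<open>The canonical extensions\<close>

text \<open>Uniqueness: \<open>\<chi>\<^sub>k f\<close> is a Schwartz function, and a tight form takes the value at \<open>f\<close> as the limit of
  the values at \<open>\<chi>\<^sub>k f\<close>.\<close>

lemma B_dot_extension_eq:
  assumes v: "v \<in> B_dot_dual" and u: "\<And>f. f \<in> schwartz \<Longrightarrow> v f = u f"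
  shows "B_dot_extension u = v"
  unfolding B_dot_extension_def
proof (rule the_equality)
  show "v \<in> B_dot_dual \<and> (\<forall>f\<in>schwartz. v f = u f)" using assms by blast
next
  fix v' assume v': "v' \<in> B_dot_dual \<and> (\<forall>f\<in>schwartz. v' f = u f)"
  obtain N N' where N: "tight_on B_dot N v" "tight_on B_dot N' v'"
    using B_dot_dual_tight v v' by blast
  have "v' f = v f" for f
  proof (cases "f \<in> B_dot")
    case True
    then have fB: "f \<in> B_space" using B_dot_subset_B_space by auto
    have eq: "v' (\<lambda>x. cutoff k x * f x) = v (\<lambda>x. cutoff k x * f x)" for k
      using u v' cutoff_mult_schwartz[OF fB] by auto
    show ?thesis
      using cutoff_mult_tight_tendsto[OF N(1) linear_space_B_dot schwartz_subset_B_dot True fB]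
        cutoff_mult_tight_tendsto[OF N(2) linear_space_B_dot schwartz_subset_B_dot True fB]
      unfolding eq by (rule LIMSEQ_unique[rotated])
  qed (use v v' in \<open>auto simp: B_dot_dual_def dual_space_def\<close>)
  then show "v' = v" by blast
qed

lemma bounded_subset_jet:
  assumes S: "bounded_subset V B_seminorms S" and V: "V \<subseteq> B_space"
  obtains M where "\<And>f x. f \<in> S \<Longrightarrow> jet N f x \<le> M"
proof -
  have "\<exists>M. \<forall>f\<in>S. \<forall>x. cmod (partials is f x) \<le> M" for "is" :: "'a list"
  proof -
    have "bdd_above ((\<lambda>f. SUP x. cmod (partials is f x)) ` S)"
      using S by (auto simp: bounded_subset_def B_seminorms_def)
    then obtain M where M: "\<And>f. f \<in> S \<Longrightarrow> (SUP x. cmod (partials is f x)) \<le> M"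
      by (auto simp: bdd_above_def)
    have "cmod (partials is f x) \<le> M" if "f \<in> S" for f x
    proof -
      have "bdd_above (range (\<lambda>x. cmod (partials is f x)))"
        using that S V by (auto simp: bounded_subset_def B_space_def bounded_iff bdd_above_def subset_iff)
      then show ?thesis using M[OF that] cSUP_upper[of x UNIV] by (meson UNIV_I order_trans)
    qed
    then show ?thesis by blast
  qed
  then obtain m where m: "\<And>is f x. f \<in> S \<Longrightarrow> cmod (partials (is :: 'a list) f x) \<le> m is" by metis
  show thesis
    by (rule that[of "\<Sum>is | length is \<le> N. m is"]) (auto simp: jet_def intro!: sum_mono m)
qed

text \<open>The topology of \<open>B_c\<close> is the finest one, so it suffices to find one admissible
  family of seminorms that dominates the form. Adding the absolute value of the form to the
  seminorms of \<open>C\<^sup>\<infinity>\<close> does not change the topology induced on bounded sets, because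
  the form is tight.\<close>

lemma B_extension_dual_B_c:
  fixes v :: "'n::finite distr"
  assumes v: "tight_on B_dot N v"
  shows "B_extension v \<in> dual_space B_space B_c_topology"
proof -
  define u where "u = B_extension v"
  have tight: "tight_on B_space N u" unfolding u_def by (rule B_extension_tight[OF v])
  then have lin: "linear_form_on B_space u" by (simp add: tight_on_def)
  define p where "p f = cmod (u f)" for f
  define P where "P = insert p (smooth_seminorms :: ((real^'n \<Rightarrow> complex) \<Rightarrow> real) set)"
  have BC: "(B_space :: (real^'n \<Rightarrow> complex) set) \<subseteq> smooth_functions" by (auto simp: B_space_smooth)
  have p: "seminorm_on B_space p"
    unfolding seminorm_on_def p_def
    by (auto simp: linear_form_onD[OF lin] norm_mult intro: norm_triangle_ineq)
  have smooth_adm: "B_c_admissible (smooth_seminorms :: ((real^'n \<Rightarrow> complex) \<Rightarrow> real) set)"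
    by (rule B_c_admissible_smooth_seminorms)
  have sm: "seminorm_on B_space q" if "q \<in> smooth_seminorms" for q :: "(real^'n \<Rightarrow> complex) \<Rightarrow> real"
    using smooth_adm that by (auto simp: B_c_admissible_def)
  have P: "seminorm_on B_space q" if "q \<in> P" for q using that p sm by (auto simp: P_def)
  have "B_c_admissible P"
    unfolding B_c_admissible_def
  proof (intro conjI ballI allI impI P)
    fix S :: "(real^'n \<Rightarrow> complex) set"
    assume S: "bounded_subset B_space B_seminorms S"
    then have SB: "S \<subseteq> B_space" by (simp add: bounded_subset_def)
    have adm: "subtopology (seminorm_topology B_space smooth_seminorms) S = subtopology smooth_topology S"
      using smooth_adm S by (simp add: B_c_admissible_def)
    obtain M where M: "\<And>f x. f \<in> S \<Longrightarrow> jet N f x \<le> M"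
      using bounded_subset_jet[OF S order_refl, of N] by metis
    have "openin (subtopology smooth_topology S) (U \<inter> S)"
      if U: "openin (seminorm_topology B_space P) U" for U
    proof (subst openin_subopen, intro ballI)
      fix g assume g: "g \<in> U \<inter> S"
      obtain F e where F: "finite F" "F \<subseteq> P" "e > 0" "{h \<in> B_space. \<forall>q\<in>F. q (\<lambda>x. h x - g x) < e} \<subseteq> U"
        using seminorm_topology_nbhd[OF linear_space_B_space P U, of g] g by auto
      obtain R d where d: "d > 0" "\<And>f. f \<in> B_space \<Longrightarrow> (\<And>x. jet N f x \<le> M + M) \<Longrightarrow>
          (\<And>x. norm x \<le> R \<Longrightarrow> jet N f x \<le> d) \<Longrightarrow> cmod (u f) \<le> e / 2"
        using tight_onD[OF tight, of "e / 2" "M + M"] F(3) by (metis half_gt_zero)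
      let ?I = "{is :: 'n list. length is \<le> N}"
      define r where "r is = (\<lambda>f. SUP x\<in>cball 0 \<bar>R\<bar>. cmod (partials is f (x :: real^'n)))" for "is" :: "'n list"
      define G where "G = r ` ?I \<union> (F - {p})"
      \<comment> \<open>small enough for the old seminorms, and such that the jet, a sum over \<open>?I\<close>, is at most \<open>d\<close>\<close>
      define e' where "e' = min e (d / (real (card ?I) + 1))"
      have e': "e' > 0" using F(3) d(1) by (auto simp: e'_def intro!: divide_pos_pos)
      have rS: "r is \<in> smooth_seminorms" for "is"
        unfolding smooth_seminorms_def r_def
        by (intro CollectI exI[of _ "is"] exI[of _ "cball 0 \<bar>R\<bar>"]) auto
      have G: "finite G" "G \<subseteq> smooth_seminorms"
        using F rS by (auto simp: G_def P_def finite_indices)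
      let ?W = "{h \<in> smooth_functions. \<forall>q\<in>G. q (\<lambda>x. h x - g x) < e'}"
      have gB: "g \<in> B_space" using g SB by auto
      have "openin smooth_topology ?W"
        unfolding smooth_topology_def using G e' gB BC by (intro openin_seminorm_ball) auto
      then have "openin (subtopology smooth_topology S) (?W \<inter> S)" by (auto simp: openin_subtopology)
      moreover have "q (\<lambda>x. g x - g x) < e'" if "q \<in> G" for q
        using seminorm_on_zero[OF sm[OF subsetD[OF G(2) that]] gB] e' by simp
      then have "g \<in> ?W \<inter> S"
        using g gB BC by (auto simp del: diff_self)
      moreover have "?W \<inter> S \<subseteq> U \<inter> S"
      proof safe
        fix h assume h: "h \<in> S" "h \<in> smooth_functions" "\<forall>q\<in>G. q (\<lambda>x. h x - g x) < e'"
        have hB: "h \<in> B_space" using h(1) SB by auto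
        have hg: "(\<lambda>x. h x - g x) \<in> B_space" by (rule linear_space_diff[OF linear_space_B_space hB gB])
        have "cmod (u (\<lambda>x. h x - g x)) \<le> e / 2"
        proof (rule d(2)[OF hg])
          show "jet N (\<lambda>x. h x - g x) x \<le> M + M" for x
            using jet_diff[OF B_space_smooth[OF hB] B_space_smooth[OF gB], of N x] M[OF h(1), of x] M[of g x] g
            by auto
          fix x :: "real^'n" assume x: "norm x \<le> R"
          have "cmod (partials is (\<lambda>x. h x - g x) x) \<le> e'" if "length is \<le> N" for "is"
          proof -
            have "bounded ((\<lambda>x. cmod (partials is (\<lambda>x. h x - g x) x)) ` cball 0 \<bar>R\<bar>)"
              using B_space_smooth[OF hg]
              by (intro compact_imp_bounded compact_continuous_image continuous_on_norm smooth_continuous compact_cball)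
            then have "cmod (partials is (\<lambda>x. h x - g x) x) \<le> r is (\<lambda>x. h x - g x)"
              unfolding r_def using x by (intro cSUP_upper bounded_imp_bdd_above) auto
            moreover have "r is (\<lambda>x. h x - g x) < e'" using h(3) that by (auto simp: G_def)
            ultimately show ?thesis by linarith
          qed
          then have "jet N (\<lambda>x. h x - g x) x \<le> real (card ?I) * e'" by (rule jet_le_card)
          also have "\<dots> \<le> real (card ?I) * (d / (real (card ?I) + 1))"
            by (intro mult_left_mono) (auto simp: e'_def)
          also have "\<dots> \<le> d" using d(1) by (simp add: field_simps)
          finally show "jet N (\<lambda>x. h x - g x) x \<le> d" .
        qed
        then have "p (\<lambda>x. h x - g x) < e" using F(3) by (simp add: p_def)
        then have "\<forall>q\<in>F. q (\<lambda>x. h x - g x) < e"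
          using h(3) by (auto simp: G_def e'_def)
        then show "h \<in> U" using F(4) hB by auto
      qed
      ultimately show "\<exists>T. openin (subtopology smooth_topology S) T \<and> g \<in> T \<and> T \<subseteq> U \<inter> S" by blast
    qed
    moreover have "openin (seminorm_topology B_space P) U"
      if "openin (seminorm_topology B_space smooth_seminorms) U" for U
      using that unfolding seminorm_topology_def openin_topology_generated_by_iff
    proof induction
      case (Basis s)
      then show ?case by (intro generate_topology_on.Basis) (auto simp: P_def)
    qed (auto intro: generate_topology_on.intros)
    ultimately show "subtopology (seminorm_topology B_space P) S = subtopology smooth_topology S"
      unfolding topology_eq adm[symmetric] by (metis openin_subtopology)
  qed
  then have "openin B_c_topology U" if "openin (seminorm_topology B_space P) U" for U
    using B_c_topology_finest that by blast
  moreover have "continuous_map (seminorm_topology B_space P) euclidean u"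
    by (rule continuous_map_linear_formI[OF linear_space_B_space P lin, where F="{p}" and C=1])
      (auto simp: P_def p_def)
  ultimately have "continuous_map B_c_topology euclidean u"
    unfolding continuous_map_def B_c_topology_def by auto
  then show ?thesis
    using lin unfolding u_def dual_space_def by (auto simp: B_extension_def)
qed

text \<open>The set of all \<open>\<chi>\<^sub>k f\<close> together with \<open>f\<close> is bounded, and on it the topologies of \<open>B_c\<close> and of
  \<open>C\<^sup>\<infinity>\<close> agree. In the latter \<open>\<chi>\<^sub>k f\<close> converges to \<open>f\<close>.\<close>

lemma dual_B_c_sequentially_continuous:
  fixes u :: "'n::finite distr"
  assumes u: "u \<in> dual_space B_space B_c_topology" and f: "f \<in> B_space"
  shows "(\<lambda>k. u (\<lambda>x. cutoff k x * f x)) \<longlonglongrightarrow> u f"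
proof -
  define S where "S = insert f (range (\<lambda>k x. cutoff k x * f x))"
  have g: "(\<lambda>x. cutoff k x * f x) \<in> B_space" for k
    using cutoff_mult_schwartz[OF f] schwartz_subset_B_dot B_dot_subset_B_space by auto
  have "bounded_subset B_space B_seminorms S"
    unfolding bounded_subset_def
  proof (intro conjI ballI)
    show "S \<subseteq> B_space" using f g by (auto simp: S_def)
    fix p :: "(real^'n \<Rightarrow> complex) \<Rightarrow> real" assume "p \<in> B_seminorms"
    then obtain "is" where p: "p = (\<lambda>f. SUP x. cmod (partials is f x))" by (auto simp: B_seminorms_def)
    obtain C where C: "C \<ge> 0" "\<And>k x. jet (length is) (\<lambda>x. cutoff k x * f x) x \<le> C * jet (length is) f x"
      using cutoff_mult_jets[of "length is"] B_space_smooth[OF f] by metis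
    obtain A where A: "A \<ge> 0" "\<And>x. jet (length is) f x \<le> A" using B_space_jet[OF f] by metis
    have "p h \<le> max A (C * A)" if "h \<in> S" for h
      unfolding p
    proof (rule cSUP_least)
      fix x
      have "jet (length is) h x \<le> max A (C * A)"
        using that A(2)[of x] order_trans[OF C(2) mult_left_mono[OF A(2) C(1)], of _ x]
        by (auto simp: S_def intro: max.coboundedI1 max.coboundedI2)
      then show "cmod (partials is h x) \<le> max A (C * A)"
        using partials_le_jet[of "is" "length is" h x] by simp
    qed simp
    then show "bdd_above (p ` S)" by (auto simp: bdd_above_def)
  qed
  with B_c_topology_admissible have eq: "subtopology B_c_topology S = subtopology smooth_topology S"
    unfolding B_c_admissible_def B_c_topology_def by blast
  have "limitin smooth_topology (\<lambda>k x. cutoff k x * f x) f sequentially"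
    unfolding smooth_topology_def
  proof (rule limitin_seminorm_topologyI[OF linear_space_smooth smooth_seminorms_seminorm])
    fix p :: "(real^'n \<Rightarrow> complex) \<Rightarrow> real" assume "p \<in> smooth_seminorms"
    then obtain "is" K where p: "p = (\<lambda>f. SUP x\<in>K. cmod (partials is f x))" "compact K" "K \<noteq> {}"
      by (auto simp: smooth_seminorms_def)
    obtain R where R: "\<And>x. x \<in> K \<Longrightarrow> norm x \<le> R"
      using compact_imp_bounded[OF p(2)] by (auto simp: bounded_iff)
    have p0: "p (\<lambda>x. cutoff k x * f x - f x) \<ge> 0" for k
      using \<open>p \<in> smooth_seminorms\<close> g f
      by (intro seminorm_onD(1)[OF smooth_seminorms_seminorm] smooth_functions_diff) (auto simp: B_space_smooth)
    show "(\<lambda>k. p (\<lambda>x. cutoff k x * f x - f x)) \<longlonglongrightarrow> 0"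
    proof (rule tendstoI)
      fix e :: real assume e: "e > 0"
      show "eventually (\<lambda>k. dist (p (\<lambda>x. cutoff k x * f x - f x)) 0 < e) sequentially"
        using cutoff_mult_tendsto[OF f half_gt_zero[OF e], of R "length is"]
      proof eventually_elim
        case (elim k)
        have "p (\<lambda>x. cutoff k x * f x - f x) \<le> e / 2"
          unfolding p(1)
        proof (rule cSUP_least[OF p(3)])
          fix x assume "x \<in> K"
          then have "jet (length is) (\<lambda>x. cutoff k x * f x - f x) x \<le> e / 2" using elim R by blast
          then show "cmod (partials is (\<lambda>x. cutoff k x * f x - f x) x) \<le> e / 2"
            using partials_le_jet[of "is" "length is" "\<lambda>x. cutoff k x * f x - f x" x] by simp
        qed
        then show ?case using e p0[of k] by simp
      qed
    qed
  qed (use f g in \<open>auto simp: B_space_smooth\<close>)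
  then have "limitin (subtopology B_c_topology S) (\<lambda>k x. cutoff k x * f x) f sequentially"
    unfolding eq limitin_subtopology by (auto simp: S_def)
  then have "limitin B_c_topology (\<lambda>k x. cutoff k x * f x) f sequentially"
    by (simp add: limitin_subtopology)
  from continuous_map_limit[OF _ this, of euclidean u] u show ?thesis
    by (simp add: dual_space_def o_def)
qed

lemma DL1_B_c_pairing_eq:
  assumes v: "v \<in> B_dot_dual" and u: "\<And>f. f \<in> schwartz \<Longrightarrow> v f = u f"
  shows "DL1_B_c_pairing u = B_extension v"
proof -
  obtain N where N: "tight_on B_dot N v" using B_dot_dual_tight[OF v] by blast
  have ext: "B_dot_extension u = v" by (rule B_dot_extension_eq[OF v u])
  show ?thesis
    unfolding DL1_B_c_pairing_def ext
  proof (rule the_equality)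
    show "B_extension v \<in> dual_space B_space B_c_topology \<and> (\<forall>f\<in>B_dot. B_extension v f = v f)"
      using B_extension_dual_B_c[OF N] B_extension_eq[OF N] by blast
  next
    fix v' assume v': "v' \<in> dual_space B_space B_c_topology \<and> (\<forall>f\<in>B_dot. v' f = v f)"
    have "v' f = B_extension v f" for f
    proof (cases "f \<in> B_space")
      case True
      have eq: "v' (\<lambda>x. cutoff k x * f x) = v (\<lambda>x. cutoff k x * f x)" for k
        using v' cutoff_mult_schwartz[OF True] schwartz_subset_B_dot by blast
      have "v' \<in> dual_space B_space B_c_topology" using v' by blast
      from dual_B_c_sequentially_continuous[OF this True] B_extension_tendsto[OF N True]
      show ?thesis unfolding eq by (rule LIMSEQ_unique)
    next
      case False
      then show ?thesis using v' by (simp add: dual_space_def B_extension_def)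
    qed
    then show "v' = B_extension v" by blast
  qed
qed

section \<open>Convolution with integrable functions\<close>

lemma lborel_distr_reflect: "distr lborel borel (\<lambda>h :: real^'n::finite. x - h) = lborel"
  using lborel_affine[of "-1" x] by (simp add: density_1)

lemma integrable_reflect:
  fixes f :: "real^'n::finite \<Rightarrow> 'b::{banach, second_countable_topology}"
  assumes "integrable lborel f"
  shows "integrable lborel (\<lambda>h. f (x - h))"
  using assms integrable_distr_eq[of "\<lambda>h. x - h" lborel borel f] borel_measurable_integrable[OF assms]
  by (simp add: lborel_distr_reflect)

lemma integral_reflect:
  fixes f :: "real^'n::finite \<Rightarrow> 'b::{banach, second_countable_topology}"
  assumes "f \<in> borel_measurable borel"
  shows "(LINT h|lborel. f (x - h)) = (LINT h|lborel. f h)"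
  using integral_distr[of "\<lambda>h. x - h" lborel borel f] assms by (simp add: lborel_distr_reflect)

definition conv :: "(real^'n::finite \<Rightarrow> complex) \<Rightarrow> (real^'n \<Rightarrow> complex) \<Rightarrow> real^'n \<Rightarrow> complex" where
  "conv a c x = (LINT h|lborel. a h * c (x - h))"

lemma conv_commute:
  assumes [measurable]: "a \<in> borel_measurable borel" "c \<in> borel_measurable borel"
  shows "conv a c = conv c a"
proof
  fix x
  show "conv a c x = conv c a x"
    unfolding conv_def by (subst integral_reflect[of _ x, symmetric]) (simp_all add: mult.commute)
qed

text \<open>In this form the remainders given by Taylor's formula can be integrated, or estimated by a
  continuous linear form, before differentiability is concluded.\<close>

lemma has_derivative_quadratic_remainder:
  fixes f :: "'a::real_normed_vector \<Rightarrow> 'b::real_normed_vector"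
  assumes D: "bounded_linear D" and K: "\<And>v. norm v \<le> 1 \<Longrightarrow> norm (f (x + v) - f x - D v) \<le> K * (norm v)\<^sup>2"
  shows "(f has_derivative D) (at x)"
  unfolding has_derivative_at
proof
  have "((\<lambda>v::'a. \<bar>K\<bar> * norm v) \<longlongrightarrow> \<bar>K\<bar> * norm (0::'a)) (at 0)"
    by (rule tendsto_mult_left[OF tendsto_norm[OF tendsto_ident_at]])
  moreover have "eventually (\<lambda>v. norm (norm (f (x + v) - f x - D v) / norm v) \<le> \<bar>K\<bar> * norm v) (at 0)"
  proof -
    have "eventually (\<lambda>v::'a. norm v < 1) (at 0)"
      unfolding eventually_at by (intro exI[of _ 1]) auto
    then show ?thesis
    proof eventually_elim
      case (elim v)
      have "norm (f (x + v) - f x - D v) \<le> \<bar>K\<bar> * (norm v)\<^sup>2"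
        using elim by (intro order_trans[OF K] mult_right_mono) auto
      then show ?case
        by (cases "v = 0") (auto simp: divide_le_eq power2_eq_square mult.assoc)
    qed
  qed
  ultimately show "(\<lambda>v. norm (f (x + v) - f x - D v) / norm v) \<midarrow>0\<rightarrow> 0"
    by - (rule Lim_null_comparison, simp_all)
qed (rule D)

lemma B_space_partials:
  assumes "f \<in> B_space"
  shows "partials is f \<in> B_space"
  using assms by (auto simp: B_space_def smooth_partials simp flip: partials_append)

lemma B_space_cmod:
  assumes "f \<in> B_space"
  obtains C where "C \<ge> 0" "\<And>x. cmod (f x) \<le> C"
  using B_space_jet[OF assms, of 0] cmod_le_jet order_trans by metis

lemma integrable_mult_B_space:
  assumes a: "integrable lborel a" and c: "c \<in> B_space"
  shows "integrable lborel (\<lambda>h. a h * c (x - h))"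
proof -
  obtain C where C: "C \<ge> 0" "\<And>x. cmod (c x) \<le> C" using B_space_cmod[OF c] by metis
  have [measurable]: "a \<in> borel_measurable borel" "c \<in> borel_measurable borel"
    using borel_measurable_integrable[OF a] smooth_measurable[OF B_space_smooth[OF c]] by simp_all
  have "integrable lborel (\<lambda>h. C * cmod (a h))" using a by simp
  then show ?thesis
    by (rule Bochner_Integration.integrable_bound)
      (auto simp: norm_mult mult.commute[of C] C intro!: mult_left_mono)
qed

text \<open>Differentiation under the integral: Taylor's formula for \<open>c\<close> has a remainder that is quadratic
  in the increment, uniformly in the point, and integrating it against \<open>a\<close> keeps it quadratic.\<close>

lemma conv_smooth:
  fixes a c :: "real^'n::finite \<Rightarrow> complex"
  assumes a: "integrable lborel a" and c: "c \<in> B_space"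
  shows "partials is (conv a c) = conv a (partials is c)" and "conv a c \<in> smooth_functions"
proof -
  have D: "(conv a c has_derivative (\<lambda>v. \<Sum>i\<in>UNIV. (v $ i) *\<^sub>R conv a (partial i c) x)) (at x)"
    if c: "c \<in> B_space" for c :: "real^'n \<Rightarrow> complex" and x
  proof -
    obtain C where C: "C \<ge> 0" "\<And>x. jet 2 c x \<le> C" using B_space_jet[OF c] by metis
    let ?K = "real CARD('n) ^ 2 * C"
    show ?thesis
    proof (rule has_derivative_quadratic_remainder)
    show "bounded_linear (\<lambda>v :: real^'n. \<Sum>i\<in>UNIV. (v $ i) *\<^sub>R conv a (partial i c) x)"
      by (intro bounded_linear_sum bounded_linear_scaleR_const bounded_linear_vec_nth)
    fix v :: "real^'n"
    have int: "integrable lborel (\<lambda>h. a h * c (x + v - h))" "integrable lborel (\<lambda>h. a h * c (x - h))"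
      "integrable lborel (\<lambda>h. a h * partial i c (x - h))" for i
      using integrable_mult_B_space[OF a B_space_partials[OF c, of "[i]"]]
      by (auto intro: integrable_mult_B_space[OF a c])
    have "conv a c (x + v) - conv a c x - (\<Sum>i\<in>UNIV. (v $ i) *\<^sub>R conv a (partial i c) x) =
        (LINT h|lborel. a h * c (x + v - h) - a h * c (x - h) - (\<Sum>i\<in>UNIV. (v $ i) *\<^sub>R (a h * partial i c (x - h))))"
      unfolding conv_def
      by (simp add: int Bochner_Integration.integral_diff Bochner_Integration.integral_sum)
    also have "cmod \<dots> \<le> (LINT h|lborel. cmod (a h) * (?K * (norm v)\<^sup>2))"
    proof (rule Bochner_Integration.integral_norm_bound_integral)
      show "integrable lborel (\<lambda>h. a h * c (x + v - h) - a h * c (x - h) - (\<Sum>i\<in>UNIV. (v $ i) *\<^sub>R (a h * partial i c (x - h))))"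
        by (intro Bochner_Integration.integrable_diff Bochner_Integration.integrable_sum
            integrable_scaleR_right int)
      show "integrable lborel (\<lambda>h. cmod (a h) * (?K * (norm v)\<^sup>2))" using a by simp
      fix h
      have "a h * c (x + v - h) - a h * c (x - h) - (\<Sum>i\<in>UNIV. (v $ i) *\<^sub>R (a h * partial i c (x - h))) =
          a h * (c (x - h + v) - c (x - h) - (\<Sum>i\<in>UNIV. (v $ i) *\<^sub>R partial i c (x - h)))"
        by (simp add: right_diff_distrib sum_distrib_left algebra_simps)
      moreover have "cmod (c (x - h + v) - c (x - h) - (\<Sum>i\<in>UNIV. (v $ i) *\<^sub>R partial i c (x - h)))
          \<le> ?K * (norm v)\<^sup>2"
      proof (rule smooth_taylor[OF B_space_smooth[OF c]])
        fix t :: real and i j :: 'n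
        show "cmod (partial i (partial j c) (x - h + t *\<^sub>R v)) \<le> C"
          using order_trans[OF partials_le_jet[of "[i, j]" 2 c] C(2)] by simp
      qed
      ultimately show "cmod (a h * c (x + v - h) - a h * c (x - h) - (\<Sum>i\<in>UNIV. (v $ i) *\<^sub>R (a h * partial i c (x - h))))
          \<le> cmod (a h) * (?K * (norm v)\<^sup>2)"
        by (simp add: norm_mult mult_left_mono)
    qed
    also have "\<dots> = ((LINT h|lborel. cmod (a h)) * ?K) * (norm v)\<^sup>2"
      by (simp add: integral_mult_left_zero)
    finally show "cmod (conv a c (x + v) - conv a c x - (\<Sum>i\<in>UNIV. (v $ i) *\<^sub>R conv a (partial i c) x))
      \<le> ((LINT h|lborel. cmod (a h)) * ?K) * (norm v)\<^sup>2" .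
    qed
  qed
  have P: "partial i (conv a c) = conv a (partial i c)" if c: "c \<in> B_space" for c i
  proof
    fix x
    have "((axis i 1 :: real^'n) $ k) *\<^sub>R conv a (partial k c) x = (if k = i then conv a (partial i c) x else 0)" for k
      by (simp add: axis_def)
    then show "partial i (conv a c) x = conv a (partial i c) x"
      unfolding partial_eq_derivative[OF D[OF c]] by simp
  qed
  have eq: "partials is (conv a c) = conv a (partials is c)" for "is"
    by (induction "is") (use P[OF B_space_partials[OF c]] in auto)
  then show "partials is (conv a c) = conv a (partials is c)" .
  have "partials is (conv a c) differentiable at x" for "is" x
    unfolding eq using D[OF B_space_partials[OF c]] by (rule differentiableI)
  then show "conv a c \<in> smooth_functions"
    by (simp add: smooth_functions_def differentiable_on_def)
qed

lemma integrable_mult_jet: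
  assumes a: "integrable lborel a" and c: "c \<in> B_space"
  shows "integrable lborel (\<lambda>h. cmod (a h) * jet N c (x - h))"
proof -
  have "integrable lborel (\<lambda>h. \<Sum>is | length is \<le> N. cmod (a h * partials is c (x - h)))"
    by (intro Bochner_Integration.integrable_sum integrable_norm integrable_mult_B_space a B_space_partials c)
  then show ?thesis by (simp add: jet_def norm_mult sum_distrib_left)
qed

lemma jet_conv:
  assumes a: "integrable lborel a" and c: "c \<in> B_space"
  shows "jet N (conv a c) x \<le> (LINT h|lborel. cmod (a h) * jet N c (x - h))"
proof -
  have "jet N (conv a c) x \<le> (\<Sum>is | length is \<le> N. (LINT h|lborel. cmod (a h * partials is c (x - h))))"
    unfolding jet_def conv_smooth[OF assms] by (intro sum_mono) (simp add: conv_def)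
  also have "\<dots> = (LINT h|lborel. (\<Sum>is | length is \<le> N. cmod (a h * partials is c (x - h))))"
    by (intro Bochner_Integration.integral_sum[symmetric] integrable_norm integrable_mult_B_space a
        B_space_partials c)
  finally show ?thesis by (simp add: jet_def norm_mult sum_distrib_left)
qed

section \<open>Weights\<close>

text \<open>The properties of the weight that are used below. The inequality \<open>w_add\<close> says
  that \<open>1 / w\<close> is subconvolutive: together with the integrability of \<open>1 / w\<close> it makes the functions
  that are \<open>O(1 / w)\<close> with all derivatives stable under convolution.\<close>

locale smooth_weight =
  fixes w :: "real^'n::finite \<Rightarrow> real" and A :: real and P :: nat
  assumes w_ge_1: "1 \<le> w x"
    and w_smooth: "(\<lambda>x. complex_of_real (w x)) \<in> smooth_functions"
    and w_jet: "\<exists>C\<ge>0. \<forall>x. jet N (\<lambda>x. complex_of_real (w x)) x \<le> C * w x"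
    and w_inverse_smooth: "(\<lambda>x. complex_of_real (inverse (w x))) \<in> smooth_functions"
    and w_inverse_jet: "\<exists>C\<ge>0. \<forall>x. jet N (\<lambda>x. complex_of_real (inverse (w x))) x \<le> C * inverse (w x)"
    and w_add: "w (x + h) \<le> A * (w x + w h)"
    and w_double: "norm s \<le> 2 * norm h \<Longrightarrow> w s \<le> A * w h"
    and w_integrable: "integrable lborel (\<lambda>x. inverse (w x))"
    and w_poly: "w x \<le> (1 + (norm x)\<^sup>2) ^ P"
begin

lemma w_pos: "0 < w x"
  using w_ge_1[of x] by linarith

lemma w_nonneg [simp]: "0 \<le> w x"
  using w_ge_1[of x] by linarith

lemma w_neq_0 [simp]: "w x \<noteq> 0"
  using w_ge_1[of x] by auto

lemma w_measurable [measurable]: "w \<in> borel_measurable borel"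
proof -
  have "(\<lambda>x. Re (complex_of_real (w x))) \<in> borel_measurable borel"
    using smooth_measurable[OF w_smooth] by measurable
  then show ?thesis by simp
qed

lemma A_ge_1: "1 \<le> A"
  using w_double[of 0 0] w_ge_1[of 0] by (simp add: pos_le_divide_eq)

lemma w_shift: "w x \<le> 2 * A * (w (x - h) * w h)"
proof -
  have "w x \<le> A * (w (x - h) + w h)" using w_add[of "x - h" h] by simp
  also have "\<dots> \<le> A * (w (x - h) * w h + w (x - h) * w h)"
    using mult_left_mono[OF w_ge_1[of h] w_nonneg[of "x - h"]] mult_right_mono[OF w_ge_1[of "x - h"] w_nonneg[of h]] A_ge_1
    by (intro mult_left_mono add_mono) auto
  finally show ?thesis by (simp add: algebra_simps)
qed

definition near_const where "near_const = A * (1 + 2 ^ P)"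

lemma w_near: "norm k \<le> 1 \<Longrightarrow> w (h + k) \<le> near_const * w h"
proof -
  assume k: "norm k \<le> 1"
  have "w k \<le> (1 + (norm k)\<^sup>2) ^ P" by (rule w_poly)
  also have "\<dots> \<le> 2 ^ P" using k power_le_one[of "norm k" 2] by (intro power_mono) auto
  also have "\<dots> \<le> 2 ^ P * w h" using mult_left_mono[OF w_ge_1[of h], of "2 ^ P"] by simp
  finally have "w h + w k \<le> (1 + 2 ^ P) * w h" by (simp add: distrib_right)
  then have "A * (w h + w k) \<le> A * ((1 + 2 ^ P) * w h)" using A_ge_1 by (intro mult_left_mono) auto
  then show ?thesis using w_add[of h k] by (simp add: near_const_def mult.assoc)
qed

lemma near_const_nonneg: "0 \<le> near_const"
  using A_ge_1 by (simp add: near_const_def)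

definition mult_w :: "(real^'n \<Rightarrow> complex) \<Rightarrow> real^'n \<Rightarrow> complex" where
  "mult_w c = (\<lambda>x. complex_of_real (w x) * c x)"

definition div_w :: "(real^'n \<Rightarrow> complex) \<Rightarrow> real^'n \<Rightarrow> complex" where
  "div_w f = (\<lambda>x. complex_of_real (inverse (w x)) * f x)"

lemma mult_w_div_w [simp]: "mult_w (div_w f) = f" "div_w (mult_w f) = f"
  by (simp_all add: mult_w_def div_w_def fun_eq_iff)

lemma mult_w_linear: "mult_w (\<lambda>x. c x + d x) = (\<lambda>x. mult_w c x + mult_w d x)" "mult_w (\<lambda>x. r * c x) = (\<lambda>x. r * mult_w c x)"
  "mult_w (\<lambda>x. c x - d x) = (\<lambda>x. mult_w c x - mult_w d x)"
  by (auto simp: mult_w_def algebra_simps)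

lemma div_w_linear: "div_w (\<lambda>x. c x + d x) = (\<lambda>x. div_w c x + div_w d x)" "div_w (\<lambda>x. r * c x) = (\<lambda>x. r * div_w c x)"
  by (auto simp: div_w_def algebra_simps)

lemma mult_w_smooth: "c \<in> smooth_functions \<Longrightarrow> mult_w c \<in> smooth_functions"
  unfolding mult_w_def by (intro smooth_mult w_smooth)

lemma div_w_smooth: "c \<in> smooth_functions \<Longrightarrow> div_w c \<in> smooth_functions"
  unfolding div_w_def by (intro smooth_mult w_inverse_smooth)

lemma jet_mult_w: "\<exists>C\<ge>0. \<forall>c\<in>smooth_functions. \<forall>x. jet N (mult_w c) x \<le> C * (w x * jet N c x)"
proof -
  obtain C where C: "C \<ge> 0" "\<And>f g (x :: real^'n). f \<in> smooth_functions \<Longrightarrow> g \<in> smooth_functions \<Longrightarrow>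
      jet N (\<lambda>x. f x * g x) x \<le> C * (jet N f x * jet N g x)"
    using jet_mult[of N] by metis
  obtain D where D: "D \<ge> 0" "\<And>x. jet N (\<lambda>x. complex_of_real (w x)) x \<le> D * w x"
    using w_jet by metis
  have "jet N (mult_w c) x \<le> (C * D) * (w x * jet N c x)" if c: "c \<in> smooth_functions" for c x
  proof -
    have "jet N (mult_w c) x \<le> C * (jet N (\<lambda>x. complex_of_real (w x)) x * jet N c x)"
      unfolding mult_w_def by (rule C(2)[OF w_smooth c])
    also have "\<dots> \<le> C * ((D * w x) * jet N c x)" by (intro mult_left_mono mult_right_mono C D jet_nonneg)
    finally show ?thesis by (simp add: mult_ac)
  qed
  then show ?thesis using C(1) D(1) by (intro exI[of _ "C * D"]) auto
qed

lemma jet_div_w: "\<exists>C\<ge>0. \<forall>f\<in>smooth_functions. \<forall>x. w x * jet N (div_w f) x \<le> C * jet N f x"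
proof -
  obtain C where C: "C \<ge> 0" "\<And>f g (x :: real^'n). f \<in> smooth_functions \<Longrightarrow> g \<in> smooth_functions \<Longrightarrow>
      jet N (\<lambda>x. f x * g x) x \<le> C * (jet N f x * jet N g x)"
    using jet_mult[of N] by metis
  obtain D where D: "D \<ge> 0" "\<And>x. jet N (\<lambda>x. complex_of_real (inverse (w x))) x \<le> D * inverse (w x)"
    using w_inverse_jet by metis
  have "w x * jet N (div_w f) x \<le> (C * D) * jet N f x" if f: "f \<in> smooth_functions" for f x
  proof -
    have "jet N (div_w f) x \<le> C * (jet N (\<lambda>x. complex_of_real (inverse (w x))) x * jet N f x)"
      unfolding div_w_def by (rule C(2)[OF w_inverse_smooth f])
    also have "\<dots> \<le> C * ((D * inverse (w x)) * jet N f x)" by (intro mult_left_mono mult_right_mono C D jet_nonneg)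
    finally have "w x * jet N (div_w f) x \<le> w x * (C * ((D * inverse (w x)) * jet N f x))"
      by (rule mult_left_mono) simp
    also have "\<dots> = (C * D) * jet N f x" by (simp add: field_simps)
    finally show ?thesis .
  qed
  then show ?thesis using C(1) D(1) by (intro exI[of _ "C * D"]) auto
qed

text \<open>This is the space \<open>w\<^sup>-\<^sup>1 B\<close>, see \<open>decaying_iff\<close>. It contains the Schwartz functions and the
  Poisson kernels.\<close>

definition decaying :: "(real^'n \<Rightarrow> complex) set" where
  "decaying = {c \<in> smooth_functions. \<forall>N. \<exists>C. \<forall>x. w x * jet N c x \<le> C}"

lemma decaying_smooth: "c \<in> decaying \<Longrightarrow> c \<in> smooth_functions"
  by (simp add: decaying_def)

lemma decaying_jet:
  assumes "c \<in> decaying"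
  obtains C where "C \<ge> 0" "\<And>x. w x * jet N c x \<le> C"
proof -
  obtain C where C: "\<And>x. w x * jet N c x \<le> C" using assms unfolding decaying_def by blast
  have "0 \<le> w 0 * jet N c 0" by (simp add: jet_nonneg)
  then show thesis using that[of C] C order_trans by blast
qed

lemma decaying_mult_w: "c \<in> decaying \<Longrightarrow> mult_w c \<in> B_space"
proof -
  assume c: "c \<in> decaying"
  have "\<exists>C. \<forall>x. jet N (mult_w c) x \<le> C" for N
  proof -
    obtain C where C: "C \<ge> 0" "\<And>x. jet N (mult_w c) x \<le> C * (w x * jet N c x)"
      using jet_mult_w decaying_smooth[OF c] by metis
    obtain M where M: "M \<ge> 0" "\<And>x. w x * jet N c x \<le> M" using decaying_jet[OF c] by metis
    have "jet N (mult_w c) x \<le> C * M" for x by (rule order_trans[OF C(2) mult_left_mono[OF M(2) C(1)]])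
    then show ?thesis by blast
  qed
  then show ?thesis by (simp add: B_space_iff mult_w_smooth decaying_smooth c)
qed

lemma decaying_div_w: "f \<in> B_space \<Longrightarrow> div_w f \<in> decaying"
proof -
  assume f: "f \<in> B_space"
  have "\<exists>C. \<forall>x. w x * jet N (div_w f) x \<le> C" for N
  proof -
    obtain C where C: "C \<ge> 0" "\<And>x. w x * jet N (div_w f) x \<le> C * jet N f x"
      using jet_div_w B_space_smooth[OF f] by metis
    obtain M where M: "M \<ge> 0" "\<And>x. jet N f x \<le> M" using B_space_jet[OF f] by metis
    have "w x * jet N (div_w f) x \<le> C * M" for x by (rule order_trans[OF C(2) mult_left_mono[OF M(2) C(1)]])
    then show ?thesis by blast
  qed
  then show ?thesis by (simp add: decaying_def div_w_smooth B_space_smooth f)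
qed

lemma decaying_iff: "c \<in> decaying \<longleftrightarrow> mult_w c \<in> B_space"
  using decaying_mult_w[of c] decaying_div_w[of "mult_w c"] by auto

lemma decaying_subset_B_space: "c \<in> decaying \<Longrightarrow> c \<in> B_space"
proof -
  assume c: "c \<in> decaying"
  have "\<exists>C. \<forall>x. jet N c x \<le> C" for N
  proof -
    obtain M where M: "M \<ge> 0" "\<And>x. w x * jet N c x \<le> M" using decaying_jet[OF c] by metis
    have "jet N c x \<le> M" for x
      using mult_right_mono[OF w_ge_1[of x] jet_nonneg[of N c x]] M(2)[of x] by simp
    then show ?thesis by blast
  qed
  then show ?thesis by (simp add: B_space_iff decaying_smooth c)
qed

lemma schwartz_decaying: "f \<in> schwartz \<Longrightarrow> f \<in> decaying"
proof -
  assume f: "f \<in> schwartz"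
  have "\<exists>C. \<forall>x. w x * jet N f x \<le> C" for N
  proof -
    obtain C where "\<And>x. (1 + (norm x)\<^sup>2) ^ P * jet N f x \<le> C" using schwartz_jet[OF f] by metis
    then have "w x * jet N f x \<le> C" for x
      using mult_right_mono[OF w_poly[of x] jet_nonneg[of N f x]] order_trans by blast
    then show ?thesis by blast
  qed
  then show ?thesis by (simp add: decaying_def schwartz_smooth f)
qed

lemma schwartz_mult_w: "f \<in> schwartz \<Longrightarrow> mult_w f \<in> schwartz"
  unfolding mult_w_def
proof (rule schwartz_mult[OF w_smooth])
  fix N
  obtain C where C: "C \<ge> 0" "\<And>x. jet N (\<lambda>x. complex_of_real (w x)) x \<le> C * w x" using w_jet by metis
  have "jet N (\<lambda>x. complex_of_real (w x)) x \<le> C * (1 + (norm x)\<^sup>2) ^ P" for x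
    by (rule order_trans[OF C(2) mult_left_mono[OF w_poly C(1)]])
  then show "\<exists>C P. \<forall>x. jet N (\<lambda>x. complex_of_real (w x)) x \<le> C * (1 + (norm x)\<^sup>2) ^ P" by blast
qed

lemma schwartz_div_w: "f \<in> schwartz \<Longrightarrow> div_w f \<in> schwartz"
  unfolding div_w_def
proof (rule schwartz_mult_B_space)
  have "(\<lambda>x. complex_of_real (inverse (w x))) \<in> decaying"
    using decaying_div_w[OF B_space_const[of 1]] by (simp add: div_w_def)
  then show "(\<lambda>x. complex_of_real (inverse (w x))) \<in> B_space" by (rule decaying_subset_B_space)
qed

text \<open>The factor \<open>w h\<close> comes from \<open>w_shift\<close>. Its growth is the price for the weight not being translation
  invariant, and integrability of \<open>|a| w\<close> compensates for it.\<close>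

lemma translate_jet:
  assumes "\<And>x. w x * jet N c x \<le> M"
  shows "w x * jet N (translate h c) x \<le> 2 * A * M * w h"
proof -
  have "w x * jet N c (x - h) \<le> (2 * A * (w (x - h) * w h)) * jet N c (x - h)"
    by (intro mult_right_mono w_shift jet_nonneg)
  also have "\<dots> = (2 * A * w h) * (w (x - h) * jet N c (x - h))" by (simp add: mult_ac)
  also have "\<dots> \<le> (2 * A * w h) * M" using A_ge_1 by (intro mult_left_mono assms) auto
  finally show ?thesis by (simp add: jet_translate mult_ac)
qed

lemma decaying_translate: "c \<in> decaying \<Longrightarrow> translate h c \<in> decaying"
proof -
  assume c: "c \<in> decaying"
  have "\<exists>C. \<forall>x. w x * jet N (translate h c) x \<le> C" for N
  proof -
    obtain M where M: "M \<ge> 0" "\<And>x. w x * jet N c x \<le> M" using decaying_jet[OF c] by metis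
    from translate_jet[OF M(2)] have "w x * jet N (translate h c) x \<le> 2 * A * M * w h" for x .
    then show ?thesis by blast
  qed
  then show ?thesis using smooth_translate[OF decaying_smooth[OF c]] by (simp add: decaying_def)
qed

lemma decaying_integrable:
  assumes "a \<in> borel_measurable borel" "\<And>h. cmod (a h) \<le> K * inverse (w h)"
  shows "integrable lborel a"
proof -
  have "integrable lborel (\<lambda>h. K * inverse (w h))" using w_integrable by simp
  then show ?thesis
    by (rule Bochner_Integration.integrable_bound)
      (use assms in \<open>auto intro: order_trans[OF _ abs_ge_self]\<close>)
qed

lemma decaying_cmod:
  assumes "\<And>x. w x * jet N c x \<le> K"
  shows "cmod (c x) \<le> K * inverse (w x)"
proof -
  have "w x * cmod (c x) \<le> K"
    using mult_left_mono[OF cmod_le_jet[of c x N] w_nonneg[of x]] assms[of x] by linarith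
  then show ?thesis using w_pos[of x] by (simp add: field_simps)
qed

definition conv_norm where "conv_norm = 2 * A * (LINT h|lborel. inverse (w h))"

lemma conv_norm_nonneg: "0 \<le> conv_norm"
  using A_ge_1 by (simp add: conv_norm_def integral_nonneg_AE)

text \<open>From \<open>w x \<le> A (w (x - h) + w h)\<close> it follows that
  \<open>w x / (w h w (x - h)) \<le> A (1 / w h + 1 / w (x - h))\<close>, and the right-hand side has an integral over \<open>h\<close>
  that does not depend on \<open>x\<close>.\<close>

lemma weighted_conv_bound:
  assumes a: "a \<in> borel_measurable borel" "\<And>h. \<bar>a h\<bar> \<le> K * inverse (w h)"
    and c: "c \<in> borel_measurable borel" "\<And>x. 0 \<le> c x" "\<And>x. w x * c x \<le> M"
  shows "w x * (LINT h|lborel. \<bar>a h\<bar> * c (x - h)) \<le> conv_norm * K * M"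
proof -
  note [measurable] = a(1) c(1)
  have K: "K \<ge> 0"
  proof -
    have "0 \<le> K * inverse (w 0)" using a(2)[of 0] by (rule order_trans[OF abs_ge_zero])
    then show ?thesis using w_pos[of 0] by (simp add: zero_le_mult_iff)
  qed
  have M: "M \<ge> 0" using c(2,3)[of 0] by (meson mult_nonneg_nonneg order_trans w_nonneg)
  have pw: "w x * (\<bar>a h\<bar> * c (x - h)) \<le> A * K * M * (inverse (w h) + inverse (w (x - h)))" for h
  proof -
    have "c (x - h) \<le> M * inverse (w (x - h))"
      using c(3)[of "x - h"] w_pos[of "x - h"] by (simp add: field_simps)
    then have "\<bar>a h\<bar> * c (x - h) \<le> (K * inverse (w h)) * (M * inverse (w (x - h)))"
      using a(2)[of h] c(2)[of "x - h"] K by (intro mult_mono) auto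
    then have "w x * (\<bar>a h\<bar> * c (x - h)) \<le> (A * (w (x - h) + w h)) * ((K * inverse (w h)) * (M * inverse (w (x - h))))"
      using w_add[of "x - h" h] c(2)[of "x - h"] A_ge_1 by (intro mult_mono[of "w x"]) auto
    also have "\<dots> = A * K * M * (inverse (w h) + inverse (w (x - h)))" by (simp add: field_simps)
    finally show ?thesis .
  qed
  have int: "integrable lborel (\<lambda>h. inverse (w h))" "integrable lborel (\<lambda>h. inverse (w (x - h)))"
    using w_integrable integrable_reflect[OF w_integrable] by auto
  have int': "integrable lborel (\<lambda>h. w x * (\<bar>a h\<bar> * c (x - h)))"
  proof (rule Bochner_Integration.integrable_bound)
    show "integrable lborel (\<lambda>h. A * K * M * (inverse (w h) + inverse (w (x - h))))" using int by simp
    show "AE h in lborel. norm (w x * (\<bar>a h\<bar> * c (x - h))) \<le> norm (A * K * M * (inverse (w h) + inverse (w (x - h))))"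
    proof (rule AE_I2)
      fix h
      have "0 \<le> w x * (\<bar>a h\<bar> * c (x - h))" by (simp add: c(2))
      then show "norm (w x * (\<bar>a h\<bar> * c (x - h))) \<le> norm (A * K * M * (inverse (w h) + inverse (w (x - h))))"
        using pw[of h] unfolding real_norm_def by linarith
    qed
  qed measurable
  have "w x * (LINT h|lborel. \<bar>a h\<bar> * c (x - h)) = (LINT h|lborel. w x * (\<bar>a h\<bar> * c (x - h)))" by simp
  also have "\<dots> \<le> (LINT h|lborel. A * K * M * (inverse (w h) + inverse (w (x - h))))"
    using int int' pw by (intro integral_mono) auto
  also have "\<dots> = A * K * M * ((LINT h|lborel. inverse (w h)) + (LINT h|lborel. inverse (w (x - h))))"
    using int by simp
  also have "(LINT h|lborel. inverse (w (x - h))) = (LINT h|lborel. inverse (w h))"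
    by (rule integral_reflect[where f="\<lambda>h. inverse (w h)"]) simp
  finally show ?thesis by (simp add: conv_norm_def mult_ac)
qed

lemma jet_conv_decaying:
  assumes a: "a \<in> borel_measurable borel" "\<And>h. cmod (a h) \<le> K * inverse (w h)"
    and c: "c \<in> decaying" "\<And>x. w x * jet N c x \<le> M"
  shows "w x * jet N (conv a c) x \<le> conv_norm * K * M"
proof -
  have ia: "integrable lborel a" by (rule decaying_integrable[OF a])
  have "w x * jet N (conv a c) x \<le> w x * (LINT h|lborel. \<bar>cmod (a h)\<bar> * jet N c (x - h))"
    using jet_conv[OF ia decaying_subset_B_space[OF c(1)]] by (intro mult_left_mono) auto
  also have "\<dots> \<le> conv_norm * K * M"
  proof (rule weighted_conv_bound)
    show "jet N c \<in> borel_measurable borel" by (rule jet_measurable[OF decaying_smooth[OF c(1)]])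
  qed (use a c(2) in \<open>auto simp: jet_nonneg\<close>)
  finally show ?thesis .
qed

lemma conv_decaying:
  assumes a: "a \<in> borel_measurable borel" "\<And>h. cmod (a h) \<le> K * inverse (w h)" and c: "c \<in> decaying"
  shows "conv a c \<in> decaying"
proof -
  have "\<exists>C. \<forall>x. w x * jet N (conv a c) x \<le> C" for N
  proof -
    obtain M where "\<And>x. w x * jet N c x \<le> M" using decaying_jet[OF c] by metis
    from jet_conv_decaying[OF a c this] show ?thesis by blast
  qed
  then show ?thesis
    using conv_smooth(2)[OF decaying_integrable[OF a] decaying_subset_B_space[OF c]] by (simp add: decaying_def)
qed

end

section \<open>Linear forms and convolutions\<close>

text \<open>Only this bound on the extension of \<open>v\<close> is needed for exchanging it with integrals and derivatives;
  tightness is used again for passing to the limit along cutoffs.\<close>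

definition bounded_form :: "nat \<Rightarrow> real \<Rightarrow> 'n::finite distr \<Rightarrow> bool" where
  "bounded_form N C L \<longleftrightarrow> linear_form_on B_space L \<and> C \<ge> 0 \<and>
     (\<forall>f\<in>B_space. \<forall>M. (\<forall>x. jet N f x \<le> M) \<longrightarrow> cmod (L f) \<le> C * M)"

lemma tight_on_B_space_bounded_form: "tight_on B_space N L \<Longrightarrow> \<exists>C. bounded_form N C L"
  using tight_on_bounded[of B_space N L] linear_space_B_space B_space_smooth
  unfolding bounded_form_def tight_on_def by blast

lemma linear_form_B_space_sum:
  assumes L: "linear_form_on B_space L" and J: "finite J" "\<And>j. j \<in> J \<Longrightarrow> f j \<in> B_space"
  shows "(\<lambda>x. \<Sum>j\<in>J. c j * f j x) \<in> B_space" "L (\<lambda>x. \<Sum>j\<in>J. c j * f j x) = (\<Sum>j\<in>J. c j * L (f j))"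
proof -
  have "(\<lambda>x. \<Sum>j\<in>J. c j * f j x) \<in> B_space \<and> L (\<lambda>x. \<Sum>j\<in>J. c j * f j x) = (\<Sum>j\<in>J. c j * L (f j))"
    using J
  proof (induction J)
    case empty
    show ?case using linear_form_on_zero[OF L B_space_const] B_space_const[of 0] by simp
  next
    case (insert j J)
    have 1: "(\<lambda>x. c j * f j x) \<in> B_space" "(\<lambda>x. \<Sum>j\<in>J. c j * f j x) \<in> B_space"
      using insert by (auto intro: linear_space_scale[OF linear_space_B_space])
    show ?case
      using insert linear_space_add[OF linear_space_B_space 1] linear_form_onD(1)[OF L 1]
        linear_form_onD(2)[OF L, of "f j" "c j"] by simp
  qed
  then show "(\<lambda>x. \<Sum>j\<in>J. c j * f j x) \<in> B_space" "L (\<lambda>x. \<Sum>j\<in>J. c j * f j x) = (\<Sum>j\<in>J. c j * L (f j))"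
    by auto
qed

lemma integral_simple_composition:
  fixes a :: "real^'n::finite \<Rightarrow> complex"
  assumes a: "integrable lborel a" and s: "simple_function lborel s"
  shows "integrable lborel (\<lambda>h. a h * \<phi> (s h))"
    and "(LINT h|lborel. a h * \<phi> (s h)) = (\<Sum>j\<in>range s. (LINT h|lborel. a h * indicator (s -` {j}) h) * \<phi> j)"
proof -
  have fin: "finite (range s)" using simple_functionD(1)[OF s] by simp
  have sets: "s -` {j} \<in> sets lborel" for j using simple_functionD(2)[OF s, of "{j}"] by simp
  have int: "integrable lborel (\<lambda>h. a h * indicator (s -` {j}) h)" for j
  proof (rule Bochner_Integration.integrable_bound[OF integrable_norm[OF a]])
    have [measurable]: "a \<in> borel_measurable lborel" "s -` {j} \<in> sets lborel"
      using borel_measurable_integrable[OF a] sets by auto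
    show "(\<lambda>h. a h * indicator (s -` {j}) h) \<in> borel_measurable lborel" by measurable
    show "AE h in lborel. norm (a h * indicator (s -` {j}) h) \<le> norm (cmod (a h))"
      by (auto simp: indicator_def)
  qed
  have eq: "a h * \<phi> (s h) = (\<Sum>j\<in>range s. (a h * indicator (s -` {j}) h) * \<phi> j)" for h
  proof -
    have "(\<Sum>j\<in>range s. (a h * indicator (s -` {j}) h) * \<phi> j) = (\<Sum>j\<in>range s. if j = s h then a h * \<phi> (s h) else 0)"
      by (intro sum.cong) (auto simp: indicator_def)
    then show ?thesis using fin by simp
  qed
  show "integrable lborel (\<lambda>h. a h * \<phi> (s h))"
    unfolding eq using int by (intro Bochner_Integration.integrable_sum integrable_mult_left)
  show "(LINT h|lborel. a h * \<phi> (s h)) = (\<Sum>j\<in>range s. (LINT h|lborel. a h * indicator (s -` {j}) h) * \<phi> j)"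
    unfolding eq using int by (subst Bochner_Integration.integral_sum) (auto simp: integral_mult_left_zero)
qed

context smooth_weight
begin

text \<open>Along a segment of length at most \<open>1\<close> that starts at \<open>x - h\<close>, a function in \<open>w\<^sup>-\<^sup>1 B\<close> decays like
  \<open>w h / w x\<close>.\<close>

lemma segment_jet:
  assumes M: "\<And>x. w x * jet m c x \<le> M" and v: "norm v \<le> 1" and t: "0 \<le> t" "t \<le> 1"
  shows "jet m c (x - h + t *\<^sub>R v) \<le> 2 * A * near_const * w h * M / w x"
proof -
  define z where "z = x - h + t *\<^sub>R v"
  have "w (x - z) = w (h + (- t) *\<^sub>R v)" by (simp add: z_def)
  also have "\<dots> \<le> near_const * w h" using t v by (intro w_near) (simp add: mult_le_one)
  finally have "w z * w (x - z) \<le> w z * (near_const * w h)" by (rule mult_left_mono) simp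
  then have "2 * A * (w z * w (x - z)) \<le> 2 * A * (w z * (near_const * w h))"
    by (rule mult_left_mono) (use A_ge_1 in simp)
  then have "w x \<le> 2 * A * (w z * (near_const * w h))" using w_shift[of x "x - z"] by simp
  then have "w x * jet m c z \<le> (2 * A * (w z * (near_const * w h))) * jet m c z"
    by (rule mult_right_mono[OF _ jet_nonneg])
  also have "\<dots> = (2 * A * near_const * w h) * (w z * jet m c z)" by (simp add: mult_ac)
  also have "\<dots> \<le> (2 * A * near_const * w h) * M" using A_ge_1 near_const_nonneg by (intro mult_left_mono M) auto
  finally have "jet m c z \<le> 2 * A * near_const * w h * M / w x" using w_pos[of x] by (simp add: field_simps)
  then show ?thesis by (simp only: z_def)
qed

lemma translate_diff_jet:
  "\<exists>C\<ge>0. \<forall>c\<in>smooth_functions. \<forall>M. (\<forall>x. w x * jet (Suc N) c x \<le> M) \<longrightarrow>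
     (\<forall>s h x. norm (s - h) \<le> 1 \<longrightarrow>
        w x * jet N (\<lambda>x. c (x - s) - c (x - h)) x \<le> C * (M * (norm (s - h) * w h)))"
proof -
  obtain C' where C': "C' \<ge> 0" "\<forall>f\<in>smooth_functions. \<forall>(x :: real^'n) v M.
     (\<forall>t. 0 \<le> t \<and> t \<le> 1 \<longrightarrow> jet (Suc N) f (x + t *\<^sub>R v) \<le> M) \<longrightarrow>
     jet N (\<lambda>z. f (z + v) - f z) x \<le> C' * (M * norm v)"
    using jet_mean_value[of N] by blast
  have "w x * jet N (\<lambda>x. c (x - s) - c (x - h)) x \<le> (C' * (2 * A * near_const)) * (M * (norm (s - h) * w h))"
    if c: "c \<in> smooth_functions" and M: "\<forall>x. w x * jet (Suc N) c x \<le> M" and sh: "norm (s - h) \<le> 1" for c M s h x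
  proof -
    define v where "v = h - s"
    have v: "norm v = norm (s - h)" by (simp add: v_def norm_minus_commute)
    have M0: "0 \<le> M" using M jet_nonneg[of "Suc N" c 0] by (meson mult_nonneg_nonneg order_trans w_nonneg)
    define M' where "M' = 2 * A * near_const * w h * M / w x"
    have "jet (Suc N) c (x - h + t *\<^sub>R v) \<le> M'" if "0 \<le> t" "t \<le> 1" for t
      unfolding M'_def using M v sh that by (intro segment_jet) auto
    then have "jet N (\<lambda>z. c (z + v) - c z) (x - h) \<le> C' * (M' * norm v)" by (intro C'(2)[rule_format, OF c]) auto
    moreover have "(\<lambda>x. c (x - s) - c (x - h)) = translate h (\<lambda>z. c (z + v) - c z)"
      by (simp add: translate_def v_def)
    ultimately have "w x * jet N (\<lambda>x. c (x - s) - c (x - h)) x \<le> w x * (C' * (M' * norm v))"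
      by (intro mult_left_mono) (simp_all add: jet_translate)
    then show ?thesis by (simp add: M'_def v field_simps)
  qed
  then show ?thesis
    using C'(1) A_ge_1 near_const_nonneg by (intro exI[of _ "C' * (2 * A * near_const)"]) auto
qed

text \<open>The minimum makes the bound usable for all \<open>s\<close> with \<open>|s| \<le> 2 |h|\<close>: it tends to \<open>0\<close> as \<open>s \<rightarrow> h\<close>
  and is dominated by \<open>w h\<close>.\<close>

lemma translate_diff_jet_min:
  "\<exists>C\<ge>0. \<forall>c\<in>smooth_functions. \<forall>M. (\<forall>x. w x * jet (Suc N) c x \<le> M) \<longrightarrow>
     (\<forall>s h x. norm s \<le> 2 * norm h \<longrightarrow>
        w x * jet N (\<lambda>x. c (x - s) - c (x - h)) x \<le> C * (M * (min 1 (norm (s - h)) * w h)))"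
proof -
  obtain C where C: "C \<ge> 0" "\<forall>c\<in>smooth_functions. \<forall>M. (\<forall>x. w x * jet (Suc N) c x \<le> M) \<longrightarrow>
      (\<forall>s h x. norm (s - h) \<le> 1 \<longrightarrow> w x * jet N (\<lambda>x. c (x - s) - c (x - h)) x \<le> C * (M * (norm (s - h) * w h)))"
    using translate_diff_jet[of N] by blast
  let ?D = "2 * A * (A + 1)"
  have "w x * jet N (\<lambda>x. c (x - s) - c (x - h)) x \<le> (C + ?D) * (M * (min 1 (norm (s - h)) * w h))"
    if c: "c \<in> smooth_functions" and M: "\<forall>x. w x * jet (Suc N) c x \<le> M" and sh: "norm s \<le> 2 * norm h" for c M s h x
  proof -
    have M0: "0 \<le> M" using M jet_nonneg[of "Suc N" c 0] by (meson mult_nonneg_nonneg order_trans w_nonneg)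
    have D0: "?D \<ge> 0" using A_ge_1 by simp
    show ?thesis
    proof (cases "norm (s - h) \<le> 1")
      case True
      have "C * (M * (norm (s - h) * w h)) \<le> (C + ?D) * (M * (norm (s - h) * w h))"
        using D0 M0 by (intro mult_right_mono) auto
      then show ?thesis using C(2)[rule_format, OF c M[rule_format] True, of x] True by (simp add: min_absorb2)
    next
      case False
      have MN: "w x * jet N c x \<le> M" for x
        using M mult_left_mono[OF jet_mono[of N "Suc N" c x] w_nonneg[of x]] by (meson le_SucI order_refl order_trans)
      have "jet N (\<lambda>x. translate s c x - translate h c x) x \<le> jet N (translate s c) x + jet N (translate h c) x"
        by (intro jet_diff smooth_translate c)
      then have "w x * jet N (\<lambda>x. c (x - s) - c (x - h)) x \<le> w x * (jet N (translate s c) x + jet N (translate h c) x)"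
        by (intro mult_left_mono) (auto simp: translate_def)
      also have "\<dots> \<le> 2 * A * M * w s + 2 * A * M * w h"
        unfolding distrib_left by (intro add_mono translate_jet MN)
      also have "\<dots> \<le> 2 * A * M * (A * w h) + 2 * A * M * w h"
        using w_double[OF sh] A_ge_1 M0 by (intro add_mono mult_left_mono) auto
      also have "\<dots> = ?D * (M * w h)" by (simp add: algebra_simps)
      also have "\<dots> \<le> (C + ?D) * (M * w h)" using C(1) M0 by (intro mult_right_mono) auto
      finally show ?thesis using False by (simp add: min_absorb1)
    qed
  qed
  then show ?thesis using C(1) A_ge_1 by (intro exI[of _ "C + ?D"]) auto
qed

lemma bounded_form_mult_w:
  assumes "bounded_form N C L"
  shows "\<exists>C'\<ge>0. \<forall>c\<in>decaying. \<forall>M. (\<forall>x. w x * jet N c x \<le> M) \<longrightarrow> cmod (L (mult_w c)) \<le> C' * M"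
proof -
  obtain D where D: "D \<ge> 0" "\<And>c x. c \<in> smooth_functions \<Longrightarrow> jet N (mult_w c) x \<le> D * (w x * jet N c x)"
    using jet_mult_w by metis
  have "cmod (L (mult_w c)) \<le> (C * D) * M" if c: "c \<in> decaying" and M: "\<forall>x. w x * jet N c x \<le> M" for c M
  proof -
    have "\<forall>x. jet N (mult_w c) x \<le> D * M"
      using M by (intro allI order_trans[OF D(2)[OF decaying_smooth[OF c]]] mult_left_mono D) auto
    then show ?thesis using assms decaying_mult_w[OF c] by (auto simp: bounded_form_def mult.assoc)
  qed
  then show ?thesis using D(1) assms by (intro exI[of _ "C * D"]) (auto simp: bounded_form_def)
qed

lemma bounded_form_linear: "bounded_form N C L \<Longrightarrow> linear_form_on B_space L"
  by (simp add: bounded_form_def)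

lemma linear_form_mult_w_diff:
  assumes "linear_form_on B_space L" "c \<in> decaying" "d \<in> decaying"
  shows "L (mult_w (\<lambda>x. c x - d x)) = L (mult_w c) - L (mult_w d)" "(\<lambda>x. c x - d x) \<in> decaying"
  using linear_form_on_diff[OF assms(1) linear_space_B_space assms(2,3)[THEN decaying_mult_w]]
    linear_space_diff[OF linear_space_B_space assms(2,3)[THEN decaying_mult_w]]
  by (simp_all add: mult_w_linear decaying_iff)

lemma continuous_translate:
  assumes L: "bounded_form N C L" and c: "c \<in> decaying"
  shows "continuous_on UNIV (\<lambda>h. L (mult_w (translate h c)))"
proof (rule continuous_at_imp_continuous_on, intro ballI)
  fix h
  note lin = bounded_form_linear[OF L]
  obtain D where D: "D \<ge> 0" "\<forall>c\<in>decaying. \<forall>M. (\<forall>x. w x * jet N c x \<le> M) \<longrightarrow> cmod (L (mult_w c)) \<le> D * M"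
    using bounded_form_mult_w[OF L] by blast
  obtain E where E: "E \<ge> 0" "\<forall>c\<in>smooth_functions. \<forall>M. (\<forall>x. w x * jet (Suc N) c x \<le> M) \<longrightarrow>
      (\<forall>s h x. norm (s - h) \<le> 1 \<longrightarrow> w x * jet N (\<lambda>x. c (x - s) - c (x - h)) x \<le> E * (M * (norm (s - h) * w h)))"
    using translate_diff_jet[of N] by blast
  obtain M where M: "M \<ge> 0" "\<And>x. w x * jet (Suc N) c x \<le> M" using decaying_jet[OF c] by metis
  have "cmod (L (mult_w (translate s c)) - L (mult_w (translate h c))) \<le> D * (E * (M * (norm (s - h) * w h)))"
    if "norm (s - h) \<le> 1" for s
  proof -
    have "cmod (L (mult_w (\<lambda>x. translate s c x - translate h c x))) \<le> D * (E * (M * (norm (s - h) * w h)))"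
      using E(2)[rule_format, OF decaying_smooth[OF c] M(2) that]
      by (intro D(2)[rule_format] linear_form_mult_w_diff[OF lin] decaying_translate c) (auto simp: translate_def)
    then show ?thesis by (simp add: linear_form_mult_w_diff[OF lin] decaying_translate c)
  qed
  then have "eventually (\<lambda>s. norm (L (mult_w (translate s c)) - L (mult_w (translate h c))) \<le> D * (E * (M * (norm (s - h) * w h)))) (at h)"
    unfolding eventually_at by (intro exI[of _ 1]) (auto simp: dist_norm)
  moreover have "((\<lambda>s. D * (E * (M * (norm (s - h) * w h)))) \<longlongrightarrow> D * (E * (M * (norm (h - h) * w h)))) (at h)"
    by (intro tendsto_intros)
  ultimately have "((\<lambda>s. L (mult_w (translate s c)) - L (mult_w (translate h c))) \<longlongrightarrow> 0) (at h)"
    by - (rule Lim_null_comparison, simp_all)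
  then show "isCont (\<lambda>h. L (mult_w (translate h c))) h"
    unfolding isCont_def by (rule LIM_zero_cancel)
qed

text \<open>The integral over \<open>h\<close> is approximated by replacing the translation by \<open>h\<close> with the translation by \<open>s\<^sub>i h\<close> for simple
  functions \<open>s\<^sub>i\<close> converging to the identity; the integral is then a finite sum, and the
  error is small in the norm that controls the form.\<close>

lemma bounded_form_conv:
  assumes L: "bounded_form N C L" and c: "c \<in> decaying"
    and a: "a \<in> borel_measurable borel" "integrable lborel (\<lambda>h. cmod (a h) * w h)"
    and cv: "conv a c \<in> decaying"
  shows "L (mult_w (conv a c)) = (LINT h|lborel. a h * L (mult_w (translate h c)))"
proof -
  note lin = bounded_form_linear[OF L]
  note [measurable] = a(1)
  have ia: "integrable lborel a"
  proof (rule Bochner_Integration.integrable_bound[OF a(2)])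
    have "cmod (a h) \<le> cmod (a h) * w h" for h
      using mult_left_mono[OF w_ge_1[of h] norm_ge_zero[of "a h"]] by simp
    then show "AE h in lborel. norm (a h) \<le> norm (cmod (a h) * w h)" by auto
  qed simp
  obtain D where D: "D \<ge> 0" "\<forall>c\<in>decaying. \<forall>M. (\<forall>x. w x * jet N c x \<le> M) \<longrightarrow> cmod (L (mult_w c)) \<le> D * M"
    using bounded_form_mult_w[OF L] by blast
  obtain E where E: "E \<ge> 0" "\<forall>c\<in>smooth_functions. \<forall>M. (\<forall>x. w x * jet (Suc N) c x \<le> M) \<longrightarrow>
      (\<forall>s h x. norm s \<le> 2 * norm h \<longrightarrow> w x * jet N (\<lambda>x. c (x - s) - c (x - h)) x \<le> E * (M * (min 1 (norm (s - h)) * w h)))"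
    using translate_diff_jet_min[of N] by blast
  obtain M where M: "M \<ge> 0" "\<And>x. w x * jet (Suc N) c x \<le> M" using decaying_jet[OF c] by metis
  have MN: "w x * jet N c x \<le> M" for x
    using M(2)[of x] mult_left_mono[OF jet_mono[of N "Suc N" c x] w_nonneg[of x]] by simp
  obtain s where s: "\<And>i. simple_function lborel (s i)" "\<And>h. (\<lambda>i. s i h) \<longlonglongrightarrow> h"
      "\<And>i h. norm (s i h) \<le> 2 * norm (h :: real^'n)"
    using borel_measurable_implies_sequence_metric[of "\<lambda>h :: real^'n. h" lborel 0] by auto
  have [measurable]: "s i \<in> borel_measurable borel" for i
    using borel_measurable_simple_function[OF s(1)] by simp
  define F where "F h = L (mult_w (translate h c))" for h
  have F_bound: "cmod (F h) \<le> D * (2 * A * M * w h)" for h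
    unfolding F_def by (intro D(2)[rule_format] decaying_translate c translate_jet MN)
  have F_cont: "continuous_on UNIV F" unfolding F_def by (rule continuous_translate[OF L c])
  have [measurable]: "F \<in> borel_measurable borel" by (rule borel_measurable_continuous_onI[OF F_cont])
  \<comment> \<open>the approximating finite sums of translates\<close>
  define cs where "cs i x = (\<Sum>j\<in>range (s i). (LINT h|lborel. a h * indicator (s i -` {j}) h) * translate j c x)" for i x
  have fin: "finite (range (s i))" for i using simple_functionD(1)[OF s(1)] by simp
  have mult_w_cs: "mult_w (cs i) = (\<lambda>x. \<Sum>j\<in>range (s i). (LINT h|lborel. a h * indicator (s i -` {j}) h) * mult_w (translate j c) x)" for i
    by (simp add: mult_w_def cs_def fun_eq_iff sum_distrib_left mult_ac)
  have cs_decaying: "cs i \<in> decaying" for i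
    unfolding decaying_iff mult_w_cs
    by (intro linear_form_B_space_sum[OF lin] fin decaying_mult_w decaying_translate c)
  have L_cs: "L (mult_w (cs i)) = (LINT h|lborel. a h * F (s i h))" for i
  proof -
    have "L (mult_w (cs i)) = (\<Sum>j\<in>range (s i). (LINT h|lborel. a h * indicator (s i -` {j}) h) * F j)"
      unfolding mult_w_cs F_def by (intro linear_form_B_space_sum[OF lin] fin decaying_mult_w decaying_translate c)
    then show ?thesis by (simp add: integral_simple_composition(2)[OF ia s(1)])
  qed
  define \<kappa> where "\<kappa> i = (LINT h|lborel. cmod (a h) * w h * min 1 (norm (s i h - h)))" for i
  have \<kappa>_integrable: "integrable lborel (\<lambda>h. cmod (a h) * w h * min 1 (norm (s i h - h)))" for i
  proof (rule Bochner_Integration.integrable_bound[OF a(2)])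
    show "AE h in lborel. norm (cmod (a h) * w h * min 1 (norm (s i h - h))) \<le> norm (cmod (a h) * w h)"
      by (intro AE_I2) (auto simp: abs_mult intro!: mult_left_le)
  qed simp
  have \<kappa>_0: "\<kappa> \<longlonglongrightarrow> 0"
  proof -
    have "(\<lambda>i. LINT h|lborel. cmod (a h) * w h * min 1 (norm (s i h - h))) \<longlonglongrightarrow> (LINT h :: real^'n|lborel. 0)"
    proof (rule integral_dominated_convergence[OF _ _ a(2)])
      show "AE h in lborel. (\<lambda>i. cmod (a h) * w h * min 1 (norm (s i h - h))) \<longlonglongrightarrow> 0"
      proof (rule AE_I2)
        fix h
        have "(\<lambda>i. cmod (a h) * w h * min 1 (norm (s i h - h))) \<longlonglongrightarrow> cmod (a h) * w h * min 1 (norm (h - h))"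
          by (intro tendsto_intros s)
        then show "(\<lambda>i. cmod (a h) * w h * min 1 (norm (s i h - h))) \<longlonglongrightarrow> 0" by simp
      qed
      show "AE h in lborel. norm (cmod (a h) * w h * min 1 (norm (s i h - h))) \<le> cmod (a h) * w h" for i
        by (intro AE_I2) (auto simp: abs_mult intro!: mult_left_le)
    qed simp_all
    then show ?thesis unfolding \<kappa>_def[abs_def] by simp
  qed
  have diff: "cmod (L (mult_w (cs i)) - L (mult_w (conv a c))) \<le> D * (E * M * \<kappa> i)" for i
  proof -
    have "w x * jet N (\<lambda>x. cs i x - conv a c x) x \<le> E * M * \<kappa> i" for x
    proof -
      have int12: "integrable lborel (\<lambda>h. a h * partials is c (x - s i h))"
          "integrable lborel (\<lambda>h. a h * partials is c (x - h))" for "is"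
        using integral_simple_composition(1)[OF ia s(1), of "\<lambda>t. partials is c (x - t)"]
          integrable_mult_B_space[OF ia B_space_partials[OF decaying_subset_B_space[OF c]]] by auto
      have P: "partials is (\<lambda>x. cs i x - conv a c x) x =
          (LINT h|lborel. a h * (partials is c (x - s i h) - partials is c (x - h)))" for "is"
      proof -
        have "partials is (cs i) x = (\<Sum>j\<in>range (s i). (LINT h|lborel. a h * indicator (s i -` {j}) h) * partials is c (x - j))"
          unfolding cs_def[abs_def]
          by (subst smooth_sum(2)[OF fin]) (auto intro: smooth_translate decaying_smooth c simp: partials_translate, simp add: translate_def)
        also have "\<dots> = (LINT h|lborel. a h * partials is c (x - s i h))"
          by (rule integral_simple_composition(2)[OF ia s(1), symmetric])
        finally have 1: "partials is (cs i) x = (LINT h|lborel. a h * partials is c (x - s i h))" .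
        have 2: "partials is (conv a c) x = (LINT h|lborel. a h * partials is c (x - h))"
          by (simp add: conv_smooth(1)[OF ia decaying_subset_B_space[OF c]] conv_def)
        show ?thesis
          unfolding partials_diff[OF decaying_smooth[OF cs_decaying] decaying_smooth[OF cv]] 1 2 right_diff_distrib
          by (rule Bochner_Integration.integral_diff[OF int12, symmetric])
      qed
      have int: "integrable lborel (\<lambda>h. a h * (partials is c (x - s i h) - partials is c (x - h)))" for "is"
        unfolding right_diff_distrib
        by (rule Bochner_Integration.integrable_diff[OF int12])
      have J: "jet N (\<lambda>x. c (x - s) - c (x - h)) x = (\<Sum>is | length is \<le> N. cmod (partials is c (x - s) - partials is c (x - h)))" for s h
        using partials_diff[OF smooth_translate smooth_translate, OF decaying_smooth[OF c] decaying_smooth[OF c], of _ s h]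
        unfolding jet_def partials_translate by (simp add: translate_def)
      have "w x * jet N (\<lambda>x. cs i x - conv a c x) x \<le>
          w x * (\<Sum>is | length is \<le> N. LINT h|lborel. cmod (a h * (partials is c (x - s i h) - partials is c (x - h))))"
        unfolding jet_def P by (intro mult_left_mono sum_mono) auto
      also have "\<dots> = (LINT h|lborel. w x * (\<Sum>is | length is \<le> N. cmod (a h * (partials is c (x - s i h) - partials is c (x - h)))))"
        using int by (simp add: Bochner_Integration.integral_sum)
      also have "\<dots> \<le> (LINT h|lborel. E * M * (cmod (a h) * w h * min 1 (norm (s i h - h))))"
      proof (rule integral_mono)
        show "integrable lborel (\<lambda>h. w x * (\<Sum>is | length is \<le> N. cmod (a h * (partials is c (x - s i h) - partials is c (x - h)))))"
          using int by (intro integrable_mult_right Bochner_Integration.integrable_sum integrable_norm)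
        show "integrable lborel (\<lambda>h. E * M * (cmod (a h) * w h * min 1 (norm (s i h - h))))"
          using \<kappa>_integrable by (rule integrable_mult_right)
        fix h
        have "w x * (\<Sum>is | length is \<le> N. cmod (a h * (partials is c (x - s i h) - partials is c (x - h)))) =
            cmod (a h) * (w x * jet N (\<lambda>x. c (x - s i h) - c (x - h)) x)"
          by (simp add: J norm_mult sum_distrib_left mult_ac)
        also have "\<dots> \<le> cmod (a h) * (E * (M * (min 1 (norm (s i h - h)) * w h)))"
          by (intro mult_left_mono E(2)[rule_format, OF decaying_smooth[OF c] M(2) s(3)]) auto
        finally show "w x * (\<Sum>is | length is \<le> N. cmod (a h * (partials is c (x - s i h) - partials is c (x - h))))
            \<le> E * M * (cmod (a h) * w h * min 1 (norm (s i h - h)))" by (simp add: mult_ac)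
      qed
      also have "\<dots> = E * M * \<kappa> i" by (simp add: \<kappa>_def)
      finally show ?thesis .
    qed
    then show ?thesis
      using D(2)[rule_format, of "\<lambda>x. cs i x - conv a c x"] linear_form_mult_w_diff[OF lin cs_decaying cv] by auto
  qed
  have "(\<lambda>i. L (mult_w (cs i))) \<longlonglongrightarrow> L (mult_w (conv a c))"
  proof (rule LIM_zero_cancel, rule Lim_null_comparison)
    have "(\<lambda>i. D * (E * M * \<kappa> i)) \<longlonglongrightarrow> D * (E * M * 0)" by (intro tendsto_intros \<kappa>_0)
    then show "(\<lambda>i. D * (E * M * \<kappa> i)) \<longlonglongrightarrow> 0" by simp
  qed (use diff in auto)
  moreover have "(\<lambda>i. LINT h|lborel. a h * F (s i h)) \<longlonglongrightarrow> (LINT h|lborel. a h * F h)"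
  proof (rule integral_dominated_convergence)
    show "integrable lborel (\<lambda>h. (D * (2 * A * M) * A) * (cmod (a h) * w h))"
      using a(2) by (rule integrable_mult_right)
    show "AE h in lborel. (\<lambda>i. a h * F (s i h)) \<longlonglongrightarrow> a h * F h"
    proof (intro AE_I2 tendsto_mult_left)
      fix h
      have "isCont F h" using F_cont by (simp add: continuous_on_eq_continuous_at)
      then show "(\<lambda>i. F (s i h)) \<longlonglongrightarrow> F h" by (rule isCont_tendsto_compose[OF _ s(2)])
    qed
    show "AE h in lborel. norm (a h * F (s i h)) \<le> (D * (2 * A * M) * A) * (cmod (a h) * w h)" for i
    proof (rule AE_I2)
      fix h
      have "cmod (F (s i h)) \<le> D * (2 * A * M * w (s i h))" by (rule F_bound)
      also have "\<dots> \<le> D * (2 * A * M * (A * w h))"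
        using w_double[OF s(3)] A_ge_1 M(1) D(1) by (intro mult_left_mono) auto
      finally have "cmod (a h) * cmod (F (s i h)) \<le> cmod (a h) * (D * (2 * A * M * (A * w h)))"
        by (intro mult_left_mono) auto
      then show "norm (a h * F (s i h)) \<le> (D * (2 * A * M) * A) * (cmod (a h) * w h)"
        by (simp add: norm_mult mult_ac)
    qed
  qed simp_all
  ultimately show ?thesis unfolding L_cs F_def by (rule LIMSEQ_unique)
qed

end

section \<open>The weight and the Poisson kernel\<close>

definition power_weight :: "real \<Rightarrow> real \<Rightarrow> real^'n::finite \<Rightarrow> real" where
  "power_weight q \<sigma> x = (q + (norm x)\<^sup>2) powr \<sigma>"

lemma power_weight_pos: "q > 0 \<Longrightarrow> power_weight q \<sigma> x > 0"
  by (simp add: power_weight_def add_pos_nonneg less_imp_neq[symmetric])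

lemma base_derivative:
  "((\<lambda>x :: real^'n::finite. q + (norm x)\<^sup>2) has_derivative (\<lambda>v. 2 * (x \<bullet> v))) (at x)"
  unfolding power2_norm_eq_inner by (auto intro!: derivative_eq_intros simp: inner_commute)

text \<open>Every derivative of \<open>(q + |x|\<^sup>2)\<^sup>\<sigma>\<close> is this function times a polynomial in the bounded functions
  \<open>1 / (q + |x|\<^sup>2)\<close> and \<open>x\<^sub>i / (q + |x|\<^sup>2)\<close>; these generate an algebra stable under differentiation.\<close>

lemma power_weight_jet:
  assumes q: "q > 0"
  shows "(\<lambda>x :: real^'n::finite. complex_of_real (power_weight q \<sigma> x)) \<in> smooth_functions"
    and "\<exists>C\<ge>0. \<forall>x :: real^'n. jet N (\<lambda>x. complex_of_real (power_weight q \<sigma> x)) x \<le> C * power_weight q \<sigma> x"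
proof -
  have pos: "q + (norm x)\<^sup>2 > 0" for x :: "real^'n" using q by (simp add: add_pos_nonneg)
  define r where "r x = complex_of_real (inverse (q + (norm x)\<^sup>2))" for x :: "real^'n"
  define b where "b i x = complex_of_real (x $ i * inverse (q + (norm x)\<^sup>2))" for i and x :: "real^'n"
  define X where "X = insert r (range b)"
  have rX: "r \<in> alg X" and bX: "b i \<in> alg X" for i by (auto simp: X_def intro: alg.alg_gen)
  have inv: "((\<lambda>x. inverse (q + (norm x)\<^sup>2)) has_derivative
      (\<lambda>v. - (inverse (q + (norm x)\<^sup>2) * (2 * (x \<bullet> v)) * inverse (q + (norm x)\<^sup>2)))) (at x)" for x :: "real^'n"
    by (rule Deriv.has_derivative_inverse[OF _ base_derivative]) (use pos[of x] in auto)
  have Dr: "(r has_derivative (\<lambda>v. of_real (- (inverse (q + (norm x)\<^sup>2) * (2 * (x \<bullet> v)) * inverse (q + (norm x)\<^sup>2))))) (at x)" for x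
    unfolding r_def[abs_def] by (rule has_derivative_of_real[OF inv])
  have Db: "(b j has_derivative (\<lambda>v. of_real (x $ j * - (inverse (q + (norm x)\<^sup>2) * (2 * (x \<bullet> v)) * inverse (q + (norm x)\<^sup>2))
      + v $ j * inverse (q + (norm x)\<^sup>2)))) (at x)" for j x
    unfolding b_def[abs_def]
    by (rule has_derivative_of_real[OF has_derivative_mult[OF bounded_linear_imp_has_derivative[OF bounded_linear_vec_nth] inv]])
  have X1: "f differentiable at x" if "f \<in> X" for f x
    using that differentiableI[OF Dr] differentiableI[OF Db] by (auto simp: X_def)
  have X2: "partial i f \<in> alg X" if "f \<in> X" for f i
  proof -
    have "partial i r = (\<lambda>x. (-2) * (b i x * r x))"
      unfolding partial_eq_derivative[OF Dr, abs_def]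
      by (simp add: r_def b_def fun_eq_iff inner_axis)
    moreover have "partial i (b j) = (\<lambda>x. (-2) * (b i x * b j x) + of_real (axis i 1 $ j) * r x)" for j
      unfolding partial_eq_derivative[OF Db, abs_def]
      by (simp add: r_def b_def fun_eq_iff inner_axis algebra_simps)
    moreover have "(\<lambda>x. (-2) * (b i x * r x)) \<in> alg X"
      "(\<lambda>x. (-2) * (b i x * b j x) + of_real (axis i 1 $ j) * r x) \<in> alg X" for j
      by (intro alg.alg_add alg.alg_mult alg.alg_const rX bX)+
    ultimately have "partial i r \<in> alg X" "partial i (b j) \<in> alg X" for j by (simp_all only:)
    then show ?thesis using that unfolding X_def by blast
  qed
  have X3: "bounded (range f)" if "f \<in> X" for f
  proof -
    have "cmod (r x) \<le> 1 / q" for x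
      unfolding r_def using q by (simp add: norm_inverse norm_divide field_simps add_pos_nonneg flip: of_real_add of_real_power)
    moreover have "cmod (b i x) \<le> 1 / q + 1" for i x
    proof -
      have "\<bar>x $ i\<bar> \<le> 1 + (norm x)\<^sup>2"
        using component_le_norm_cart[of x i] sum_squares_bound[of 1 "norm x"] by (simp add: power2_eq_square)
      also have "\<dots> \<le> (1 / q + 1) * (q + (norm x)\<^sup>2)" using q by (simp add: field_simps)
      finally show ?thesis
        using pos[of x] by (simp only: b_def norm_of_real abs_mult abs_inverse) (simp add: divide_simps abs_of_pos)
    qed
    ultimately show ?thesis using that unfolding X_def bounded_iff by auto
  qed
  have B: "alg X \<subseteq> B_space" by (rule alg_B_space[OF X1 X2 X3])
  define f where "f x = complex_of_real (power_weight q \<sigma> x)" for x :: "real^'n"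
  have Df: "(f has_derivative (\<lambda>v. of_real (power_weight q \<sigma> x * (\<sigma> * inverse (q + (norm x)\<^sup>2) * (2 * (x \<bullet> v)))))) (at x)" for x
  proof -
    have "((\<lambda>t. t powr \<sigma>) has_real_derivative \<sigma> * (q + (norm x)\<^sup>2) powr (\<sigma> - 1)) (at (q + (norm x)\<^sup>2))"
      by (rule has_real_derivative_powr[OF pos])
    from has_derivative_compose[OF base_derivative[of q x] this[unfolded has_field_derivative_def]]
    have "((\<lambda>x. power_weight q \<sigma> x) has_derivative (\<lambda>v. \<sigma> * (q + (norm x)\<^sup>2) powr (\<sigma> - 1) * (2 * (x \<bullet> v)))) (at x)"
      by (simp add: power_weight_def)
    moreover have "(q + (norm x)\<^sup>2) powr (\<sigma> - 1) = power_weight q \<sigma> x * inverse (q + (norm x)\<^sup>2)"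
      using pos[of x] by (simp add: powr_diff power_weight_def divide_inverse)
    ultimately show ?thesis
      unfolding f_def[abs_def] by (intro has_derivative_of_real) (simp add: mult_ac)
  qed
  have "\<exists>g\<in>alg X. partials is f = (\<lambda>x. g x * f x)" for "is"
  proof (induction "is")
    case Nil
    show ?case by (rule bexI[of _ "\<lambda>_. 1"]) (auto intro: alg.alg_const)
  next
    case (Cons i js)
    then obtain g where g: "g \<in> alg X" "partials js f = (\<lambda>x. g x * f x)" by blast
    have g': "partial i g \<in> alg X" "g differentiable at x" for x
      using alg_partials(1)[OF X1 X2 g(1), of "[i]"] alg_partials(2)[OF X1 X2 g(1), of "[]" x] by auto
    have "partial i f x = (2 * of_real \<sigma>) * b i x * f x" for x
      unfolding partial_eq_derivative[OF Df] by (simp add: f_def b_def inner_axis mult_ac)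
    then have "partials (i # js) f = (\<lambda>x. (partial i g x + g x * ((2 * of_real \<sigma>) * b i x)) * f x)"
      unfolding partials.simps g(2)
      by (subst partial_mult[OF g'(2) differentiableI[OF Df], abs_def]) (simp add: algebra_simps)
    moreover have "(\<lambda>x. partial i g x + g x * ((2 * of_real \<sigma>) * b i x)) \<in> alg X"
      by (intro alg.alg_add alg.alg_mult g' g(1) bX alg.alg_const)
    ultimately show ?case by (rule bexI)
  qed
  then obtain g where g: "\<And>is. g is \<in> alg X" "\<And>is. partials is f = (\<lambda>x. g is x * f x)" by metis
  have "partials is f differentiable at x" for "is" x
    unfolding g(2) using alg_partials(2)[OF X1 X2 g(1), of "[]"] differentiableI[OF Df] by auto
  then show "(\<lambda>x :: real^'n. complex_of_real (power_weight q \<sigma> x)) \<in> smooth_functions"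
    unfolding f_def[abs_def] by (simp add: smooth_functions_def differentiable_on_def)
  have "\<exists>C\<ge>0. \<forall>x. cmod (g is x) \<le> C" for "is"
    using B_space_cmod[of "g is"] g(1) B by (metis subsetD)
  then obtain C where C: "\<And>is. 0 \<le> C is" "\<And>is x. cmod (g is x) \<le> C is" by metis
  have "jet N f x \<le> (\<Sum>is | length is \<le> N. C is) * power_weight q \<sigma> x" for x
    unfolding jet_def sum_distrib_right
  proof (rule sum_mono)
    fix "is" :: "'n list"
    have "cmod (partials is f x) = cmod (g is x) * power_weight q \<sigma> x"
      unfolding g(2) by (simp add: norm_mult f_def power_weight_def)
    also have "\<dots> \<le> C is * power_weight q \<sigma> x"
      by (intro mult_right_mono C) (simp add: power_weight_def)
    finally show "cmod (partials is f x) \<le> C is * power_weight q \<sigma> x" .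
  qed
  then show "\<exists>C\<ge>0. \<forall>x :: real^'n. jet N (\<lambda>x. complex_of_real (power_weight q \<sigma> x)) x \<le> C * power_weight q \<sigma> x"
    unfolding f_def[abs_def] using C(1) by (intro exI[of _ "\<Sum>is | length is \<le> N. C is"]) (auto intro: sum_nonneg)
qed

lemma nn_integral_Gamma_scaled:
  assumes "\<sigma> > 0" "c > (0::real)"
  shows "(\<integral>\<^sup>+t. ennreal (indicator {0..} t * t powr (\<sigma> - 1) * exp (- (c * t))) \<partial>lborel) = ennreal (Gamma \<sigma> * c powr (- \<sigma>))"
proof -
  let ?J = "\<integral>\<^sup>+t. ennreal (indicator {0..} t * t powr (\<sigma> - 1) * exp (- (c * t))) \<partial>lborel"
  have "ennreal (Gamma \<sigma>) = (\<integral>\<^sup>+t. ennreal (indicator {0..} t * t powr (\<sigma> - 1) / exp t) \<partial>lborel)"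
    by (rule Gamma_conv_nn_integral_real[OF assms(1)])
  also have "\<dots> = ennreal c * (\<integral>\<^sup>+t. ennreal (indicator {0..} (0 + c * t) * (0 + c * t) powr (\<sigma> - 1) / exp (0 + c * t)) \<partial>lborel)"
    using assms(2) by (subst nn_integral_real_affine[where c=c and t=0]) auto
  also have "(\<integral>\<^sup>+t. ennreal (indicator {0..} (0 + c * t) * (0 + c * t) powr (\<sigma> - 1) / exp (0 + c * t)) \<partial>lborel) =
      (\<integral>\<^sup>+t. ennreal (c powr (\<sigma> - 1)) * ennreal (indicator {0..} t * t powr (\<sigma> - 1) * exp (- (c * t))) \<partial>lborel)"
    using assms(2) by (intro nn_integral_cong)
      (auto simp: indicator_def zero_le_mult_iff powr_mult exp_minus divide_inverse ennreal_mult'[symmetric] mult_ac)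
  also have "\<dots> = ennreal (c powr (\<sigma> - 1)) * ?J" by (rule nn_integral_cmult) simp
  also have "ennreal c * (ennreal (c powr (\<sigma> - 1)) * ?J) = ennreal (c powr \<sigma>) * ?J"
    using assms(2) by (simp add: mult.assoc[symmetric] ennreal_mult'[symmetric] powr_diff)
  finally have "ennreal (c powr (- \<sigma>)) * ennreal (Gamma \<sigma>) = ennreal (c powr (- \<sigma>)) * (ennreal (c powr \<sigma>) * ?J)"
    by simp
  also have "\<dots> = ?J"
    using assms(2) by (simp add: mult.assoc[symmetric] ennreal_mult'[symmetric] powr_add[symmetric])
  finally have "ennreal (c powr (- \<sigma>)) * ennreal (Gamma \<sigma>) = ?J" .
  moreover have "ennreal (Gamma \<sigma> * c powr (- \<sigma>)) = ennreal (c powr (- \<sigma>)) * ennreal (Gamma \<sigma>)"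
    by (subst mult.commute, subst ennreal_mult') auto
  ultimately show ?thesis by simp
qed

lemma nn_integral_gaussian_1:
  assumes "t > (0::real)"
  shows "(\<integral>\<^sup>+z. ennreal (exp (- (t * z\<^sup>2))) \<partial>lborel) = ennreal (sqrt (pi / t))"
proof -
  define \<sigma> where "\<sigma> = sqrt (1 / (2 * t))"
  have \<sigma>: "\<sigma> > 0" "\<sigma>\<^sup>2 = 1 / (2 * t)" using assms by (auto simp: \<sigma>_def)
  have "exp (- (t * z\<^sup>2)) = sqrt (pi / t) * normal_density 0 \<sigma> z" for z
    unfolding normal_density_def \<sigma>(2) using assms by (simp add: real_sqrt_divide field_simps)
  then have "(\<integral>\<^sup>+z. ennreal (exp (- (t * z\<^sup>2))) \<partial>lborel) = (\<integral>\<^sup>+z. ennreal (sqrt (pi / t)) * ennreal (normal_density 0 \<sigma> z) \<partial>lborel)"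
    using assms by (simp add: ennreal_mult'[symmetric])
  also have "\<dots> = ennreal (sqrt (pi / t)) * (\<integral>\<^sup>+z. ennreal (normal_density 0 \<sigma> z) \<partial>lborel)"
    by (rule nn_integral_cmult) simp
  also have "(\<integral>\<^sup>+z. ennreal (normal_density 0 \<sigma> z) \<partial>lborel) = 1"
    using \<sigma>(1) by (subst nn_integral_eq_integral) (auto simp: integral_normal_density integrable_normal_density)
  finally show ?thesis by simp
qed

lemma nn_integral_gaussian:
  assumes "t > (0::real)"
  shows "(\<integral>\<^sup>+x. ennreal (exp (- (t * (norm (x :: real^'n::finite))\<^sup>2))) \<partial>lborel) = ennreal ((pi / t) powr (real CARD('n) / 2))"
proof -
  have "(\<integral>\<^sup>+x. ennreal (exp (- (t * (norm (x :: real^'n))\<^sup>2))) \<partial>lborel) =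
      (\<integral>\<^sup>+x. (\<Prod>b\<in>Basis. ennreal (exp (- (t * ((x :: real^'n) \<bullet> b)\<^sup>2)))) \<partial>lborel)"
  proof (rule nn_integral_cong)
    fix x :: "real^'n"
    have "(norm x)\<^sup>2 = (\<Sum>b\<in>Basis. (x \<bullet> b)\<^sup>2)"
      by (subst power2_norm_eq_inner, subst euclidean_inner) (simp add: power2_eq_square)
    then show "ennreal (exp (- (t * (norm x)\<^sup>2))) = (\<Prod>b\<in>Basis. ennreal (exp (- (t * (x \<bullet> b)\<^sup>2))))"
      by (simp add: prod_ennreal exp_sum[symmetric] sum_distrib_left sum_negf[symmetric])
  qed
  also have "\<dots> = (\<Prod>b\<in>(Basis :: (real^'n) set). (\<integral>\<^sup>+z. ennreal (exp (- (t * z\<^sup>2))) \<partial>lborel))"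
    by (rule nn_integral_lborel_prod) auto
  also have "\<dots> = ennreal (sqrt (pi / t) ^ CARD('n))"
    using assms by (simp add: nn_integral_gaussian_1 prod_constant ennreal_power)
  also have "sqrt (pi / t) ^ CARD('n) = (pi / t) powr (real CARD('n) / 2)"
    using assms by (simp add: powr_half_sqrt[symmetric] powr_powr powr_realpow[symmetric])
  finally show ?thesis .
qed

text \<open>Write \<open>(q + |x|\<^sup>2)\<^sup>-\<^sup>\<sigma>\<close> as a Gamma integral over Gaussians and exchange the integrals.\<close>

lemma has_integral_power_weight:
  assumes q: "q > 0" and \<sigma>: "\<sigma> > real CARD('n) / 2"
  shows "has_bochner_integral lborel (\<lambda>x :: real^'n::finite. power_weight q (- \<sigma>) x)
    (pi powr (real CARD('n) / 2) * Gamma (\<sigma> - real CARD('n) / 2) / Gamma \<sigma> * q powr (real CARD('n) / 2 - \<sigma>))"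
proof (rule has_bochner_integral_nn_integral)
  let ?m = "real CARD('n) / 2"
  have \<sigma>0: "\<sigma> > 0" using \<sigma> by (smt (verit) of_nat_0_le_iff zero_le_divide_iff)
  have G0: "Gamma \<sigma> > 0" "Gamma (\<sigma> - ?m) > 0" using \<sigma>0 \<sigma> by (auto intro: Gamma_real_pos)
  show meas: "(\<lambda>x :: real^'n. power_weight q (- \<sigma>) x) \<in> borel_measurable lborel"
    unfolding power_weight_def by measurable
  show "AE x in lborel. 0 \<le> power_weight q (- \<sigma>) (x :: real^'n)" by (simp add: power_weight_def)
  show "0 \<le> pi powr ?m * Gamma (\<sigma> - ?m) / Gamma \<sigma> * q powr (?m - \<sigma>)" using G0 by simp
  let ?g = "\<lambda>t. ennreal (indicator {0..} t * t powr (\<sigma> - 1) * exp (- (q * t)))"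
  have "ennreal (Gamma \<sigma>) * (\<integral>\<^sup>+x. ennreal (power_weight q (- \<sigma>) (x :: real^'n)) \<partial>lborel) =
      (\<integral>\<^sup>+x. ennreal (Gamma \<sigma> * power_weight q (- \<sigma>) (x :: real^'n)) \<partial>lborel)"
    using meas G0 by (subst nn_integral_cmult[symmetric]) (auto simp: ennreal_mult')
  also have "\<dots> = (\<integral>\<^sup>+x. (\<integral>\<^sup>+t. ennreal (indicator {0..} t * t powr (\<sigma> - 1) * exp (- ((q + (norm (x :: real^'n))\<^sup>2) * t))) \<partial>lborel) \<partial>lborel)"
    unfolding power_weight_def using q \<sigma>0 by (intro nn_integral_cong nn_integral_Gamma_scaled[symmetric]) (auto simp: add_pos_nonneg)
  also have "\<dots> = (\<integral>\<^sup>+x. (\<integral>\<^sup>+t. ?g t * ennreal (exp (- (t * (norm (x :: real^'n))\<^sup>2))) \<partial>lborel) \<partial>lborel)"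
    by (intro nn_integral_cong) (auto simp: ennreal_mult'[symmetric] exp_add[symmetric] algebra_simps indicator_def)
  also have "\<dots> = (\<integral>\<^sup>+t. (\<integral>\<^sup>+x. ?g t * ennreal (exp (- (t * (norm (x :: real^'n))\<^sup>2))) \<partial>lborel) \<partial>lborel)"
    by (rule lborel_pair.Fubini'[symmetric]) measurable
  also have "\<dots> = (\<integral>\<^sup>+t. ?g t * (\<integral>\<^sup>+x. ennreal (exp (- (t * (norm (x :: real^'n))\<^sup>2))) \<partial>lborel) \<partial>lborel)"
    by (intro nn_integral_cong nn_integral_cmult) measurable
  also have "\<dots> = (\<integral>\<^sup>+t. ennreal (pi powr ?m) * ennreal (indicator {0..} t * t powr (\<sigma> - ?m - 1) * exp (- (q * t))) \<partial>lborel)"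
  proof (rule nn_integral_cong)
    fix t :: real
    show "?g t * (\<integral>\<^sup>+x. ennreal (exp (- (t * (norm (x :: real^'n))\<^sup>2))) \<partial>lborel) =
        ennreal (pi powr ?m) * ennreal (indicator {0..} t * t powr (\<sigma> - ?m - 1) * exp (- (q * t)))"
    proof (cases "t > 0")
      case True
      have "t powr (\<sigma> - 1) * (pi / t) powr ?m = pi powr ?m * t powr (\<sigma> - ?m - 1)"
        using True by (simp add: powr_divide powr_diff mult_ac)
      then show ?thesis
        using True by (simp add: nn_integral_gaussian ennreal_mult'[symmetric] mult_ac) 
    qed (auto simp: indicator_def)
  qed
  also have "\<dots> = ennreal (pi powr ?m) * ennreal (Gamma (\<sigma> - ?m) * q powr (- (\<sigma> - ?m)))"
    using q \<sigma> by (subst nn_integral_cmult) (auto simp: nn_integral_Gamma_scaled)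
  finally have eq: "ennreal (Gamma \<sigma>) * (\<integral>\<^sup>+x. ennreal (power_weight q (- \<sigma>) (x :: real^'n)) \<partial>lborel) =
      ennreal (pi powr ?m) * ennreal (Gamma (\<sigma> - ?m) * q powr (- (\<sigma> - ?m)))" .
  have one: "ennreal (inverse (Gamma \<sigma>)) * ennreal (Gamma \<sigma>) = 1"
    using G0 by (subst ennreal_mult'[symmetric]) auto
  have "(\<integral>\<^sup>+x. ennreal (power_weight q (- \<sigma>) (x :: real^'n)) \<partial>lborel) =
      ennreal (inverse (Gamma \<sigma>)) * (ennreal (pi powr ?m) * ennreal (Gamma (\<sigma> - ?m) * q powr (- (\<sigma> - ?m))))"
    unfolding eq[symmetric] mult.assoc[symmetric] one by simp
  also have "\<dots> = ennreal (inverse (Gamma \<sigma>) * (pi powr ?m * (Gamma (\<sigma> - ?m) * q powr (- (\<sigma> - ?m)))))"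
  proof -
    have "ennreal a * (ennreal b * ennreal c) = ennreal (a * (b * c))" if "0 \<le> a" "0 \<le> b" for a b c
      using that by (simp add: ennreal_mult')
    then show ?thesis using G0 by simp
  qed
  also have "inverse (Gamma \<sigma>) * (pi powr ?m * (Gamma (\<sigma> - ?m) * q powr (- (\<sigma> - ?m)))) =
      pi powr ?m * Gamma (\<sigma> - ?m) / Gamma \<sigma> * q powr (?m - \<sigma>)"
    by (simp only: divide_inverse[of _ "Gamma \<sigma>"] minus_diff_eq mult_ac)
  finally show "(\<integral>\<^sup>+x. ennreal (power_weight q (- \<sigma>) (x :: real^'n)) \<partial>lborel) =
      ennreal (pi powr ?m * Gamma (\<sigma> - ?m) / Gamma \<sigma> * q powr (?m - \<sigma>))" .
qed

lemma weight_eq_power_weight: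
  "weight \<alpha> (x :: real^'n::finite) = power_weight 1 ((\<alpha> + real CARD('n) + 1) / 2) x"
  by (simp add: weight_def power_weight_def)

lemma inverse_weight_eq_power_weight:
  "inverse (weight \<alpha> (x :: real^'n::finite)) = power_weight 1 (- ((\<alpha> + real CARD('n) + 1) / 2)) x"
  by (simp add: weight_def power_weight_def powr_minus)

lemma norm_add_square_bound:
  fixes x h :: "'a::real_normed_vector"
  shows "1 + (norm (x + h))\<^sup>2 \<le> 4 * max (1 + (norm x)\<^sup>2) (1 + (norm h)\<^sup>2)"
proof -
  have "(norm (x + h))\<^sup>2 \<le> (norm x + norm h)\<^sup>2" by (intro power_mono norm_triangle_ineq) auto
  also have "\<dots> \<le> 2 * (norm x)\<^sup>2 + 2 * (norm h)\<^sup>2"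
    using sum_squares_bound[of "norm x" "norm h"] by (simp add: power2_sum)
  finally have *: "(norm (x + h))\<^sup>2 \<le> 2 * (norm x)\<^sup>2 + 2 * (norm h)\<^sup>2" .
  define m where "m = max (1 + (norm x)\<^sup>2) (1 + (norm h)\<^sup>2)"
  have "1 + (norm x)\<^sup>2 \<le> m" "1 + (norm h)\<^sup>2 \<le> m" by (auto simp: m_def)
  then have "1 + (norm (x + h))\<^sup>2 \<le> 4 * m" using * zero_le_power2[of "norm x"] by linarith
  then show ?thesis by (simp only: m_def)
qed

text \<open>With \<open>1 + |x + h|\<^sup>2 \<le> 4 max (1 + |x|\<^sup>2) (1 + |h|\<^sup>2)\<close> and monotonicity of powers, the constant \<open>4\<^sup>s\<close>
  serves for both inequalities of the weight. The exponent \<open>s\<close> exceeds half the dimension because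
  \<open>\<alpha> > - 1\<close>, which makes \<open>1 / w\<close> integrable.\<close>

lemma weight_smooth_weight:
  assumes \<alpha>: "\<alpha> > -1"
  defines "s \<equiv> (\<alpha> + real CARD('n) + 1) / 2"
  shows "smooth_weight (weight \<alpha> :: real^'n::finite \<Rightarrow> real) (4 powr s) (nat \<lceil>s\<rceil>)"
proof
  fix x h k :: "real^'n" and N
  have s: "s > real CARD('n) / 2" "s > 0" using \<alpha> by (auto simp: s_def add_pos_nonneg)
  have w: "weight \<alpha> x = (1 + (norm x)\<^sup>2) powr s" for x :: "real^'n" by (simp add: weight_def s_def)
  show "1 \<le> weight \<alpha> x" unfolding w using s by (intro ge_one_powr_ge_zero) auto
  show "(\<lambda>x. complex_of_real (weight \<alpha> x)) \<in> smooth_functions"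
    "\<exists>C\<ge>0. \<forall>x. jet N (\<lambda>x. complex_of_real (weight \<alpha> x)) x \<le> C * weight \<alpha> x"
    unfolding weight_eq_power_weight by (rule power_weight_jet; simp)+
  show "(\<lambda>x. complex_of_real (inverse (weight \<alpha> x))) \<in> smooth_functions"
    "\<exists>C\<ge>0. \<forall>x. jet N (\<lambda>x. complex_of_real (inverse (weight \<alpha> x))) x \<le> C * inverse (weight \<alpha> x)"
    unfolding inverse_weight_eq_power_weight by (rule power_weight_jet; simp)+
  have "(1 + (norm (x + h))\<^sup>2) powr s \<le> (4 * max (1 + (norm x)\<^sup>2) (1 + (norm h)\<^sup>2)) powr s"
    using s by (intro powr_mono2 norm_add_square_bound) auto
  also have "\<dots> = 4 powr s * max (1 + (norm x)\<^sup>2) (1 + (norm h)\<^sup>2) powr s"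
    by (subst powr_mult) auto
  also have "\<dots> \<le> 4 powr s * (weight \<alpha> x + weight \<alpha> h)"
    unfolding w by (intro mult_left_mono) (auto simp: max_def)
  finally show "weight \<alpha> (x + h) \<le> 4 powr s * (weight \<alpha> x + weight \<alpha> h)" unfolding w .
  show "weight \<alpha> k \<le> 4 powr s * weight \<alpha> h" if "norm k \<le> 2 * norm h"
  proof -
    have "(norm k)\<^sup>2 \<le> (2 * norm h)\<^sup>2" using that by (intro power_mono) auto
    then have "(1 + (norm k)\<^sup>2) powr s \<le> (4 * (1 + (norm h)\<^sup>2)) powr s"
      using s by (intro powr_mono2) (auto simp: power_mult_distrib)
    then show ?thesis unfolding w by (subst (asm) powr_mult) auto
  qed
  show "integrable lborel (\<lambda>x :: real^'n. inverse (weight \<alpha> x))"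
    unfolding inverse_weight_eq_power_weight
    using has_integral_power_weight[of 1 s, where 'n='n] s(1)
    by (auto simp: has_bochner_integral_iff s_def)
  have "(1 + (norm x)\<^sup>2) powr s \<le> (1 + (norm x)\<^sup>2) powr real (nat \<lceil>s\<rceil>)"
    using s by (intro powr_mono) (auto simp: real_nat_ceiling_ge)
  then show "weight \<alpha> x \<le> (1 + (norm x)\<^sup>2) ^ nat \<lceil>s\<rceil>"
    unfolding w by (subst (asm) powr_realpow) (auto simp: add_pos_nonneg)
qed

text \<open>The type argument carries the dimension.\<close>

definition poisson_const :: "real \<Rightarrow> 'n::finite itself \<Rightarrow> real" where
  "poisson_const \<alpha> _ = Gamma ((\<alpha> + real CARD('n) + 1) / 2) / (Gamma ((\<alpha> + 1) / 2) * pi powr (real CARD('n) / 2))"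

lemma poisson_const_pos: "\<alpha> > -1 \<Longrightarrow> poisson_const \<alpha> TYPE('n::finite) > 0"
  by (auto simp: poisson_const_def add_pos_nonneg intro!: divide_pos_pos mult_pos_pos Gamma_real_pos)

lemma poisson_kernel_eq:
  "poisson_kernel \<alpha> y (x :: real^'n::finite) =
     poisson_const \<alpha> TYPE('n) * y powr (\<alpha> + 1) * power_weight (y\<^sup>2) (- ((\<alpha> + real CARD('n) + 1) / 2)) x"
  unfolding poisson_kernel_def poisson_const_def power_weight_def powr_minus
  by (simp only: add.commute[of "y\<^sup>2"] divide_inverse[of "y powr (\<alpha> + 1)"] mult.assoc)

lemma poisson_kernel_even: "poisson_kernel \<alpha> y (- x) = poisson_kernel \<alpha> y x"
  by (simp add: poisson_kernel_def)

lemma poisson_kernel_nonneg: "\<alpha> > -1 \<Longrightarrow> 0 \<le> poisson_kernel \<alpha> y (x :: real^'n::finite)"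
  unfolding poisson_kernel_eq using poisson_const_pos[of \<alpha>, where 'n='n] by (simp add: power_weight_def)

lemma poisson_kernel_integral:
  assumes \<alpha>: "\<alpha> > -1" and y: "y > 0"
  shows "has_bochner_integral lborel (\<lambda>x :: real^'n::finite. poisson_kernel \<alpha> y x) 1"
proof -
  let ?s = "(\<alpha> + real CARD('n) + 1) / 2" and ?m = "real CARD('n) / 2"
  have s: "?s > ?m" "?s - ?m = (\<alpha> + 1) / 2" "?m - ?s = - ((\<alpha> + 1) / 2)" using \<alpha> by (auto simp: field_simps)
  have G: "Gamma ?s > 0" "Gamma ((\<alpha> + 1) / 2) > 0"
    using \<alpha> by (auto intro!: Gamma_real_pos simp: add_pos_nonneg)
  have "(y\<^sup>2) powr (- ((\<alpha> + 1) / 2)) = (y powr 2) powr (- ((\<alpha> + 1) / 2))"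
    using y by (simp add: powr_numeral)
  also have "\<dots> = y powr (- (\<alpha> + 1))"
    unfolding powr_powr by (rule arg_cong[where f="\<lambda>t. y powr t"]) (simp add: field_simps)
  finally have y2: "(y\<^sup>2) powr (- ((\<alpha> + 1) / 2)) = inverse (y powr (\<alpha> + 1))" by (simp only: powr_minus)
  have cancel: "a / (b * p) * r * (p * b / a * inverse r) = 1" if "a > 0" "b > 0" "p > 0" "r > 0" for a b p r :: real
    using that by (simp add: field_simps)
  have "poisson_const \<alpha> TYPE('n) * y powr (\<alpha> + 1) *
      (pi powr ?m * Gamma (?s - ?m) / Gamma ?s * (y\<^sup>2) powr (?m - ?s)) = 1"
    unfolding s(2,3) poisson_const_def y2 using G y by (intro cancel) auto
  moreover have "has_bochner_integral lborel (\<lambda>x :: real^'n. poisson_const \<alpha> TYPE('n) * y powr (\<alpha> + 1) * power_weight (y\<^sup>2) (- ?s) x)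
      (poisson_const \<alpha> TYPE('n) * y powr (\<alpha> + 1) * (pi powr ?m * Gamma (?s - ?m) / Gamma ?s * (y\<^sup>2) powr (?m - ?s)))"
    using y s(1) by (intro has_bochner_integral_mult_right has_integral_power_weight) auto
  ultimately show ?thesis unfolding poisson_kernel_eq by (simp only:)
qed

lemma poisson_kernel_smooth:
  assumes y: "y > 0"
  shows "(\<lambda>x :: real^'n::finite. complex_of_real (poisson_kernel \<alpha> y x)) \<in> smooth_functions"
  unfolding poisson_kernel_eq of_real_mult[of "_ * _"]
  by (rule smooth_functions_linear(2)[OF power_weight_jet(1) power_weight_jet(1)]) (use y in simp_all)

text \<open>For fixed \<open>y\<close> the kernel is comparable with \<open>1 / w\<close>, so it belongs to \<open>w\<^sup>-\<^sup>1 B\<close>.\<close>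

lemma poisson_kernel_jet:
  assumes \<alpha>: "\<alpha> > -1" and y: "y > 0"
  shows "\<exists>C\<ge>0. \<forall>x :: real^'n::finite. weight \<alpha> x * jet N (\<lambda>x. complex_of_real (poisson_kernel \<alpha> y x)) x \<le> C"
proof -
  let ?s = "(\<alpha> + real CARD('n) + 1) / 2"
  let ?c = "poisson_const \<alpha> TYPE('n) * y powr (\<alpha> + 1)"
  have s: "?s > 0" using \<alpha> by (simp add: add_pos_nonneg)
  have y2: "y\<^sup>2 > 0" using y by simp
  have c: "?c \<ge> 0" using poisson_const_pos[OF \<alpha>, where 'n='n] by simp
  obtain C where C: "C \<ge> 0" "\<And>x :: real^'n. jet N (\<lambda>x. complex_of_real (power_weight (y\<^sup>2) (- ?s) x)) x \<le> C * power_weight (y\<^sup>2) (- ?s) x"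
    using power_weight_jet(2)[OF y2] by metis
  define m where "m = max 1 (1 / y\<^sup>2)"
  have m: "m \<ge> 1" "m * y\<^sup>2 \<ge> 1" using y2 by (auto simp: m_def max_def field_simps)
  have "weight \<alpha> x * jet N (\<lambda>x. complex_of_real (poisson_kernel \<alpha> y x)) x \<le> ?c * C * m powr ?s" for x :: "real^'n"
  proof -
    have "jet N (\<lambda>x. complex_of_real (poisson_kernel \<alpha> y x)) x = ?c * jet N (\<lambda>x. complex_of_real (power_weight (y\<^sup>2) (- ?s) x)) x"
      unfolding poisson_kernel_eq of_real_mult[of "_ * _"] using c
      by (subst jet_scale[OF power_weight_jet(1)[OF y2]]) (simp only: norm_of_real abs_of_nonneg)
    also have "\<dots> \<le> ?c * (C * power_weight (y\<^sup>2) (- ?s) x)" by (intro mult_left_mono C c)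
    finally have "weight \<alpha> x * jet N (\<lambda>x. complex_of_real (poisson_kernel \<alpha> y x)) x \<le> weight \<alpha> x * (?c * (C * power_weight (y\<^sup>2) (- ?s) x))"
      by (intro mult_left_mono) (simp_all add: weight_def)
    also have "\<dots> = ?c * C * (weight \<alpha> x * power_weight (y\<^sup>2) (- ?s) x)" by (simp add: mult_ac)
    also have "\<dots> \<le> ?c * C * m powr ?s"
    proof (rule mult_left_mono)
      have pos: "y\<^sup>2 + (norm x)\<^sup>2 > 0" using y2 by (simp add: add_pos_nonneg)
      have "1 + (norm x)\<^sup>2 \<le> m * (y\<^sup>2 + (norm x)\<^sup>2)"
        using m mult_right_mono[OF m(1), of "(norm x)\<^sup>2"] by (simp add: distrib_left)
      then have "weight \<alpha> x \<le> (m * (y\<^sup>2 + (norm x)\<^sup>2)) powr ?s"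
        unfolding weight_def using s by (intro powr_mono2) auto
      also have "\<dots> = m powr ?s * power_weight (y\<^sup>2) ?s x"
        using m pos by (simp add: powr_mult power_weight_def)
      finally have "weight \<alpha> x * power_weight (y\<^sup>2) (- ?s) x \<le> m powr ?s * power_weight (y\<^sup>2) ?s x * power_weight (y\<^sup>2) (- ?s) x"
        by (intro mult_right_mono) (simp_all add: power_weight_def)
      also have "\<dots> = m powr ?s"
      proof -
        have "power_weight (y\<^sup>2) ?s x * power_weight (y\<^sup>2) (- ?s) x = 1"
          using power_weight_pos[OF y2, of ?s x] by (simp add: power_weight_def powr_minus)
        then show ?thesis by (simp add: mult.assoc)
      qed
      finally show "weight \<alpha> x * power_weight (y\<^sup>2) (- ?s) x \<le> m powr ?s" .
      show "0 \<le> ?c * C" using c C(1) by (rule mult_nonneg_nonneg)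
    qed
    finally show ?thesis .
  qed
  then show ?thesis using c C(1) by (intro exI[of _ "?c * C * m powr ?s"]) auto
qed

text \<open>For \<open>|h| \<ge> d\<close> the quotient \<open>(1 + |h|\<^sup>2) / (y\<^sup>2 + |h|\<^sup>2)\<close> is at most \<open>2 / d\<^sup>2\<close>, whatever \<open>y\<close> is, so
  the kernel is small like \<open>y\<^bsup>\<alpha>+1\<^esup>\<close> relative to \<open>1 / w\<close>.\<close>

lemma poisson_kernel_off_origin:
  assumes \<alpha>: "\<alpha> > -1" and d: "0 < d" "d \<le> 1"
  shows "\<exists>C\<ge>0. \<forall>y>0. \<forall>h :: real^'n::finite. d \<le> norm h \<longrightarrow>
    poisson_kernel \<alpha> y h \<le> C * y powr (\<alpha> + 1) * inverse (weight \<alpha> h)"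
proof -
  let ?s = "(\<alpha> + real CARD('n) + 1) / 2"
  let ?c = "poisson_const \<alpha> TYPE('n)"
  have s: "?s > 0" using \<alpha> by (simp add: add_pos_nonneg)
  have c: "?c \<ge> 0" using poisson_const_pos[OF \<alpha>, where 'n='n] by simp
  have "poisson_kernel \<alpha> y h \<le> (?c * (2 / d\<^sup>2) powr ?s) * y powr (\<alpha> + 1) * inverse (weight \<alpha> h)"
    if y: "y > 0" and h: "d \<le> norm h" for y and h :: "real^'n"
  proof -
    have d2: "d\<^sup>2 \<le> (norm h)\<^sup>2" "d\<^sup>2 \<le> 1" "0 < d\<^sup>2"
      using d h power_mono[of d "norm h" 2] power_mono[of d 1 2] by auto
    have "d\<^sup>2 * (norm h)\<^sup>2 \<le> (norm h)\<^sup>2" using mult_right_mono[OF d2(2), of "(norm h)\<^sup>2"] by simp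
    then have "1 + (norm h)\<^sup>2 \<le> (2 / d\<^sup>2) * (y\<^sup>2 + (norm h)\<^sup>2)"
      using d2 y by (simp add: field_simps add_increasing)
    then have "weight \<alpha> h \<le> ((2 / d\<^sup>2) * (y\<^sup>2 + (norm h)\<^sup>2)) powr ?s"
      unfolding weight_def using s by (intro powr_mono2) auto
    also have "\<dots> = (2 / d\<^sup>2) powr ?s * power_weight (y\<^sup>2) ?s h"
      by (subst powr_mult) (simp_all add: power_weight_def)
    finally have *: "weight \<alpha> h \<le> (2 / d\<^sup>2) powr ?s * power_weight (y\<^sup>2) ?s h" .
    have wp: "weight \<alpha> h > 0" unfolding weight_eq_power_weight by (rule power_weight_pos) simp
    have pp: "power_weight (y\<^sup>2) ?s h > 0" using y by (intro power_weight_pos) simp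
    have "power_weight (y\<^sup>2) (- ?s) h = inverse (power_weight (y\<^sup>2) ?s h)" by (simp add: power_weight_def powr_minus)
    also have "\<dots> \<le> (2 / d\<^sup>2) powr ?s * inverse (weight \<alpha> h)" using * wp pp by (simp add: field_simps)
    finally have "?c * y powr (\<alpha> + 1) * power_weight (y\<^sup>2) (- ?s) h \<le> ?c * y powr (\<alpha> + 1) * ((2 / d\<^sup>2) powr ?s * inverse (weight \<alpha> h))"
      using c by (intro mult_left_mono) auto
    then show ?thesis unfolding poisson_kernel_eq by (simp add: mult_ac)
  qed
  then show ?thesis using c by (intro exI[of _ "?c * (2 / d\<^sup>2) powr ?s"]) auto
qed

section \<open>The S'-convolution with a decaying kernel\<close>

context smooth_weight
begin

lemma decaying_partials:
  assumes "c \<in> decaying"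
  shows "partials js c \<in> decaying"
proof -
  have "\<exists>C. \<forall>x. w x * jet N (partials js c) x \<le> C" for N
  proof -
    let ?K = "real (card {is :: 'n list. length is \<le> N})"
    obtain M where M: "M \<ge> 0" "\<And>x. w x * jet (N + length js) c x \<le> M" using decaying_jet[OF assms] by metis
    have "w x * jet N (partials js c) x \<le> ?K * M" for x
    proof -
      have "w x * jet N (partials js c) x \<le> w x * (?K * jet (N + length js) c x)"
        by (intro mult_left_mono jet_partials) simp
      also have "\<dots> = ?K * (w x * jet (N + length js) c x)" by simp
      also have "\<dots> \<le> ?K * M" by (intro mult_left_mono M) simp
      finally show ?thesis .
    qed
    then show ?thesis by blast
  qed
  then show ?thesis using smooth_partials[OF decaying_smooth[OF assms]] by (simp add: decaying_def)
qed

text \<open>Pairing a form with the translates of a test function gives a smooth function, by Taylor's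
  formula in the norm that controls the form.\<close>

lemma translate_derivative:
  assumes L: "bounded_form N C L" and c: "c \<in> decaying"
  shows "((\<lambda>h. L (mult_w (translate (- h) c))) has_derivative
    (\<lambda>k. \<Sum>i\<in>UNIV. (k $ i) *\<^sub>R L (mult_w (translate (- h) (partial i c))))) (at h)"
proof -
  note lin = bounded_form_linear[OF L]
  obtain D where D: "D \<ge> 0" "\<forall>c\<in>decaying. \<forall>M. (\<forall>x. w x * jet N c x \<le> M) \<longrightarrow> cmod (L (mult_w c)) \<le> D * M"
    using bounded_form_mult_w[OF L] by blast
  obtain E where E: "E \<ge> 0" "\<forall>f\<in>smooth_functions. \<forall>(x :: real^'n) v M.
     (\<forall>t. 0 \<le> t \<and> t \<le> 1 \<longrightarrow> jet (N + 2) f (x + t *\<^sub>R v) \<le> M) \<longrightarrow>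
     jet N (\<lambda>z. f (z + v) - f z - (\<Sum>i\<in>UNIV. of_real (v $ i) * partial i f z)) x \<le> E * (M * norm v ^ 2)"
    using jet_taylor[of N] by blast
  obtain M where M: "M \<ge> 0" "\<And>x. w x * jet (N + 2) c x \<le> M" using decaying_jet[OF c] by metis
  have pc: "partial i c \<in> decaying" for i using decaying_partials[OF c, of "[i]"] by simp
  show ?thesis
  proof (rule has_derivative_quadratic_remainder)
    show "bounded_linear (\<lambda>k :: real^'n. \<Sum>i\<in>UNIV. (k $ i) *\<^sub>R L (mult_w (translate (- h) (partial i c))))"
      by (intro bounded_linear_sum bounded_linear_scaleR_const bounded_linear_vec_nth)
    fix k :: "real^'n" assume k: "norm k \<le> 1"
    define r where "r = (\<lambda>z. c (z + k) - c z - (\<Sum>i\<in>UNIV. of_real (k $ i) * partial i c z))"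
    define S where "S = (\<lambda>z. \<Sum>i\<in>UNIV. of_real (k $ i) * translate (- h) (partial i c) z)"
    have mwS: "mult_w S = (\<lambda>x. \<Sum>i\<in>UNIV. of_real (k $ i) * mult_w (translate (- h) (partial i c)) x)"
      by (simp add: mult_w_def S_def fun_eq_iff sum_distrib_left mult_ac)
    have S: "S \<in> decaying" "L (mult_w S) = (\<Sum>i\<in>UNIV. of_real (k $ i) * L (mult_w (translate (- h) (partial i c))))"
      unfolding decaying_iff mwS
      using linear_form_B_space_sum[OF lin, of UNIV "\<lambda>i. mult_w (translate (- h) (partial i c))" "\<lambda>i. of_real (k $ i)"]
      by (auto intro: decaying_mult_w decaying_translate pc)
    have d1: "(\<lambda>x. translate (- (h + k)) c x - translate (- h) c x) \<in> decaying"
      by (intro linear_form_mult_w_diff[OF lin] decaying_translate c)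
    have r_eq: "translate (- h) r = (\<lambda>x. (translate (- (h + k)) c x - translate (- h) c x) - S x)"
      by (simp add: r_def S_def translate_def fun_eq_iff algebra_simps)
    have r_dec: "translate (- h) r \<in> decaying"
      unfolding r_eq by (rule linear_form_mult_w_diff[OF lin d1 S(1)])
    have "w x * jet N (translate (- h) r) x \<le> E * (2 * A * near_const * w (- h) * M) * norm k ^ 2" for x
    proof -
      define M' where "M' = 2 * A * near_const * w (- h) * M / w x"
      have "jet (N + 2) c (x + h + t *\<^sub>R k) \<le> M'" if "0 \<le> t" "t \<le> 1" for t
        using segment_jet[of "N + 2" c M k t x "- h"] M(2) k that by (simp add: M'_def)
      then have "jet N r (x + h) \<le> E * (M' * norm k ^ 2)"
        unfolding r_def by (intro E(2)[rule_format, OF decaying_smooth[OF c]]) auto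
      then have "w x * jet N (translate (- h) r) x \<le> w x * (E * (M' * norm k ^ 2))"
        by (intro mult_left_mono) (simp_all add: jet_translate)
      then show ?thesis by (simp add: M'_def field_simps)
    qed
    then have "cmod (L (mult_w (translate (- h) r))) \<le> D * (E * (2 * A * near_const * w (- h) * M) * norm k ^ 2)"
      by (intro D(2)[rule_format] r_dec)
    moreover have "L (mult_w (translate (- h) r)) = L (mult_w (translate (- (h + k)) c)) - L (mult_w (translate (- h) c)) -
        (\<Sum>i\<in>UNIV. (k $ i) *\<^sub>R L (mult_w (translate (- h) (partial i c))))"
      unfolding r_eq by (simp add: linear_form_mult_w_diff[OF lin] d1 S decaying_translate c scaleR_conv_of_real)
    ultimately show "cmod (L (mult_w (translate (- (h + k)) c)) - L (mult_w (translate (- h) c)) -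
        (\<Sum>i\<in>UNIV. (k $ i) *\<^sub>R L (mult_w (translate (- h) (partial i c)))))
        \<le> (D * (E * (2 * A * near_const * w (- h) * M))) * (norm k)\<^sup>2"
      by (simp add: mult.assoc)
  qed
qed

lemma translate_smooth:
  assumes L: "bounded_form N C L" and c: "c \<in> decaying"
  shows "partials is (\<lambda>h. L (mult_w (translate (- h) c))) = (\<lambda>h. L (mult_w (translate (- h) (partials is c))))"
    and "(\<lambda>h. L (mult_w (translate (- h) c))) \<in> smooth_functions"
    and "\<exists>B. \<forall>h. jet m (\<lambda>h. L (mult_w (translate (- h) c))) h \<le> B * (1 + (norm h)\<^sup>2) ^ P"
proof -
  have P: "partial i (\<lambda>h. L (mult_w (translate (- h) c))) h = L (mult_w (translate (- h) (partial i c)))"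
    if "c \<in> decaying" for c i h
  proof -
    have "((axis i 1 :: real^'n) $ k) *\<^sub>R L (mult_w (translate (- h) (partial k c))) =
        (if k = i then L (mult_w (translate (- h) (partial i c))) else 0)" for k
      by (simp add: axis_def)
    then show ?thesis unfolding partial_eq_derivative[OF translate_derivative[OF L that]] by simp
  qed
  have eq: "partials is (\<lambda>h. L (mult_w (translate (- h) c))) = (\<lambda>h. L (mult_w (translate (- h) (partials is c))))" for "is"
  proof (induction "is")
    case (Cons i js)
    show ?case
      unfolding partials.simps Cons using P[OF decaying_partials[OF c, of js]] by (simp add: fun_eq_iff)
  qed simp
  then show "partials is (\<lambda>h. L (mult_w (translate (- h) c))) = (\<lambda>h. L (mult_w (translate (- h) (partials is c))))" .
  have "partials is (\<lambda>h. L (mult_w (translate (- h) c))) differentiable at h" for "is" h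
    unfolding eq by (rule differentiableI[OF translate_derivative[OF L decaying_partials[OF c]]])
  then show "(\<lambda>h. L (mult_w (translate (- h) c))) \<in> smooth_functions"
    by (simp add: smooth_functions_def differentiable_on_def)
  obtain D where D: "D \<ge> 0" "\<forall>c\<in>decaying. \<forall>M. (\<forall>x. w x * jet N c x \<le> M) \<longrightarrow> cmod (L (mult_w c)) \<le> D * M"
    using bounded_form_mult_w[OF L] by blast
  have "\<exists>B. \<forall>h. cmod (L (mult_w (translate (- h) (partials is c)))) \<le> B * (1 + (norm h)\<^sup>2) ^ P" for "is"
  proof -
    obtain M where M: "M \<ge> 0" "\<And>x. w x * jet N (partials is c) x \<le> M"
      using decaying_jet[OF decaying_partials[OF c]] by metis
    have "cmod (L (mult_w (translate (- h) (partials is c)))) \<le> (D * (2 * A * M) * A) * (1 + (norm h)\<^sup>2) ^ P" for h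
    proof -
      have "cmod (L (mult_w (translate (- h) (partials is c)))) \<le> D * (2 * A * M * w (- h))"
        by (intro D(2)[rule_format] decaying_translate decaying_partials c translate_jet M)
      also have "\<dots> \<le> D * (2 * A * M * (A * w h))"
        using w_double[of "- h" h] A_ge_1 M(1) D(1) by (intro mult_left_mono) auto
      also have "\<dots> \<le> D * (2 * A * M * (A * (1 + (norm h)\<^sup>2) ^ P))"
        using w_poly[of h] A_ge_1 M(1) D(1) by (intro mult_left_mono) auto
      finally show ?thesis by (simp add: mult.assoc)
    qed
    then show ?thesis by blast
  qed
  then obtain B where B: "\<And>is h. cmod (L (mult_w (translate (- h) (partials is c)))) \<le> B is * (1 + (norm h)\<^sup>2) ^ P" by metis
  have "jet m (\<lambda>h. L (mult_w (translate (- h) c))) h \<le> (\<Sum>is | length is \<le> m. B is) * (1 + (norm h)\<^sup>2) ^ P" for h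
    unfolding jet_def eq sum_distrib_right by (intro sum_mono B)
  then show "\<exists>B. \<forall>h. jet m (\<lambda>h. L (mult_w (translate (- h) c))) h \<le> B * (1 + (norm h)\<^sup>2) ^ P" by blast
qed

lemma conv_add_left:
  assumes "integrable lborel a" "integrable lborel b" "c \<in> B_space"
  shows "conv (\<lambda>h. a h + b h) c = (\<lambda>x. conv a c x + conv b c x)"
    and "conv (\<lambda>h. a h - b h) c = (\<lambda>x. conv a c x - conv b c x)"
  using integrable_mult_B_space[OF assms(1,3)] integrable_mult_B_space[OF assms(2,3)]
  by (simp_all add: conv_def fun_eq_iff distrib_right left_diff_distrib)

lemma conv_add_right:
  assumes "integrable lborel a" "c \<in> B_space" "d \<in> B_space"
  shows "conv a (\<lambda>x. c x + d x) = (\<lambda>x. conv a c x + conv a d x)"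
  using integrable_mult_B_space[OF assms(1,2)] integrable_mult_B_space[OF assms(1,3)]
  by (simp add: conv_def fun_eq_iff distrib_left)

lemma conv_scale:
  "conv (\<lambda>h. r * a h) c = (\<lambda>x. r * conv a c x)" "conv a (\<lambda>x. r * c x) = (\<lambda>x. r * conv a c x)"
  by (simp_all add: conv_def fun_eq_iff mult.assoc mult.left_commute[of _ r])

lemma bounded_form_conv_bound:
  assumes L: "bounded_form N C L"
  shows "\<exists>D\<ge>0. \<forall>a\<in>borel_measurable borel. \<forall>c\<in>decaying. \<forall>K M.
    (\<forall>h. cmod (a h) \<le> K * inverse (w h)) \<longrightarrow> (\<forall>x. w x * jet N c x \<le> M) \<longrightarrow>
    cmod (L (mult_w (conv a c))) \<le> D * (K * M)"
proof -
  obtain D where D: "D \<ge> 0" "\<forall>c\<in>decaying. \<forall>M. (\<forall>x. w x * jet N c x \<le> M) \<longrightarrow> cmod (L (mult_w c)) \<le> D * M"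
    using bounded_form_mult_w[OF L] by blast
  have "cmod (L (mult_w (conv a c))) \<le> (D * conv_norm) * (K * M)"
    if a: "a \<in> borel_measurable borel" "\<forall>h. cmod (a h) \<le> K * inverse (w h)"
      and c: "c \<in> decaying" "\<forall>x. w x * jet N c x \<le> M" for a c K M
  proof -
    have "cmod (L (mult_w (conv a c))) \<le> D * (conv_norm * K * M)"
      using a c by (intro D(2)[rule_format] jet_conv_decaying conv_decaying) auto
    then show ?thesis by (simp add: mult.assoc)
  qed
  then show ?thesis using D(1) conv_norm_nonneg by (intro exI[of _ "D * conv_norm"]) auto
qed

text \<open>Let \<open>m h = f (\<tau>\<^sub>-\<^sub>h \<phi>)\<close>. Exchanging \<open>v\<close> with the integral of \<open>K m \<psi>\<close> shows that the distribution \<open>K m\<close>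
  extends to the form \<open>\<psi> \<mapsto> \<langle>v, w (a * \<phi>)\<rangle>\<close> on \<open>B_dot\<close>, where \<open>a h = K h \<psi> (- h)\<close>. The value of the convolution at \<open>\<phi>\<close> is the
  pairing of \<open>K m\<close> with \<open>1\<close>, which is the limit of the values at the cutoffs \<open>\<psi> = \<chi>\<^sub>k\<close>. Along them \<open>w (a * \<phi>)\<close> stays
  bounded and converges locally to \<open>w (K * \<phi>)\<close>, so tightness of \<open>v\<close> identifies the limit.\<close>

lemma S'_conv_decaying_kernel:
  assumes v: "v \<in> B_dot_dual" and f: "\<And>\<phi>. \<phi> \<in> schwartz \<Longrightarrow> f \<phi> = v (mult_w \<phi>)"
    and K: "K \<in> decaying" "\<And>x. K (- x) = K x"
  shows "S'_convolvable (function_distr K) f"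
    and "\<phi> \<in> schwartz \<Longrightarrow> S'_conv (function_distr K) f \<phi> = B_extension v (mult_w (conv K \<phi>))"
proof -
  obtain N where tv: "tight_on B_dot N v" using B_dot_dual_tight[OF v] by blast
  define L where "L = B_extension v"
  have tight: "tight_on B_space N L" unfolding L_def by (rule B_extension_tight[OF tv])
  obtain C where L: "bounded_form N C L" using tight_on_B_space_bounded_form[OF tight] by blast
  note lin = bounded_form_linear[OF L]
  have Lv: "L g = v g" if "g \<in> B_dot" for g unfolding L_def by (rule B_extension_eq[OF tv that])
  obtain D where D: "D \<ge> 0" "\<forall>a\<in>borel_measurable borel. \<forall>c\<in>decaying. \<forall>K M.
    (\<forall>h. cmod (a h) \<le> K * inverse (w h)) \<longrightarrow> (\<forall>x. w x * jet N c x \<le> M) \<longrightarrow>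
    cmod (L (mult_w (conv a c))) \<le> D * (K * M)"
    using bounded_form_conv_bound[OF L] by blast
  obtain k where k: "k \<ge> 0" "\<And>x. w x * jet 0 K x \<le> k" using decaying_jet[OF K(1)] by metis
  have K_bound: "cmod (K h) \<le> k * inverse (w h)" for h by (rule decaying_cmod[OF k(2)])
  have [measurable]: "K \<in> borel_measurable borel" by (rule smooth_measurable[OF decaying_smooth[OF K(1)]])
  have iK: "integrable lborel K" by (rule decaying_integrable[OF _ K_bound]) simp
  \<comment> \<open>the reflection of \<open>K \<psi>\<close>, as \<open>K\<close> is even\<close>
  define a where "a \<psi> h = K h * \<psi> (- h)" for \<psi> and h :: "real^'n"
  have a_meas [measurable]: "a \<psi> \<in> borel_measurable borel" if "\<psi> \<in> smooth_functions" for \<psi>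
  proof -
    have [measurable]: "\<psi> \<in> borel_measurable borel" by (rule smooth_measurable[OF that])
    show ?thesis unfolding a_def by measurable
  qed
  have a_bound: "cmod (a \<psi> h) \<le> (k * B) * inverse (w h)" if "\<And>x. cmod (\<psi> x) \<le> B" for \<psi> B h
  proof -
    have "cmod (a \<psi> h) \<le> (k * inverse (w h)) * B"
      unfolding a_def norm_mult using that K_bound[of h] k(1) by (intro mult_mono) auto
    then show ?thesis by (simp add: mult_ac)
  qed
  have a_int: "integrable lborel (a \<psi>)" if \<psi>: "\<psi> \<in> B_space" for \<psi>
  proof -
    obtain B where "\<And>x. cmod (\<psi> x) \<le> B" using B_space_cmod[OF \<psi>] by metis
    from decaying_integrable[OF a_meas[OF B_space_smooth[OF \<psi>]] a_bound[OF this]] show ?thesis .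
  qed
  have aconv: "conv (a \<psi>) \<phi> \<in> decaying" if \<psi>: "\<psi> \<in> B_space" and \<phi>: "\<phi> \<in> decaying" for \<psi> \<phi>
  proof -
    obtain B where "\<And>x. cmod (\<psi> x) \<le> B" using B_space_cmod[OF \<psi>] by metis
    from conv_decaying[OF a_meas[OF B_space_smooth[OF \<psi>]] a_bound[OF this] \<phi>] show ?thesis .
  qed
  define U where "U \<phi> \<psi> = (if \<psi> \<in> B_dot then L (mult_w (conv (a \<psi>) \<phi>)) else 0)" for \<phi> \<psi>
  have U: "U \<phi> \<in> B_dot_dual" and U_eq: "mult_distr (check_conv f \<phi>) (function_distr K) \<psi> = (if \<psi> \<in> schwartz then U \<phi> \<psi> else 0)"
    and U_tempered: "mult_distr (check_conv f \<phi>) (function_distr K) \<in> tempered_distr"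
    if \<phi>: "\<phi> \<in> schwartz" for \<phi> \<psi>
  proof -
    have \<phi>d: "\<phi> \<in> decaying" by (rule schwartz_decaying[OF \<phi>])
    have \<phi>B: "\<phi> \<in> B_space" by (rule decaying_subset_B_space[OF \<phi>d])
    obtain M where M: "M \<ge> 0" "\<And>x. w x * jet N \<phi> x \<le> M" using decaying_jet[OF \<phi>d] by metis
    have BD: "\<psi> \<in> B_space" if "\<psi> \<in> B_dot" for \<psi> :: "real^'n \<Rightarrow> complex"
      using that B_dot_subset_B_space by auto
    have U_bound: "cmod (U \<phi> \<psi>) \<le> (D * k * M) * B" if \<psi>: "\<psi> \<in> B_dot" and B: "\<And>x. jet 0 \<psi> x \<le> B" for \<psi> B
    proof -
      have "cmod (\<psi> x) \<le> B" for x by (rule order_trans[OF cmod_le_jet B])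
      then have "cmod (L (mult_w (conv (a \<psi>) \<phi>))) \<le> D * (k * B * M)"
        by (intro D(2)[rule_format] \<phi>d M a_meas B_space_smooth BD \<psi> a_bound) auto
      then show ?thesis using \<psi> by (simp add: U_def mult_ac)
    qed
    have U_lin: "linear_form_on B_dot (U \<phi>)"
      unfolding linear_form_on_def
    proof (intro conjI ballI allI)
      fix \<psi> \<psi>' :: "real^'n \<Rightarrow> complex" assume p: "\<psi> \<in> B_dot" "\<psi>' \<in> B_dot"
      have "a (\<lambda>x. \<psi> x + \<psi>' x) = (\<lambda>h. a \<psi> h + a \<psi>' h)" by (simp add: a_def fun_eq_iff distrib_left)
      then have "mult_w (conv (a (\<lambda>x. \<psi> x + \<psi>' x)) \<phi>) = (\<lambda>x. mult_w (conv (a \<psi>) \<phi>) x + mult_w (conv (a \<psi>') \<phi>) x)"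
        by (simp add: conv_add_left(1)[OF a_int a_int \<phi>B] BD p mult_w_linear)
      then show "U \<phi> (\<lambda>x. \<psi> x + \<psi>' x) = U \<phi> \<psi> + U \<phi> \<psi>'"
        using p linear_space_add[OF linear_space_B_dot p]
        by (simp add: U_def linear_form_onD(1)[OF lin] decaying_mult_w aconv BD \<phi>d)
    next
      fix r and \<psi> :: "real^'n \<Rightarrow> complex" assume p: "\<psi> \<in> B_dot"
      have "a (\<lambda>x. r * \<psi> x) = (\<lambda>h. r * a \<psi> h)" by (simp add: a_def fun_eq_iff mult_ac)
      then have "mult_w (conv (a (\<lambda>x. r * \<psi> x)) \<phi>) = (\<lambda>x. r * mult_w (conv (a \<psi>) \<phi>) x)"
        by (simp add: conv_scale mult_w_linear)
      then show "U \<phi> (\<lambda>x. r * \<psi> x) = r * U \<phi> \<psi>"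
        using p linear_space_scale[OF linear_space_B_dot p]
        by (simp add: U_def linear_form_onD(2)[OF lin] decaying_mult_w aconv BD \<phi>d)
    qed
    show "U \<phi> \<in> B_dot_dual"
      by (rule B_dot_dualI[where N=0 and C="D * k * M"])
        (use U_lin U_bound D(1) k(1) M(1) in \<open>auto simp: U_def\<close>)
    define m where "m = (\<lambda>h. L (mult_w (translate (- h) \<phi>)))"
    have m: "check_conv f \<phi> = m"
    proof
      fix h
      have "mult_w (translate (- h) \<phi>) \<in> B_dot"
        using schwartz_mult_w[OF schwartz_translate[OF \<phi>]] schwartz_subset_B_dot by blast
      then show "check_conv f \<phi> h = m h"
        by (simp add: check_conv_def m_def f schwartz_translate \<phi> Lv)
    qed
    have m_mult: "(\<lambda>x. m x * \<psi> x) \<in> schwartz" if "\<psi> \<in> schwartz" for \<psi>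
      using translate_smooth(2,3)[OF L \<phi>d] that unfolding m_def[symmetric] by (intro schwartz_mult) blast+
    show U_eq: "mult_distr (check_conv f \<phi>) (function_distr K) \<psi> = (if \<psi> \<in> schwartz then U \<phi> \<psi> else 0)" for \<psi>
    proof (cases "\<psi> \<in> schwartz")
      case True
      have \<psi>: "\<psi> \<in> B_dot" "\<psi> \<in> decaying" using True schwartz_subset_B_dot schwartz_decaying by auto
      have [measurable]: "\<psi> \<in> borel_measurable borel" "m \<in> borel_measurable borel"
        using schwartz_smooth[OF True] translate_smooth(2)[OF L \<phi>d] by (auto intro: smooth_measurable simp: m_def)
      have "L (mult_w (conv (a \<psi>) \<phi>)) = (LINT h|lborel. a \<psi> h * L (mult_w (translate h \<phi>)))"
      proof (rule bounded_form_conv[OF L \<phi>d a_meas _ aconv[OF BD \<phi>d]])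
        obtain b where b: "b \<ge> 0" "\<And>x. w x * jet 0 \<psi> x \<le> b" using decaying_jet[OF \<psi>(2)] by metis
        have "integrable lborel (\<lambda>h. cmod (\<psi> (0 - h)))"
          by (intro integrable_norm integrable_reflect decaying_integrable[OF _ decaying_cmod[OF b(2)]]) simp
        then have "integrable lborel (\<lambda>h. k * cmod (\<psi> (- h)))" by simp
        then show "integrable lborel (\<lambda>h. cmod (a \<psi> h) * w h)"
        proof (rule Bochner_Integration.integrable_bound)
          have "cmod (a \<psi> h) * w h \<le> k * cmod (\<psi> (- h))" for h
          proof -
            have "cmod (K h) * w h \<le> k" using K_bound[of h] w_pos[of h] by (simp add: field_simps)
            from mult_right_mono[OF this norm_ge_zero[of "\<psi> (- h)"]] show ?thesis
              by (simp add: a_def norm_mult mult_ac)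
          qed
          then show "AE h in lborel. norm (cmod (a \<psi> h) * w h) \<le> norm (k * cmod (\<psi> (- h)))"
            using k(1) by (auto simp: abs_mult)
        qed (use schwartz_smooth[OF True] in measurable)
      qed (use \<psi> schwartz_smooth[OF True] in auto)
      also have "\<dots> = (LINT h|lborel. K (0 - h) * (m (0 - h) * \<psi> (0 - h)))"
        by (intro Bochner_Integration.integral_cong) (auto simp: a_def m_def K(2) mult_ac)
      also have "\<dots> = (LINT h|lborel. K h * (m h * \<psi> h))"
        by (rule integral_reflect[where f="\<lambda>h. K h * (m h * \<psi> h)"]) simp
      also have "\<dots> = mult_distr (check_conv f \<phi>) (function_distr K) \<psi>"
        using True m_mult[OF True] by (simp add: mult_distr_def function_distr_def m)
      finally show ?thesis using True \<psi> by (simp add: U_def)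
    qed (simp add: mult_distr_def)
    show "mult_distr (check_conv f \<phi>) (function_distr K) \<in> tempered_distr"
    proof (rule tempered_distrI[where N=0 and P=0 and C="D * k * M"])
      show "linear_form_on schwartz (mult_distr (check_conv f \<phi>) (function_distr K))"
        using U_lin schwartz_subset_B_dot linear_space_schwartz
        unfolding linear_form_on_def linear_space_def U_eq by (auto simp: subset_iff)
      show "cmod (mult_distr (check_conv f \<phi>) (function_distr K) \<psi>) \<le> D * k * M * B"
        if "\<psi> \<in> schwartz" "\<And>x. (1 + (norm x)\<^sup>2) ^ 0 * jet 0 \<psi> x \<le> B" for \<psi> B
        using that schwartz_subset_B_dot U_bound[of \<psi> B] by (auto simp: U_eq)
    qed (use D(1) k(1) M(1) in \<open>auto simp: mult_distr_def\<close>)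
  qed
  show convolvable: "S'_convolvable (function_distr K) f"
    unfolding S'_convolvable_def DL1_def using U U_eq U_tempered by auto
  assume \<phi>: "\<phi> \<in> schwartz"
  have \<phi>d: "\<phi> \<in> decaying" by (rule schwartz_decaying[OF \<phi>])
  have \<phi>B: "\<phi> \<in> B_space" by (rule decaying_subset_B_space[OF \<phi>d])
  obtain N' where tU: "tight_on B_dot N' (U \<phi>)" using B_dot_dual_tight[OF U[OF \<phi>]] by blast
  have cutB: "cutoff j \<in> B_dot" "cutoff j \<in> B_space" for j :: nat
    using cutoff_schwartz schwartz_subset_B_dot B_dot_subset_B_space by blast+
  have "S'_conv (function_distr K) f \<phi> = B_extension (U \<phi>) (\<lambda>_. 1)"
    using DL1_B_c_pairing_eq[OF U[OF \<phi>], of "mult_distr (check_conv f \<phi>) (function_distr K)"]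
    by (simp add: S'_conv_def convolvable \<phi> U_eq)
  moreover have "(\<lambda>j. U \<phi> (cutoff j)) \<longlonglongrightarrow> B_extension (U \<phi>) (\<lambda>_. 1)"
    using B_extension_tendsto[OF tU B_space_const[of 1]] by simp
  moreover have "(\<lambda>j. L (mult_w (conv (a (cutoff j)) \<phi>))) \<longlonglongrightarrow> L (mult_w (conv K \<phi>))"
  proof -
    have Kd: "conv K \<phi> \<in> decaying" by (rule conv_decaying[OF _ K_bound \<phi>d]) simp
    obtain B where B: "B \<ge> 0" "\<And>j (x :: real^'n). jet 0 (cutoff j) x \<le> B" using cutoff_bounded by metis
    have cutoff_le: "cmod (cutoff j x) \<le> B" for j and x :: "real^'n" by (rule order_trans[OF cmod_le_jet B(2)])
    obtain E where E: "E \<ge> 0" "\<forall>c\<in>smooth_functions. \<forall>x. jet N (mult_w c) x \<le> E * (w x * jet N c x)"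
      using jet_mult_w by blast
    obtain M where M: "M \<ge> 0" "\<And>x. w x * jet N \<phi> x \<le> M" using decaying_jet[OF \<phi>d] by metis
    obtain M' where M': "M' \<ge> 0" "\<And>x. jet N \<phi> x \<le> M'" using B_space_jet[OF \<phi>B] by metis
    define b where "b j = (\<lambda>h. a (cutoff j) h - K h)" for j
    have [measurable]: "cutoff j \<in> borel_measurable borel" for j by (rule smooth_measurable[OF cutoff_smooth])
    have b_meas [measurable]: "b j \<in> borel_measurable borel" for j unfolding b_def a_def by measurable
    have b_bound: "cmod (b j h) \<le> (k * (B + 1)) * inverse (w h)" for j h
      using norm_triangle_ineq4[of "a (cutoff j) h" "K h"] a_bound[of "cutoff j" B h, OF cutoff_le] K_bound[of h]
      by (simp add: b_def algebra_simps)
    have b_int: "integrable lborel (b j)" for j by (rule decaying_integrable[OF b_meas b_bound])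
    have conv_b: "(\<lambda>x. conv (a (cutoff j)) \<phi> x - conv K \<phi> x) = conv (b j) \<phi>" for j
      unfolding b_def by (simp add: conv_add_left(2)[OF a_int[OF cutB(2)] iK \<phi>B])
    have conv_b_decaying: "conv (b j) \<phi> \<in> decaying" for j by (rule conv_decaying[OF b_meas b_bound \<phi>d])
    have jet_le: "jet N (\<lambda>x. mult_w (conv (a (cutoff j)) \<phi>) x - mult_w (conv K \<phi>) x) x \<le> E * (w x * jet N (conv (b j) \<phi>) x)" for j x
      unfolding mult_w_linear(3)[symmetric] conv_b by (intro E(2)[rule_format] decaying_smooth conv_b_decaying)
    show ?thesis
    proof (rule tight_on_tendsto[OF tight linear_space_B_space decaying_mult_w[OF Kd]])
      show "eventually (\<lambda>j. mult_w (conv (a (cutoff j)) \<phi>) \<in> B_space \<and>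
          (\<forall>x. jet N (\<lambda>x. mult_w (conv (a (cutoff j)) \<phi>) x - mult_w (conv K \<phi>) x) x \<le> E * (conv_norm * (k * (B + 1)) * M))) sequentially"
      proof (intro always_eventually allI conjI)
        fix j x
        show "mult_w (conv (a (cutoff j)) \<phi>) \<in> B_space" by (intro decaying_mult_w aconv cutB \<phi>d)
        show "jet N (\<lambda>x. mult_w (conv (a (cutoff j)) \<phi>) x - mult_w (conv K \<phi>) x) x \<le> E * (conv_norm * (k * (B + 1)) * M)"
          by (rule order_trans[OF jet_le mult_left_mono[OF jet_conv_decaying[OF b_meas b_bound \<phi>d M(2)] E(1)]])
      qed
      fix R d :: real assume d: "d > 0"
      define W where "W = (1 + \<bar>R\<bar>\<^sup>2) ^ P"
      have W: "W \<ge> 0" by (simp add: W_def)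
      define \<beta> where "\<beta> j = (LINT h|lborel. cmod (b j h))" for j
      have "\<beta> \<longlonglongrightarrow> (LINT h :: real^'n|lborel. 0)"
        unfolding \<beta>_def
      proof (rule integral_dominated_convergence)
        show "integrable lborel (\<lambda>h. (k * (B + 1)) * inverse (w h))" using w_integrable by simp
        show "AE h in lborel. norm (cmod (b j h)) \<le> (k * (B + 1)) * inverse (w h)" for j using b_bound by simp
        show "AE h in lborel. (\<lambda>j. cmod (b j h)) \<longlonglongrightarrow> 0"
        proof (rule AE_I2)
          fix h :: "real^'n"
          have "(\<lambda>j. cutoff j (- h) - 1) \<longlonglongrightarrow> 0"
          proof (rule tendstoI)
            fix e :: real assume e: "e > 0"
            from cutoff_tendsto_1[OF half_gt_zero[OF e], of "norm h" 0, where 'n='n]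
            show "eventually (\<lambda>j. dist (cutoff j (- h) - 1) 0 < e) sequentially"
            proof eventually_elim
              case (elim j)
              then have "jet 0 (\<lambda>x. cutoff j x - 1) (- h) \<le> e / 2" by simp
              from order_trans[OF cmod_le_jet[of "\<lambda>x. cutoff j x - 1" "- h" 0] this] e show ?case by simp
            qed
          qed
          then have "(\<lambda>j. cmod (K h * (cutoff j (- h) - 1))) \<longlonglongrightarrow> 0"
            by (intro tendsto_norm_zero tendsto_mult_right_zero)
          then show "(\<lambda>j. cmod (b j h)) \<longlonglongrightarrow> 0" by (simp add: b_def a_def right_diff_distrib)
        qed
      qed simp_all
      then have "(\<lambda>j. E * (W * (M' * \<beta> j))) \<longlonglongrightarrow> E * (W * (M' * 0))" by (intro tendsto_intros) simp
      then have "eventually (\<lambda>j. E * (W * (M' * \<beta> j)) < d) sequentially"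
        using d by (intro order_tendstoD(2)) auto
      then show "eventually (\<lambda>j. \<forall>x. norm x \<le> R \<longrightarrow>
          jet N (\<lambda>x. mult_w (conv (a (cutoff j)) \<phi>) x - mult_w (conv K \<phi>) x) x \<le> d) sequentially"
      proof eventually_elim
        case (elim j)
        show ?case
        proof (intro allI impI)
          fix x :: "real^'n" assume x: "norm x \<le> R"
          have "w x \<le> (1 + (norm x)\<^sup>2) ^ P" by (rule w_poly)
          also have "\<dots> \<le> W" unfolding W_def using x by (intro power_mono add_left_mono) auto
          finally have wx: "w x \<le> W" .
          have "jet N (conv (b j) \<phi>) x \<le> (LINT h|lborel. cmod (b j h) * jet N \<phi> (x - h))"
            by (rule jet_conv[OF b_int \<phi>B])
          also have "\<dots> \<le> (LINT h|lborel. cmod (b j h) * M')"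
            using b_int by (intro integral_mono integrable_mult_jet \<phi>B mult_left_mono M') auto
          also have "\<dots> = M' * \<beta> j" by (simp add: \<beta>_def)
          finally have "E * (w x * jet N (conv (b j) \<phi>) x) \<le> E * (W * (M' * \<beta> j))"
            using wx W E(1) by (intro mult_left_mono mult_mono) (auto simp: jet_nonneg)
          then show "jet N (\<lambda>x. mult_w (conv (a (cutoff j)) \<phi>) x - mult_w (conv K \<phi>) x) x \<le> d"
            using jet_le[of j x] elim by linarith
        qed
      qed
    qed
  qed
  then have "(\<lambda>j. U \<phi> (cutoff j)) \<longlonglongrightarrow> L (mult_w (conv K \<phi>))" by (simp add: U_def cutB)
  ultimately show "S'_conv (function_distr K) f \<phi> = B_extension v (mult_w (conv K \<phi>))"
    unfolding L_def[symmetric] by (metis LIMSEQ_unique)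
qed

end

section \<open>Representation by a continuous function\<close>

lemma bump_translate_schwartz:
  fixes a :: "real^'n::finite"
  assumes "r > 0"
  shows "(\<lambda>x. bump (inverse r *\<^sub>R (x - a))) \<in> schwartz"
proof -
  have "(\<lambda>x :: real^'n. bump (inverse r *\<^sub>R x)) \<in> schwartz"
  proof (rule compact_support_schwartz[OF smooth_scale[OF bump_smooth], of r])
    fix x :: "real^'n" assume "norm x > r"
    then show "bump (inverse r *\<^sub>R x) = 0"
      using assms by (intro bump_eq_0) (simp add: field_simps)
  qed
  from schwartz_translate[OF this, of a] show ?thesis by (simp add: translate_def)
qed

text \<open>The two functions are only assumed to be continuous, so their products with a general Schwartz function need not be
  integrable. Testing with bump functions avoids this.\<close>

lemma function_distr_continuous_inject:
  fixes g g' :: "real^'n::finite \<Rightarrow> complex"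
  assumes g: "continuous_on UNIV g" and g': "continuous_on UNIV g'"
    and eq: "function_distr g = function_distr g'"
  shows "g = g'"
proof (rule ccontr)
  assume "g \<noteq> g'"
  then obtain a where a: "g a \<noteq> g' a" by blast
  define d where "d x = g x - g' x" for x
  have d: "continuous_on UNIV d" unfolding d_def by (intro continuous_intros g g')
  define e where "e = cmod (d a)"
  have e: "e > 0" using a by (simp add: e_def d_def)
  have "isCont d a" using d by (simp add: continuous_on_eq_continuous_at)
  then obtain r where r: "r > 0" "\<And>x. dist x a < r \<Longrightarrow> dist (d x) (d a) < e / 2"
    using e unfolding continuous_at_eps_delta by (metis half_gt_zero)
  define \<phi> where "\<phi> x = bump (inverse r *\<^sub>R (x - a))" for x
  have \<phi>: "\<phi> \<in> schwartz" unfolding \<phi>_def by (rule bump_translate_schwartz[OF r(1)])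
  have \<phi>0: "\<phi> x = 0" if "r \<le> dist x a" for x
    unfolding \<phi>_def
  proof (rule bump_eq_0)
    have "norm (inverse r *\<^sub>R (x - a)) = inverse r * dist x a" using r(1) by (simp add: dist_norm)
    then show "1 \<le> norm (inverse r *\<^sub>R (x - a))"
      using mult_left_mono[OF that, of "inverse r"] r(1) by simp
  qed
  have \<phi>c: "continuous_on UNIV \<phi>" by (rule smooth_continuous0[OF schwartz_smooth[OF \<phi>]])
  have int: "integrable lborel (\<lambda>x. h x * \<phi> x)" if "continuous_on UNIV h" for h
  proof -
    have "integrable lborel (\<lambda>x. indicator (cball a r) x *\<^sub>R (h x * \<phi> x))"
      by (rule borel_integrable_compact)
        (auto intro!: continuous_intros continuous_on_subset[OF that] continuous_on_subset[OF \<phi>c])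
    moreover have "indicator (cball a r) x *\<^sub>R (h x * \<phi> x) = h x * \<phi> x" for x
      using \<phi>0[of x] by (auto simp: indicator_def dist_commute)
    ultimately show ?thesis by simp
  qed
  have "function_distr g \<phi> = function_distr g' \<phi>" by (simp add: eq)
  then have 0: "(LINT x|lborel. d x * \<phi> x) = 0"
    using \<phi> int[OF g] int[OF g'] by (simp add: function_distr_def d_def left_diff_distrib)
  obtain \<rho> where \<rho>: "\<And>x. \<rho> x \<ge> 0" "\<And>x. \<phi> x = complex_of_real (\<rho> x)"
  proof -
    have "\<forall>x. \<exists>s\<ge>0. \<phi> x = complex_of_real s" unfolding \<phi>_def by (intro allI bump_nonneg)
    then show thesis using that by metis
  qed
  have int\<rho>: "integrable lborel \<rho>"
  proof -
    have "integrable lborel (\<lambda>x. cmod (1 * \<phi> x))" by (intro integrable_norm int continuous_on_const)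
    moreover have "cmod (1 * \<phi> x) = \<rho> x" for x using \<rho>(1)[of x] by (simp add: \<rho>(2))
    ultimately show ?thesis by simp
  qed
  have int\<phi>: "(LINT x|lborel. \<phi> x) = of_real (LINT x|lborel. \<rho> x)" unfolding \<rho>(2) by (rule integral_complex_of_real)
  have "d a * (LINT x|lborel. \<phi> x) = (LINT x|lborel. d a * \<phi> x) - (LINT x|lborel. d x * \<phi> x)" by (simp add: 0)
  also have "\<dots> = (LINT x|lborel. d a * \<phi> x - d x * \<phi> x)"
    by (intro Bochner_Integration.integral_diff[symmetric] int d continuous_on_const)
  also have "cmod \<dots> \<le> (LINT x|lborel. e / 2 * \<rho> x)"
  proof (rule Bochner_Integration.integral_norm_bound_integral)
    show "integrable lborel (\<lambda>x. d a * \<phi> x - d x * \<phi> x)"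
      by (intro Bochner_Integration.integrable_diff int d continuous_on_const)
    show "integrable lborel (\<lambda>x. e / 2 * \<rho> x)" using int\<rho> by simp
    fix x
    show "cmod (d a * \<phi> x - d x * \<phi> x) \<le> e / 2 * \<rho> x"
    proof (cases "r \<le> dist x a")
      case True
      then show ?thesis using e \<rho>(1)[of x] by (simp add: \<phi>0)
    next
      case False
      have "d a * \<phi> x - d x * \<phi> x = (d a - d x) * \<phi> x" by (simp add: left_diff_distrib)
      then have "cmod (d a * \<phi> x - d x * \<phi> x) = cmod (d a - d x) * \<rho> x"
        using \<rho>(1)[of x] by (simp only: norm_mult \<rho>(2) norm_of_real abs_of_nonneg)
      moreover have "cmod (d a - d x) \<le> e / 2" using r(2)[of x] False by (simp add: dist_norm norm_minus_commute)
      then have "cmod (d a - d x) * \<rho> x \<le> e / 2 * \<rho> x" by (rule mult_right_mono[OF _ \<rho>(1)])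
      ultimately show ?thesis by (simp only:)
    qed
  qed
  finally have "e * (LINT x|lborel. \<rho> x) \<le> e / 2 * (LINT x|lborel. \<rho> x)"
    using \<rho>(1) by (simp add: norm_mult int\<phi> e_def integral_nonneg_AE)
  then have le0: "(LINT x|lborel. \<rho> x) \<le> 0" using e by (simp add: mult_le_cancel_right field_simps)
  \<comment> \<open>but \<open>\<rho>\<close> is at least \<open>1 / 2\<close> near \<open>a\<close>\<close>
  have "isCont \<phi> a" using \<phi>c by (simp add: continuous_on_eq_continuous_at)
  moreover have "\<phi> a = 1" by (simp add: \<phi>_def bump_0)
  ultimately obtain t where t: "t > 0" "\<And>x. dist x a < t \<Longrightarrow> dist (\<phi> x) 1 < 1 / 2"
    unfolding continuous_at_eps_delta by (metis half_gt_zero zero_less_one)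
  have "1 / 2 * measure lborel (ball a t) = (LINT x|lborel. 1 / 2 * indicator (ball a t) x)"
    by simp
  also have "\<dots> \<le> (LINT x|lborel. \<rho> x)"
  proof (rule integral_mono)
    show "integrable lborel (\<lambda>x. 1 / 2 * indicator (ball a t) x :: real)"
      by (intro integrable_mult_right integrable_real_indicator) (use emeasure_bounded_finite[OF bounded_ball, of a t] in \<open>auto simp: less_top\<close>)
    fix x
    have "\<rho> x \<ge> 1 / 2" if "x \<in> ball a t"
    proof -
      have "cmod (of_real (\<rho> x - 1)) < 1 / 2" using t(2)[of x] that by (simp add: dist_norm \<rho>(2) norm_minus_commute)
      then show ?thesis unfolding norm_of_real by linarith
    qed
    then show "1 / 2 * indicator (ball a t) x \<le> \<rho> x" using \<rho>(1)[of x] by (auto simp: indicator_def)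
  qed (rule int\<rho>)
  finally have "measure lborel (ball a t) \<le> 0" using le0 by simp
  moreover have "measure lborel (ball a t) > 0" using t(1) by (rule content_ball_pos)
  ultimately show False by simp
qed

context smooth_weight
begin

text \<open>Exchange the roles of \<open>K\<close> and \<open>\<phi>\<close> in the convolution; then the form can be applied under the
  integral, because \<open>|\<phi>| w\<close> is integrable.\<close>

lemma conv_form_continuous_function:
  assumes L: "bounded_form N C L" and K: "K \<in> decaying" and \<phi>: "\<phi> \<in> schwartz"
  shows "L (mult_w (conv K \<phi>)) = (LINT h|lborel. L (mult_w (translate h K)) * \<phi> h)"
proof -
  have \<phi>d: "\<phi> \<in> decaying" "mult_w \<phi> \<in> decaying" using schwartz_decaying[OF \<phi>] schwartz_decaying[OF schwartz_mult_w[OF \<phi>]] .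
  obtain b where b: "\<And>x. w x * jet 0 \<phi> x \<le> b" using decaying_jet[OF \<phi>d(1)] by metis
  obtain b' where b': "\<And>x. w x * jet 0 (mult_w \<phi>) x \<le> b'" using decaying_jet[OF \<phi>d(2)] by metis
  have meas: "\<phi> \<in> borel_measurable borel" "mult_w \<phi> \<in> borel_measurable borel" "K \<in> borel_measurable borel"
    using \<phi>d K by (auto intro: smooth_measurable decaying_smooth)
  have "conv K \<phi> = conv \<phi> K" by (rule conv_commute[OF meas(3,1)])
  moreover have "L (mult_w (conv \<phi> K)) = (LINT h|lborel. \<phi> h * L (mult_w (translate h K)))"
  proof (rule bounded_form_conv[OF L K meas(1) _ conv_decaying[OF meas(1) decaying_cmod[OF b] K]])
    have "integrable lborel (\<lambda>h. cmod (mult_w \<phi> h))"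
      by (rule integrable_norm[OF decaying_integrable[OF meas(2) decaying_cmod[OF b']]])
    then show "integrable lborel (\<lambda>h. cmod (\<phi> h) * w h)" by (simp add: mult_w_def norm_mult mult.commute)
  qed
  ultimately show ?thesis by (simp add: mult.commute)
qed

text \<open>Near the origin the mean value inequality bounds the difference of the translates. Away from it
  the kernel is at most \<open>\<kappa> / w\<close>, and \<open>weighted_conv_bound\<close> applies. The function \<open>c\<close> enters only through
  the bound \<open>M\<close>, which makes the approximation uniform on bounded sets.\<close>

lemma approximate_identity_jet:
  "\<exists>C\<ge>0. \<forall>k \<delta> \<kappa>. (\<forall>h. 0 \<le> k h) \<longrightarrow> has_bochner_integral lborel k 1 \<longrightarrow> 0 < \<delta> \<longrightarrow> \<delta> \<le> 1 \<longrightarrow>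
     (\<forall>h. \<delta> \<le> norm h \<longrightarrow> k h \<le> \<kappa> * inverse (w h)) \<longrightarrow> \<kappa> \<ge> 0 \<longrightarrow>
     (\<forall>c\<in>decaying. \<forall>M. (\<forall>x. w x * jet (Suc N) c x \<le> M) \<longrightarrow>
       (\<forall>x. w x * jet N (\<lambda>x. conv (\<lambda>h. of_real (k h)) c x - c x) x \<le> C * (\<delta> + \<kappa>) * M))"
proof -
  obtain E where E: "E \<ge> 0" "\<forall>c\<in>smooth_functions. \<forall>M. (\<forall>x. w x * jet (Suc N) c x \<le> M) \<longrightarrow>
      (\<forall>s h x. norm (s - h) \<le> 1 \<longrightarrow> w x * jet N (\<lambda>x. c (x - s) - c (x - h)) x \<le> E * (M * (norm (s - h) * w h)))"
    using translate_diff_jet[of N] by blast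
  define I where "I = (LINT h|lborel. inverse (w h))"
  have I: "I \<ge> 0" by (simp add: I_def integral_nonneg_AE)
  define C where "C = E * w 0 + conv_norm + I"
  have C: "C \<ge> 0" using E(1) I conv_norm_nonneg by (simp add: C_def)
  have "w x * jet N (\<lambda>x. conv (\<lambda>h. of_real (k h)) c x - c x) x \<le> C * (\<delta> + \<kappa>) * M"
    if k: "\<forall>h. 0 \<le> k h" "has_bochner_integral lborel k 1" and \<delta>: "0 < \<delta>" "\<delta> \<le> 1"
      and \<kappa>: "\<forall>h. \<delta> \<le> norm h \<longrightarrow> k h \<le> \<kappa> * inverse (w h)" "\<kappa> \<ge> 0"
      and c: "c \<in> decaying" and M: "\<forall>x. w x * jet (Suc N) c x \<le> M" for k \<delta> \<kappa> c M x
  proof -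
    have cB: "c \<in> B_space" by (rule decaying_subset_B_space[OF c])
    have sm: "c \<in> smooth_functions" by (rule decaying_smooth[OF c])
    have ik: "integrable lborel k" "(LINT h|lborel. k h) = 1" using k(2) by (auto simp: has_bochner_integral_iff)
    have ikc: "integrable lborel (\<lambda>h. complex_of_real (k h))" using ik(1) by (rule integrable_of_real)
    have [measurable]: "k \<in> borel_measurable borel" using borel_measurable_integrable[OF ik(1)] by simp
    have M0: "0 \<le> M" using M jet_nonneg[of "Suc N" c 0] by (meson mult_nonneg_nonneg order_trans w_nonneg)
    have MN: "w x * jet N c x \<le> M" for x
      using M mult_left_mono[OF jet_mono[of N "Suc N" c x] w_nonneg[of x]] by (meson le_SucI order_refl order_trans)
    have int: "integrable lborel (\<lambda>h. of_real (k h) * (partials is c (x - h) - partials is c x))" for "is"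
      unfolding right_diff_distrib
      using integrable_mult_B_space[OF ikc B_space_partials[OF cB]] ikc
      by (intro Bochner_Integration.integrable_diff integrable_mult_left) auto
    have P: "partials is (\<lambda>x. conv (\<lambda>h. of_real (k h)) c x - c x) x =
        (LINT h|lborel. of_real (k h) * (partials is c (x - h) - partials is c x))" for "is"
    proof -
      have "(LINT h|lborel. complex_of_real (k h)) = 1" using ik(2) by (simp add: integral_complex_of_real)
      then have 1: "(LINT h|lborel. of_real (k h) * partials is c x) = partials is c x"
        by (subst integral_mult_left_zero) simp
      have 2: "(LINT h|lborel. of_real (k h) * (partials is c (x - h) - partials is c x)) =
          conv (\<lambda>h. of_real (k h)) (partials is c) x - (LINT h|lborel. of_real (k h) * partials is c x)"
        unfolding right_diff_distrib conv_def
        using integrable_mult_B_space[OF ikc B_space_partials[OF cB]] ikc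
        by (intro Bochner_Integration.integral_diff integrable_mult_left) auto
      show ?thesis
        unfolding 2 1 by (simp add: partials_diff[OF conv_smooth(2)[OF ikc cB] sm] conv_smooth(1)[OF ikc cB])
    qed
    define J where "J h = (\<Sum>is | length is \<le> N. cmod (partials is c (x - h) - partials is c x))" for h
    have J_translate: "J h = jet N (\<lambda>x. c (x - h) - c (x - 0)) x" for h
      using partials_diff[OF smooth_translate[OF sm, of h] sm]
      unfolding J_def jet_def by (simp add: partials_translate) (simp add: translate_def)
    have J_near: "w x * J h \<le> E * w 0 * \<delta> * M" if "norm h < \<delta>" for h
    proof -
      have "w x * J h \<le> E * (M * (norm (h - 0) * w 0))"
        unfolding J_translate using that \<delta> by (intro E(2)[rule_format, OF sm M[rule_format]]) auto
      also have "\<dots> \<le> E * (M * (\<delta> * w 0))"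
        using that E(1) M0 by (intro mult_left_mono mult_right_mono) auto
      finally show ?thesis by (simp add: mult_ac)
    qed
    have J_far: "w x * J h \<le> w x * jet N c (x - h) + M" for h
    proof -
      have "J h \<le> jet N c (x - h) + jet N c x"
        unfolding J_def jet_def sum.distrib[symmetric] by (intro sum_mono norm_triangle_ineq4)
      then have "w x * J h \<le> w x * (jet N c (x - h) + jet N c x)" by (rule mult_left_mono) simp
      then show ?thesis using MN[of x] by (simp add: distrib_left)
    qed
    define a where "a h = (if norm h < \<delta> then 0 else k h)" for h
    have a_meas [measurable]: "a \<in> borel_measurable borel" unfolding a_def by measurable
    have a_bound: "\<bar>a h\<bar> \<le> \<kappa> * inverse (w h)" for h using k(1) \<kappa> by (auto simp: a_def)
    have a0: "0 \<le> a h" for h using k(1) by (simp add: a_def)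
    have pw: "w x * (k h * J h) \<le> (E * w 0 * \<delta> * M) * k h + (w x * (\<bar>a h\<bar> * jet N c (x - h)) + (M * \<kappa>) * inverse (w h))" for h
    proof (cases "norm h < \<delta>")
      case True
      from mult_left_mono[OF J_near[OF True], of "k h"] k(1)
      have "w x * (k h * J h) \<le> (E * w 0 * \<delta> * M) * k h" by (simp add: mult_ac)
      moreover have "0 \<le> (M * \<kappa>) * inverse (w h)" using M0 \<kappa> by simp
      ultimately show ?thesis using True by (simp add: a_def)
    next
      case False
      have ah: "a h = k h" "0 \<le> k h" using False k(1) by (auto simp: a_def)
      have "k h * (w x * J h) \<le> k h * (w x * jet N c (x - h) + M)"
        by (intro mult_left_mono J_far ah(2))
      moreover have "M * k h \<le> M * (\<kappa> * inverse (w h))" using a_bound[of h] ah M0 by (intro mult_left_mono) auto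
      moreover have "0 \<le> (E * w 0 * \<delta> * M) * k h" using E(1) \<delta> M0 ah by simp
      ultimately show ?thesis using ah by (simp add: algebra_simps)
    qed
    have int_a: "integrable lborel (\<lambda>h. \<bar>a h\<bar> * jet N c (x - h))"
    proof -
      have "integrable lborel (\<lambda>h. complex_of_real (a h))"
        by (rule decaying_integrable[where K=\<kappa>]) (use a_bound in auto)
      from integrable_mult_jet[OF this cB] show ?thesis by simp
    qed
    have conv_a: "w x * (LINT h|lborel. \<bar>a h\<bar> * jet N c (x - h)) \<le> conv_norm * \<kappa> * M"
      by (rule weighted_conv_bound[OF a_meas a_bound]) (use MN in \<open>auto simp: jet_nonneg intro: jet_measurable sm\<close>)
    have "w x * jet N (\<lambda>x. conv (\<lambda>h. of_real (k h)) c x - c x) x \<le>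
        w x * (\<Sum>is | length is \<le> N. LINT h|lborel. cmod (of_real (k h) * (partials is c (x - h) - partials is c x)))"
      unfolding jet_def P by (intro mult_left_mono sum_mono) auto
    also have "\<dots> = (LINT h|lborel. w x * (k h * J h))"
    proof -
      have "k h * J h = (\<Sum>is | length is \<le> N. cmod (of_real (k h) * (partials is c (x - h) - partials is c x)))" for h
        using k(1) by (simp add: J_def norm_mult sum_distrib_left)
      then show ?thesis using int by (simp add: Bochner_Integration.integral_sum)
    qed
    also have "\<dots> \<le> (LINT h|lborel. (E * w 0 * \<delta> * M) * k h + (w x * (\<bar>a h\<bar> * jet N c (x - h)) + (M * \<kappa>) * inverse (w h)))"
    proof (rule integral_mono[OF _ _ pw])
      have "integrable lborel (\<lambda>h. \<Sum>is | length is \<le> N. cmod (of_real (k h) * (partials is c (x - h) - partials is c x)))"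
        using int by (intro Bochner_Integration.integrable_sum integrable_norm)
      moreover have "(\<Sum>is | length is \<le> N. cmod (of_real (k h) * (partials is c (x - h) - partials is c x))) = k h * J h" for h
        using k(1) by (simp add: J_def norm_mult sum_distrib_left)
      ultimately show "integrable lborel (\<lambda>h. w x * (k h * J h))" by simp
      show "integrable lborel (\<lambda>h. (E * w 0 * \<delta> * M) * k h + (w x * (\<bar>a h\<bar> * jet N c (x - h)) + (M * \<kappa>) * inverse (w h)))"
        using ik(1) int_a w_integrable by (intro Bochner_Integration.integrable_add integrable_mult_right)
    qed
    also have "\<dots> = (E * w 0 * \<delta> * M) * 1 + (w x * (LINT h|lborel. \<bar>a h\<bar> * jet N c (x - h)) + (M * \<kappa>) * I)"
      using ik int_a w_integrable by (simp add: I_def)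
    also have "\<dots> \<le> E * w 0 * \<delta> * M + (conv_norm * \<kappa> * M + M * \<kappa> * I)" using conv_a by simp
    also have "\<dots> \<le> C * (\<delta> + \<kappa>) * M"
    proof -
      have "E * w 0 * \<delta> \<le> C * \<delta>" "(conv_norm + I) * \<kappa> \<le> C * \<kappa>"
        using E(1) I conv_norm_nonneg \<delta> \<kappa> by (auto simp: C_def intro!: mult_right_mono)
      then have "(E * w 0 * \<delta> + (conv_norm + I) * \<kappa>) * M \<le> (C * \<delta> + C * \<kappa>) * M" using M0 by (intro mult_right_mono) auto
      then show ?thesis by (simp add: algebra_simps)
    qed
    finally show ?thesis .
  qed
  then show ?thesis using C by (intro exI[of _ C]) auto
qed

end

section \<open>The strong dual\<close>

lemma linear_space_B_dot_dual: "linear_space B_dot_dual"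
  unfolding linear_space_def
proof (intro conjI ballI allI)
  fix u v :: "'n::finite distr" assume uv: "u \<in> B_dot_dual" "v \<in> B_dot_dual"
  then show "(\<lambda>f. u f + v f) \<in> B_dot_dual"
    unfolding B_dot_dual_def dual_space_def linear_form_on_def
    by (auto simp: algebra_simps intro!: continuous_map_add)
next
  fix c and u :: "'n::finite distr" assume u: "u \<in> B_dot_dual"
  then have "continuous_map (seminorm_topology B_dot B_seminorms) euclidean u"
    by (simp add: B_dot_dual_def dual_space_def)
  moreover have "continuous_map euclidean euclidean (\<lambda>z :: complex. c * z)"
    by (simp add: continuous_intros)
  ultimately have "continuous_map (seminorm_topology B_dot B_seminorms) euclidean (\<lambda>f. c * u f)"
    by (rule continuous_map_compose[unfolded o_def])
  then show "(\<lambda>f. c * u f) \<in> B_dot_dual"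
    using u unfolding B_dot_dual_def dual_space_def linear_form_on_def
    by (auto simp: algebra_simps)
qed

lemma B_dot_dual_bounded_on:
  assumes u: "u \<in> B_dot_dual" and S: "bounded_subset B_dot B_seminorms S"
  shows "bdd_above ((\<lambda>f. cmod (u f)) ` S)"
proof -
  obtain N C where C: "C \<ge> 0" "\<forall>f\<in>B_dot. \<forall>M. (\<forall>x. jet N f x \<le> M) \<longrightarrow> cmod (u f) \<le> C * M"
    using B_dot_dual_bound[OF u] by blast
  obtain M where "\<And>f x. f \<in> S \<Longrightarrow> jet N f x \<le> M"
    using bounded_subset_jet[OF S B_dot_subset_B_space, of N] by metis
  then have "cmod (u f) \<le> C * M" if "f \<in> S" for f
    using C(2) that S by (auto simp: bounded_subset_def)
  then show ?thesis by (auto simp: bdd_above_def)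
qed

lemma strong_seminorms_seminorm:
  assumes "p \<in> strong_seminorms B_dot B_seminorms"
  shows "seminorm_on B_dot_dual p"
proof -
  obtain S where S: "bounded_subset B_dot B_seminorms S" "S \<noteq> {}" and p: "p = (\<lambda>u. SUP f\<in>S. cmod (u f))"
    using assms by (auto simp: strong_seminorms_def)
  have "seminorm_on B_dot_dual (\<lambda>u. SUP f\<in>S. 1 * cmod (u f))"
    by (rule seminorm_on_SUP) (use S B_dot_dual_bounded_on[OF _ S(1)] in \<open>auto simp: linear_form_on_def\<close>)
  then show ?thesis by (simp add: p)
qed

lemma limitin_pullback_topology:
  assumes "l \<in> S" "eventually (\<lambda>i. F i \<in> S) net" "limitin T (\<lambda>i. g (F i)) (g l) net"
  shows "limitin (pullback_topology S g T) F l net"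
  unfolding limitin_def
proof (intro conjI allI impI)
  show "l \<in> topspace (pullback_topology S g T)"
    using assms(1) limitin_topspace[OF assms(3)] by (simp add: topspace_pullback_topology)
  fix U assume U: "openin (pullback_topology S g T) U \<and> l \<in> U"
  then obtain V where V: "openin T V" "U = g -` V \<inter> S" by (auto simp: openin_pullback_topology)
  then have "eventually (\<lambda>i. g (F i) \<in> V) net" using assms(3) U by (auto simp: limitin_def)
  with assms(2) show "eventually (\<lambda>i. F i \<in> U) net"
    by eventually_elim (simp add: V(2))
qed

section \<open>Convergence of the Poisson integral\<close>

theorem theorem4p3:
  fixes \<alpha> :: real and f :: "'n::finite distr"
    and u :: "real^'n \<Rightarrow> real \<Rightarrow> complex"
  assumes "\<alpha> > -1"
    and "f \<in> weighted_DL1 \<alpha>"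
  defines "u \<equiv> poisson_integral \<alpha> f"
  shows "limitin (weighted_DL1_topology \<alpha>) (\<lambda>y. function_distr (\<lambda>x. u x y)) f (at_right 0)"
proof -
  note \<alpha> = assms(1)
  interpret smooth_weight "weight \<alpha> :: real^'n \<Rightarrow> real" "4 powr ((\<alpha> + real CARD('n) + 1) / 2)"
      "nat \<lceil>(\<alpha> + real CARD('n) + 1) / 2\<rceil>"
    by (rule weight_smooth_weight[OF \<alpha>])
  let ?P = "nat \<lceil>(\<alpha> + real CARD('n) + 1) / 2\<rceil>"
  define K where "K y h = complex_of_real (poisson_kernel \<alpha> y h)" for y and h :: "real^'n"
  have unweight_eq: "unweight \<alpha> g \<psi> = (if \<psi> \<in> schwartz then g (div_w \<psi>) else 0)" for g and \<psi> :: "real^'n \<Rightarrow> complex"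
    by (simp add: unweight_def mult_distr_def div_w_def)
  obtain v where v: "v \<in> B_dot_dual" "\<And>\<psi>. \<psi> \<in> schwartz \<Longrightarrow> v \<psi> = unweight \<alpha> f \<psi>"
    using assms(2) by (auto simp: weighted_DL1_def DL1_def)
  have f: "f \<phi> = v (mult_w \<phi>)" if "\<phi> \<in> schwartz" for \<phi>
    using v(2)[OF schwartz_mult_w[OF that]] schwartz_mult_w[OF that] by (simp add: unweight_eq)
  obtain N where tv: "tight_on B_dot N v" using B_dot_dual_tight[OF v(1)] by blast
  define L where "L = B_extension v"
  obtain C where L: "bounded_form N C L"
    using tight_on_B_space_bounded_form[OF B_extension_tight[OF tv]] unfolding L_def by blast
  note lin = bounded_form_linear[OF L]
  have Lv: "L g = v g" if "g \<in> B_dot" for g unfolding L_def by (rule B_extension_eq[OF tv that])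
  obtain D where D: "D \<ge> 0" "\<forall>a\<in>borel_measurable borel. \<forall>c\<in>decaying. \<forall>K M.
    (\<forall>h. cmod (a h) \<le> K * inverse (weight \<alpha> h)) \<longrightarrow> (\<forall>x. weight \<alpha> x * jet N c x \<le> M) \<longrightarrow>
    cmod (L (mult_w (conv a c))) \<le> D * (K * M)"
    using bounded_form_conv_bound[OF L] by blast
  obtain D' where D': "D' \<ge> 0" "\<forall>c\<in>decaying. \<forall>M. (\<forall>x. weight \<alpha> x * jet N c x \<le> M) \<longrightarrow> cmod (L (mult_w c)) \<le> D' * M"
    using bounded_form_mult_w[OF L] by blast
  obtain E where E: "E \<ge> 0" "\<forall>\<psi>\<in>smooth_functions. \<forall>x. weight \<alpha> x * jet N (div_w \<psi>) x \<le> E * jet N \<psi> x"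
    using jet_div_w by blast
  have BD: "\<psi> \<in> B_space" if "\<psi> \<in> B_dot" for \<psi> :: "real^'n \<Rightarrow> complex"
    using that B_dot_subset_B_space by auto
  \<comment> \<open>the extensions of \<open>w\<^sup>-\<^sup>1 u\<^sub>y\<close> to \<open>B_dot\<close>\<close>
  define V where "V y \<psi> = (if \<psi> \<in> B_dot then L (mult_w (conv (K y) (div_w \<psi>))) else 0)" for y \<psi>
  define T where "T y = function_distr (\<lambda>x. u x y)" for y
  have main: "T y \<in> weighted_DL1 \<alpha> \<and> B_dot_extension (unweight \<alpha> (T y)) = V y \<and> V y \<in> B_dot_dual" if y: "y > 0" for y
  proof -
    have Kd: "K y \<in> decaying"
      unfolding decaying_def K_def using poisson_kernel_smooth[OF y] poisson_kernel_jet[OF \<alpha> y] by blast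
    obtain k where k: "k \<ge> 0" "\<And>x. weight \<alpha> x * jet 0 (K y) x \<le> k" using decaying_jet[OF Kd] by metis
    obtain kN where kN: "kN \<ge> 0" "\<And>x. weight \<alpha> x * jet N (K y) x \<le> kN" using decaying_jet[OF Kd] by metis
    have K_bound: "cmod (K y h) \<le> k * inverse (weight \<alpha> h)" for h by (rule decaying_cmod[OF k(2)])
    have K_meas: "K y \<in> borel_measurable borel" by (rule smooth_measurable[OF decaying_smooth[OF Kd]])
    have K_int: "integrable lborel (K y)" by (rule decaying_integrable[OF K_meas K_bound])
    have conv_d: "conv (K y) c \<in> decaying" if "c \<in> decaying" for c by (rule conv_decaying[OF K_meas K_bound that])
    have S_conv: "S'_conv (function_distr (K y)) f \<phi> = (if \<phi> \<in> schwartz then L (mult_w (conv (K y) \<phi>)) else 0)" for \<phi>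
    proof (cases "\<phi> \<in> schwartz")
      case True
      then show ?thesis
        using S'_conv_decaying_kernel(2)[OF v(1) f Kd _ True] by (simp add: K_def poisson_kernel_even L_def)
    qed (simp add: S'_conv_def)
    define g where "g x = L (mult_w (translate x (K y)))" for x
    have g: "continuous_on UNIV g" unfolding g_def by (rule continuous_translate[OF L Kd])
    have fg: "function_distr g = S'_conv (function_distr (K y)) f"
    proof
      fix \<phi>
      show "function_distr g \<phi> = S'_conv (function_distr (K y)) f \<phi>"
        unfolding S_conv by (simp add: function_distr_def conv_form_continuous_function[OF L Kd] g_def)
    qed
    have "u x y = g x" for x
    proof -
      have "(THE g. continuous_on UNIV g \<and> function_distr g = S'_conv (function_distr (K y)) f) = g"
      proof (rule the_equality)
        fix g' assume "continuous_on UNIV g' \<and> function_distr g' = S'_conv (function_distr (K y)) f"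
        then show "g' = g" using g fg by (intro function_distr_continuous_inject) auto
      qed (use g fg in simp)
      moreover have "K y = (\<lambda>z. complex_of_real (poisson_kernel \<alpha> y z))" by (simp add: K_def fun_eq_iff)
      ultimately show ?thesis by (simp add: u_def poisson_integral_def)
    qed
    then have T: "T y \<phi> = (if \<phi> \<in> schwartz then L (mult_w (conv (K y) \<phi>)) else 0)" for \<phi>
      using fg by (simp add: T_def S_conv)
    have L_add: "L (mult_w (conv (K y) (\<lambda>x. c x + d x))) = L (mult_w (conv (K y) c)) + L (mult_w (conv (K y) d))"
      if "c \<in> decaying" "d \<in> decaying" for c d
      using that by (simp add: conv_add_right[OF K_int] decaying_subset_B_space mult_w_linear
          linear_form_onD(1)[OF lin] decaying_mult_w conv_d)
    have L_scale: "L (mult_w (conv (K y) (\<lambda>x. r * c x))) = r * L (mult_w (conv (K y) c))" if "c \<in> decaying" for c r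
      using that by (simp add: conv_scale mult_w_linear linear_form_onD(2)[OF lin] decaying_mult_w conv_d)
    have T_tempered: "T y \<in> tempered_distr"
    proof (rule tempered_distrI[where N=N and P="?P" and C="D * k"])
      show "linear_form_on schwartz (T y)"
        unfolding linear_form_on_def
        by (auto simp: T L_add L_scale schwartz_decaying linear_space_add[OF linear_space_schwartz]
            linear_space_scale[OF linear_space_schwartz])
      show "cmod (T y \<phi>) \<le> D * k * M" if \<phi>: "\<phi> \<in> schwartz" and M: "\<And>x. (1 + (norm x)\<^sup>2) ^ ?P * jet N \<phi> x \<le> M" for \<phi> M
      proof -
        have "weight \<alpha> x * jet N \<phi> x \<le> M" for x
          by (rule order_trans[OF mult_right_mono[OF w_poly jet_nonneg] M])
        then have "cmod (L (mult_w (conv (K y) \<phi>))) \<le> D * (k * M)"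
          using K_bound by (intro D(2)[rule_format] K_meas schwartz_decaying \<phi>) auto
        then show ?thesis using \<phi> by (simp add: T mult.assoc)
      qed
    qed (use D(1) k(1) in \<open>auto simp: T\<close>)
    have V_lin: "linear_form_on B_dot (V y)"
      unfolding linear_form_on_def
      by (auto simp: V_def div_w_linear L_add L_scale decaying_div_w BD linear_space_add[OF linear_space_B_dot]
          linear_space_scale[OF linear_space_B_dot])
    have V_bound: "cmod (V y \<psi>) \<le> (D * k * E) * M" if \<psi>: "\<psi> \<in> B_dot" and M: "\<And>x. jet N \<psi> x \<le> M" for \<psi> M
    proof -
      have "weight \<alpha> x * jet N (div_w \<psi>) x \<le> E * M" for x
        using E(2)[rule_format, OF B_space_smooth[OF BD[OF \<psi>]], of x] mult_left_mono[OF M E(1), of x] by linarith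
      then have "cmod (L (mult_w (conv (K y) (div_w \<psi>)))) \<le> D * (k * (E * M))"
        using K_bound by (intro D(2)[rule_format] K_meas decaying_div_w BD \<psi>) auto
      then show ?thesis using \<psi> by (simp add: V_def mult.assoc)
    qed
    have V_dual: "V y \<in> B_dot_dual"
      by (rule B_dot_dualI[where N=N and C="D * k * E"])
        (use V_lin V_bound D(1) k(1) E(1) in \<open>auto simp: V_def\<close>)
    have uT: "unweight \<alpha> (T y) \<psi> = (if \<psi> \<in> schwartz then V y \<psi> else 0)" for \<psi>
      using schwartz_div_w[of \<psi>] schwartz_subset_B_dot by (auto simp: unweight_eq T V_def)
    have "unweight \<alpha> (T y) \<in> tempered_distr"
    proof (rule tempered_distrI[where N=N and P=0 and C="D * k * E"])
      show "linear_form_on schwartz (unweight \<alpha> (T y))"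
        using V_lin schwartz_subset_B_dot linear_space_schwartz
        unfolding linear_form_on_def linear_space_def uT by (auto simp: subset_iff)
      show "cmod (unweight \<alpha> (T y) \<psi>) \<le> D * k * E * M"
        if "\<psi> \<in> schwartz" "\<And>x. (1 + (norm x)\<^sup>2) ^ 0 * jet N \<psi> x \<le> M" for \<psi> M
        using that schwartz_subset_B_dot V_bound[of \<psi> M] by (auto simp: uT)
    qed (use D(1) k(1) E(1) in \<open>auto simp: uT\<close>)
    then have "T y \<in> weighted_DL1 \<alpha>"
      using T_tempered V_dual uT unfolding weighted_DL1_def DL1_def by auto
    moreover have "B_dot_extension (unweight \<alpha> (T y)) = V y"
      by (rule B_dot_extension_eq[OF V_dual]) (simp add: uT)
    ultimately show ?thesis using V_dual by blast
  qed
  have pos: "eventually (\<lambda>y::real. y > 0) (at_right 0)" by (rule eventually_at_right_less)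
  have lim_V: "limitin B_dot_dual_strong V v (at_right 0)"
    unfolding B_dot_dual_strong_def
  proof (rule limitin_seminorm_topologyI[OF linear_space_B_dot_dual strong_seminorms_seminorm v(1)])
    show V_ev: "eventually (\<lambda>y. V y \<in> B_dot_dual) (at_right 0)"
      using pos by eventually_elim (use main in blast)
    fix p assume p: "p \<in> strong_seminorms (B_dot :: (real^'n \<Rightarrow> complex) set) B_seminorms"
    obtain S where S: "bounded_subset B_dot B_seminorms S" "S \<noteq> {}" and p_eq: "p = (\<lambda>u. SUP f\<in>S. cmod (u f))"
      using p by (auto simp: strong_seminorms_def)
    obtain E1 where E1: "E1 \<ge> 0" "\<forall>\<psi>\<in>smooth_functions. \<forall>x. weight \<alpha> x * jet (Suc N) (div_w \<psi>) x \<le> E1 * jet (Suc N) \<psi> x"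
      using jet_div_w by blast
    obtain M where M: "\<And>\<psi> x. \<psi> \<in> S \<Longrightarrow> jet (Suc N) \<psi> x \<le> M"
      using bounded_subset_jet[OF S(1) B_dot_subset_B_space, of "Suc N"] by metis
    obtain A where A: "A \<ge> 0" "\<forall>k \<delta> \<kappa>. (\<forall>h. 0 \<le> k h) \<longrightarrow> has_bochner_integral lborel k 1 \<longrightarrow> 0 < \<delta> \<longrightarrow> \<delta> \<le> 1 \<longrightarrow>
     (\<forall>h. \<delta> \<le> norm h \<longrightarrow> k h \<le> \<kappa> * inverse (weight \<alpha> h)) \<longrightarrow> \<kappa> \<ge> 0 \<longrightarrow>
     (\<forall>c\<in>decaying. \<forall>M. (\<forall>x. weight \<alpha> x * jet (Suc N) c x \<le> M) \<longrightarrow>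
       (\<forall>x. weight \<alpha> x * jet N (\<lambda>x. conv (\<lambda>h. of_real (k h)) c x - c x) x \<le> A * (\<delta> + \<kappa>) * M))"
      using approximate_identity_jet[of N] by blast
    define B where "B = D' * (A * (E1 * M))"
    have B: "B \<ge> 0"
    proof -
      obtain \<psi> where "\<psi> \<in> S" using S(2) by auto
      from order_trans[OF jet_nonneg M[OF this]] have "M \<ge> 0" .
      then show ?thesis using D'(1) A(1) E1(1) by (simp add: B_def)
    qed
    have le: "p (\<lambda>\<psi>. V y \<psi> - v \<psi>) \<le> B * (\<delta> + \<kappa>)"
      if y: "y > 0" and \<delta>: "0 < \<delta>" "\<delta> \<le> 1" and \<kappa>: "\<kappa> \<ge> 0"
        "\<forall>h :: real^'n. \<delta> \<le> norm h \<longrightarrow> poisson_kernel \<alpha> y h \<le> \<kappa> * inverse (weight \<alpha> h)" for y \<delta> \<kappa>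
      unfolding p_eq
    proof (rule cSUP_least[OF S(2)])
      fix \<psi> assume \<psi>S: "\<psi> \<in> S"
      have \<psi>: "\<psi> \<in> B_dot" using \<psi>S S(1) by (auto simp: bounded_subset_def)
      have d: "div_w \<psi> \<in> decaying" by (rule decaying_div_w[OF BD[OF \<psi>]])
      have Kd: "K y \<in> decaying"
        unfolding decaying_def K_def using poisson_kernel_smooth[OF y] poisson_kernel_jet[OF \<alpha> y] by blast
      obtain k where k: "\<And>x. weight \<alpha> x * jet 0 (K y) x \<le> k" using decaying_jet[OF Kd] by metis
      have cd: "conv (K y) (div_w \<psi>) \<in> decaying"
        by (rule conv_decaying[OF smooth_measurable[OF decaying_smooth[OF Kd]] decaying_cmod[OF k] d])
      have "weight \<alpha> x * jet (Suc N) (div_w \<psi>) x \<le> E1 * M" for x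
        using E1(2)[rule_format, OF B_space_smooth[OF BD[OF \<psi>]], of x] mult_left_mono[OF M[OF \<psi>S] E1(1), of x] by linarith
      then have "weight \<alpha> x * jet N (\<lambda>x. conv (K y) (div_w \<psi>) x - div_w \<psi> x) x \<le> A * (\<delta> + \<kappa>) * (E1 * M)" for x
        unfolding K_def using \<delta> \<kappa> poisson_kernel_nonneg[OF \<alpha>] poisson_kernel_integral[OF \<alpha> y]
        by (intro A(2)[rule_format] d) auto
      then have "cmod (L (mult_w (\<lambda>x. conv (K y) (div_w \<psi>) x - div_w \<psi> x))) \<le> D' * (A * (\<delta> + \<kappa>) * (E1 * M))"
        by (intro D'(2)[rule_format] linear_form_mult_w_diff[OF lin cd d]) auto
      then show "cmod (V y \<psi> - v \<psi>) \<le> B * (\<delta> + \<kappa>)"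
        using \<psi> by (simp add: linear_form_mult_w_diff[OF lin cd d] V_def Lv B_def mult_ac)
    qed
    show "((\<lambda>y. p (\<lambda>\<psi>. V y \<psi> - v \<psi>)) \<longlongrightarrow> 0) (at_right 0)"
    proof (rule tendstoI)
      fix e :: real assume e: "e > 0"
      \<comment> \<open>first choose the radius \<open>\<delta>\<close> around the origin, then let \<open>y\<close> tend to \<open>0\<close>\<close>
      define \<delta> where "\<delta> = min 1 (e / (2 * (B + 1)))"
      have \<delta>: "0 < \<delta>" "\<delta> \<le> 1" "B * \<delta> \<le> e / 2"
      proof -
        show "0 < \<delta>" "\<delta> \<le> 1" using e B by (auto simp: \<delta>_def)
        have "B * \<delta> \<le> B * (e / (2 * (B + 1)))" using B by (intro mult_left_mono) (auto simp: \<delta>_def)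
        also have "\<dots> \<le> e / 2" using e B by (simp add: field_simps)
        finally show "B * \<delta> \<le> e / 2" .
      qed
      obtain Q where Q: "Q \<ge> 0" "\<forall>y>0. \<forall>h :: real^'n. \<delta> \<le> norm h \<longrightarrow>
          poisson_kernel \<alpha> y h \<le> Q * y powr (\<alpha> + 1) * inverse (weight \<alpha> h)"
        using poisson_kernel_off_origin[OF \<alpha> \<delta>(1,2), where 'n='n] by blast
      have "((\<lambda>y. B * (Q * y powr (\<alpha> + 1))) \<longlongrightarrow> B * (Q * 0)) (at_right 0)"
      proof (intro tendsto_intros)
        have "((\<lambda>y. y powr (\<alpha> + 1)) \<longlongrightarrow> 0 powr (\<alpha> + 1)) (at_right 0)"
          by (rule tendsto_powr') (use \<alpha> in \<open>auto intro!: tendsto_intros simp: eventually_at_right_less eventually_mono[OF eventually_at_right_less]\<close>)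
        then show "((\<lambda>y. y powr (\<alpha> + 1)) \<longlongrightarrow> 0) (at_right 0)" by simp
      qed
      then have "eventually (\<lambda>y. B * (Q * y powr (\<alpha> + 1)) < e / 2) (at_right 0)"
        using e by (intro order_tendstoD(2)) auto
      with pos V_ev show "eventually (\<lambda>y. dist (p (\<lambda>\<psi>. V y \<psi> - v \<psi>)) 0 < e) (at_right 0)"
      proof eventually_elim
        case (elim y)
        have "p (\<lambda>\<psi>. V y \<psi> - v \<psi>) \<le> B * (\<delta> + Q * y powr (\<alpha> + 1))"
          using elim(1) \<delta> Q by (intro le) auto
        moreover have "0 \<le> p (\<lambda>\<psi>. V y \<psi> - v \<psi>)"
          by (rule seminorm_onD(1)[OF strong_seminorms_seminorm[OF p] linear_space_diff[OF linear_space_B_dot_dual elim(2) v(1)]])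
        ultimately show ?case using elim(3) \<delta>(3) by (simp add: distrib_left)
      qed
    qed
  qed
  have ext_f: "B_dot_extension (unweight \<alpha> f) = v" by (rule B_dot_extension_eq[OF v])
  show ?thesis
    unfolding weighted_DL1_topology_def T_def[symmetric]
  proof (rule limitin_pullback_topology[OF assms(2)])
    show "eventually (\<lambda>y. T y \<in> weighted_DL1 \<alpha>) (at_right 0)"
      using pos by eventually_elim (use main in blast)
    have "eventually (\<lambda>y. V y = B_dot_extension (unweight \<alpha> (T y))) (at_right 0)"
      using pos by eventually_elim (use main in auto)
    from limitin_transform_eventually[OF this lim_V]
    show "limitin B_dot_dual_strong (\<lambda>y. B_dot_extension (unweight \<alpha> (T y)))
        (B_dot_extension (unweight \<alpha> f)) (at_right 0)"
      by (simp add: ext_f)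
  qed
qed

end
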